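(* Given a weighted ring loading instance with nonnegative edge costs $c\colon E\to\mathbb{R}_{\ge0}$ and a fractional solution $x\in Q_C$, there is a polynomial-time algorithm that computes an unsplittable solution $\mathcal{P}=(P_i)_{i\in[k]}$ such that $$\sum_{i=1}^k d_i\, c(P_i)\le c^T x\qquad\text{and}\qquad \sum_{i\in[k]:\,e\in P_i}d_i\le x_e+\tfrac{13}{5}\,d_{\max}\quad\forall e\in E,$$ where $c(P)=\sum_{e\in P}c(e)$ and $d_{\max}=\max_{i\in[k]}d_i$.
   Context: A ring loading instance consists of an undirected cycle $C=(V,E)$ and $k$ commodities, commodity $i\in[k]$ given by a pair of distinct vertices $\{s_i,t_i\}\subseteq V$ and a demand $d_i\in\mathbb{R}_{\ge0}$. For each $i$, let $P_i^1,P_i^2\subseteq E$ be the two $s_i$-$t_i$ paths in $C$. A fractional solution is a vector $x$ in $$Q_C=\Big\{x\in\mathbb{R}^E_{\ge0}:\exists\lambda_i\in[0,1]\ (i\in[k])\text{ with } x(e)=\sum_{i:\,e\in P_i^1}\lambda_id_i+\sum_{i:\,e\in P_i^2}(1-\lambda_i)d_i\ \forall e\in E\Big\}.$$ An unsplittable solution is $\mathcal{P}=(P_i)_{i\in[k]}$ with $P_i\in\{P_i^1,P_i^2\}$ for each $i$. A weighted instance additionally has edge costs $c\colon E\to\mathbb{R}_{\ge0}$. *)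

theory Defs
  imports
    Complex_Main
    "HOL-Library.Log_Nat"
    "HOL-Computational_Algebra.Polynomial"
begin

section \<open>The cycle and its paths\<close>

text \<open>
  The undirected cycle with \<open>n \<ge> 3\<close> vertices has vertex set \<open>{..<n}\<close>; its edges are named by
  \<open>{..<n}\<close> as well, edge \<open>j\<close> joining \<open>j\<close> and \<open>j + 1\<close> modulo \<open>n\<close>.
\<close>

definition ends :: "nat \<Rightarrow> nat \<Rightarrow> nat set" where
  "ends n j = {j, Suc j mod n}"

text \<open>
  \<open>arc n s t\<close> is the edge set of the path that runs from \<open>s\<close> to \<open>t\<close> in the direction of increasing
  vertex numbers. The two \<open>s\<close>-\<open>t\<close> paths are \<open>arc n s t\<close> and \<open>arc n t s\<close>; see
  \<open>path_edge_sets_eq\<close> below.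
\<close>

definition arc :: "nat \<Rightarrow> nat \<Rightarrow> nat \<Rightarrow> nat set" where
  "arc n s t = {(s + l) mod n | l. l < (t + n - s) mod n}"

definition cycle_path :: "nat \<Rightarrow> nat \<Rightarrow> nat \<Rightarrow> nat list \<Rightarrow> bool" where
  "cycle_path n s t vs \<longleftrightarrow> vs \<noteq> [] \<and> hd vs = s \<and> last vs = t \<and> distinct vs \<and> set vs \<subseteq> {..<n} \<and>
     (\<forall>i. Suc i < length vs \<longrightarrow> {vs ! i, vs ! Suc i} \<in> ends n ` {..<n})"

definition path_edges :: "nat \<Rightarrow> nat list \<Rightarrow> nat set" where
  "path_edges n vs = {j. j < n \<and> (\<exists>i. Suc i < length vs \<and> ends n j = {vs ! i, vs ! Suc i})}"

lemma suc_mod_inj: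
  assumes "a < n" "b < n" "Suc a mod n = Suc b mod n"
  shows "a = (b::nat)"
  using assms by (auto simp: mod_Suc split: if_splits)

lemma ends_inj:
  assumes "3 \<le> n" "a < n" "b < n" "ends n a = ends n b"
  shows "a = b"
  using assms by (auto simp: ends_def doubleton_eq_iff mod_Suc split: if_splits)

lemma cycle_path_rev: "cycle_path n s t vs \<Longrightarrow> cycle_path n t s (rev vs)"
proof -
  assume p: "cycle_path n s t vs"
  have "{rev vs ! i, rev vs ! Suc i} \<in> ends n ` {..<n}" if "Suc i < length vs" for i
  proof -
    have "Suc (length vs - Suc (Suc i)) = length vs - Suc i" using that by simp
    moreover have "Suc (length vs - Suc (Suc i)) < length vs" using that by simp
    ultimately have "{vs ! (length vs - Suc (Suc i)), vs ! (length vs - Suc i)} \<in> ends n ` {..<n}"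
      using p unfolding cycle_path_def by metis
    then show ?thesis using that by (simp add: rev_nth insert_commute)
  qed
  then show ?thesis using p by (auto simp: cycle_path_def hd_rev last_rev)
qed

lemma path_edges_rev_subset: "path_edges n vs \<subseteq> path_edges n (rev vs)"
proof
  fix j assume "j \<in> path_edges n vs"
  then obtain i where i: "j < n" "Suc i < length vs" "ends n j = {vs ! i, vs ! Suc i}"
    by (auto simp: path_edges_def)
  let ?i = "length vs - Suc (Suc i)"
  have "Suc ?i < length (rev vs)" "rev vs ! ?i = vs ! Suc i" "rev vs ! Suc ?i = vs ! i"
    using i(2) by (simp_all add: rev_nth Suc_diff_Suc)
  then show "j \<in> path_edges n (rev vs)"
    using i unfolding path_edges_def by (auto simp: insert_commute intro!: exI[of _ ?i])
qed

lemma path_edges_rev: "path_edges n (rev vs) = path_edges n vs"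
  using path_edges_rev_subset[of n vs] path_edges_rev_subset[of n "rev vs"] by auto

lemma ascending_path_edges:
  assumes n: "3 \<le> n" "s < n" "t < n" and p: "cycle_path n s t vs"
    and up: "\<And>i. Suc i < length vs \<Longrightarrow> vs ! Suc i = Suc (vs ! i) mod n"
  shows "path_edges n vs = arc n s t"
proof -
  have ne: "vs \<noteq> []" and s: "vs ! 0 = s" and t: "vs ! (length vs - 1) = t"
    using p by (auto simp: cycle_path_def hd_conv_nth last_conv_nth)
  have v: "vs ! i = (s + i) mod n" if "i < length vs" for i
    using that
  proof (induction i)
    case 0 then show ?case using s n by simp
  next
    case (Suc i) then show ?case using up[of i] by (simp add: mod_Suc_eq)
  qed
  have len: "length vs \<le> n"
    using p card_mono[of "{..<n}" "set vs"] by (auto simp: cycle_path_def distinct_card)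
  define k where "k = length vs - 1"
  have k: "k < n" "length vs = Suc k" using ne len n by (auto simp: k_def)
  have "t = (s + k) mod n" using t v[of k] k by simp
  then have k_eq: "(t + n - s) mod n = k"
    using n k by (cases "s + k < n") (auto simp: mod_if)
  have e: "ends n ((s + i) mod n) = {vs ! i, vs ! Suc i}" if "i < k" for i
    using that v[of i] up[of i] k by (simp add: ends_def)
  have "j \<in> path_edges n vs \<longleftrightarrow> j \<in> arc n s t" for j
  proof
    assume "j \<in> path_edges n vs"
    then obtain i where "j < n" "i < k" "ends n j = {vs ! i, vs ! Suc i}"
      using k by (auto simp: path_edges_def)
    then have "j = (s + i) mod n" using e ends_inj[OF n(1)] n by simp
    then show "j \<in> arc n s t" using \<open>i < k\<close> by (auto simp: arc_def k_eq)
  next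
    assume "j \<in> arc n s t"
    then show "j \<in> path_edges n vs"
      using e k n by (auto simp: arc_def k_eq path_edges_def)
  qed
  then show ?thesis by blast
qed

lemma ascending_path_exists:
  assumes "s < n" "t < n"
  shows "\<exists>vs. cycle_path n s t vs \<and> (\<forall>i. Suc i < length vs \<longrightarrow> vs ! Suc i = Suc (vs ! i) mod n)"
proof -
  define k where "k = (t + n - s) mod n"
  define vs where "vs = map (\<lambda>i. (s + i) mod n) [0..<Suc k]"
  have k: "k < n" using assms by (simp add: k_def)
  have sk: "(s + k) mod n = t" using assms by (simp add: k_def mod_simps)
  have len: "length vs = Suc k" by (simp add: vs_def)
  have nth: "vs ! i = (s + i) mod n" if "i \<le> k" for i
    using that by (simp add: vs_def del: upt_Suc)
  have inj: "inj_on (\<lambda>i. (s + i) mod n) {0..<Suc k}"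
  proof (rule inj_onI)
    fix x y assume *: "x \<in> {0..<Suc k}" "y \<in> {0..<Suc k}" "(s + x) mod n = (s + y) mod n"
    then have "x < n" "y < n" using k by auto
    then show "x = y" using *(3) assms by (auto simp: mod_if split: if_splits)
  qed
  have up: "vs ! Suc i = Suc (vs ! i) mod n" if "Suc i < length vs" for i
    using that len nth[of i] nth[of "Suc i"] by (simp add: mod_Suc_eq)
  have ne: "vs \<noteq> []" using len by auto
  have sub: "set vs \<subseteq> {..<n}" using assms by (auto simp: vs_def)
  have "{vs ! i, vs ! Suc i} \<in> ends n ` {..<n}" if "Suc i < length vs" for i
  proof -
    have "vs ! i \<in> {..<n}" using sub that nth_mem[of i vs] by fastforce
    then show ?thesis using up[OF that] unfolding ends_def by (intro image_eqI[of _ _ "vs ! i"]) simp_all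
  qed
  moreover have "distinct vs" using inj by (simp add: vs_def distinct_map del: upt_Suc)
  moreover have "hd vs = s" "last vs = t"
    using ne nth[of 0] nth[of k] len assms sk by (auto simp: hd_conv_nth last_conv_nth)
  ultimately have "cycle_path n s t vs" using ne sub by (auto simp: cycle_path_def)
  then show ?thesis using up by blast
qed

lemma path_monotone:
  assumes n: "3 \<le> n" and p: "cycle_path n s t vs"
  shows "(\<forall>i. Suc i < length vs \<longrightarrow> vs ! Suc i = Suc (vs ! i) mod n) \<or>
         (\<forall>i. Suc i < length vs \<longrightarrow> vs ! i = Suc (vs ! Suc i) mod n)"
proof -
  have lt: "vs ! i < n" if "i < length vs" for i
    using p nth_mem[OF that] by (auto simp: cycle_path_def)
  have step: "vs ! Suc i = Suc (vs ! i) mod n \<or> vs ! i = Suc (vs ! Suc i) mod n"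
    if "Suc i < length vs" for i
  proof -
    have "{vs ! i, vs ! Suc i} \<in> ends n ` {..<n}" using p that by (auto simp: cycle_path_def)
    then show ?thesis by (auto simp: ends_def doubleton_eq_iff)
  qed
  have dist: "vs ! i \<noteq> vs ! Suc (Suc i)" if "Suc (Suc i) < length vs" for i
    using p that by (auto simp: cycle_path_def nth_eq_iff_index_eq)
  show ?thesis
  proof (cases "vs ! Suc 0 = Suc (vs ! 0) mod n")
    case True
    have "vs ! Suc i = Suc (vs ! i) mod n" if "Suc i < length vs" for i
      using that
    proof (induction i)
      case (Suc i)
      then show ?case
        using step[of "Suc i"] dist[of i] lt[of i] lt[of "Suc (Suc i)"]
          suc_mod_inj[of "vs ! i" n "vs ! Suc (Suc i)"] by auto
    qed (use True in auto)
    then show ?thesis by blast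
  next
    case False
    have "vs ! i = Suc (vs ! Suc i) mod n" if "Suc i < length vs" for i
      using that
    proof (induction i)
      case 0 then show ?case using step[of 0] False by auto
    next
      case (Suc i)
      then show ?case using step[of "Suc i"] dist[of i] by auto
    qed
    then show ?thesis by blast
  qed
qed

lemma path_edge_sets_eq:
  assumes n: "3 \<le> n" "s < n" "t < n"
  shows "{path_edges n vs | vs. cycle_path n s t vs} = {arc n s t, arc n t s}"
proof (intro equalityI subsetI)
  fix A assume "A \<in> {path_edges n vs | vs. cycle_path n s t vs}"
  then obtain vs where A: "A = path_edges n vs" and p: "cycle_path n s t vs" by blast
  from path_monotone[OF n(1) p] show "A \<in> {arc n s t, arc n t s}"
  proof
    assume "\<forall>i. Suc i < length vs \<longrightarrow> vs ! Suc i = Suc (vs ! i) mod n"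
    then show ?thesis using ascending_path_edges[OF n p] A by auto
  next
    assume down: "\<forall>i. Suc i < length vs \<longrightarrow> vs ! i = Suc (vs ! Suc i) mod n"
    have "rev vs ! Suc i = Suc (rev vs ! i) mod n" if "Suc i < length (rev vs)" for i
    proof -
      have "Suc (length vs - Suc (Suc i)) = length vs - Suc i" using that by simp
      then show ?thesis
        using that down[rule_format, of "length vs - Suc (Suc i)"] by (simp add: rev_nth)
    qed
    then show ?thesis
      using ascending_path_edges[OF n(1,3,2) cycle_path_rev[OF p]] A
      by (auto simp: path_edges_rev)
  qed
next
  fix A assume "A \<in> {arc n s t, arc n t s}"
  moreover obtain vs where "cycle_path n s t vs" "path_edges n vs = arc n s t"
    using ascending_path_exists[OF n(2,3)] ascending_path_edges[OF n] by blast
  moreover obtain ws where "cycle_path n t s ws" "path_edges n ws = arc n t s"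
    using ascending_path_exists[OF n(3,2)] ascending_path_edges[OF n(1,3,2)] by blast
  ultimately show "A \<in> {path_edges n vs | vs. cycle_path n s t vs}"
    using cycle_path_rev[of n t s ws] path_edges_rev[of n ws] by blast
qed


section \<open>Weighted ring loading\<close>

record weighted_ring =
  ring_size :: nat
  num_comm :: nat
  src :: "nat \<Rightarrow> nat"
  snk :: "nat \<Rightarrow> nat"
  dem :: "nat \<Rightarrow> real"
  ecost :: "nat \<Rightarrow> real"

text \<open>
  Commodities are numbered from \<open>0\<close>. There is at least one of them, so that the maximum demand
  exists.
\<close>

definition weighted_ring_instance :: "weighted_ring \<Rightarrow> bool" where
  "weighted_ring_instance I \<longleftrightarrow>
     3 \<le> ring_size I \<and> 1 \<le> num_comm I \<and>
     (\<forall>i<num_comm I. src I i < ring_size I \<and> snk I i < ring_size I \<and> src I i \<noteq> snk I i \<and> 0 \<le> dem I i) \<and>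
     (\<forall>e<ring_size I. 0 \<le> ecost I e)"

definition path1 :: "weighted_ring \<Rightarrow> nat \<Rightarrow> nat set" where
  "path1 I i = arc (ring_size I) (src I i) (snk I i)"

definition path2 :: "weighted_ring \<Rightarrow> nat \<Rightarrow> nat set" where
  "path2 I i = arc (ring_size I) (snk I i) (src I i)"

text \<open>The values of \<open>x\<close> outside the edge set \<open>{..<ring_size I}\<close> are irrelevant.\<close>

definition fractional_solutions :: "weighted_ring \<Rightarrow> (nat \<Rightarrow> real) set" where
  "fractional_solutions I = {x.
     (\<forall>e<ring_size I. 0 \<le> x e) \<and>
     (\<exists>lam. (\<forall>i<num_comm I. 0 \<le> lam i \<and> lam i \<le> 1) \<and>
        (\<forall>e<ring_size I.
           x e = (\<Sum>i | i < num_comm I \<and> e \<in> path1 I i. lam i * dem I i)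
               + (\<Sum>i | i < num_comm I \<and> e \<in> path2 I i. (1 - lam i) * dem I i)))}"

definition unsplittable_solution :: "weighted_ring \<Rightarrow> (nat \<Rightarrow> nat set) \<Rightarrow> bool" where
  "unsplittable_solution I P \<longleftrightarrow> (\<forall>i<num_comm I. P i \<in> {path1 I i, path2 I i})"

definition max_demand :: "weighted_ring \<Rightarrow> real" where
  "max_demand I = Max (dem I ` {..<num_comm I})"

definition path_cost :: "weighted_ring \<Rightarrow> nat set \<Rightarrow> real" where
  "path_cost I P = (\<Sum>e\<in>P. ecost I e)"

definition edge_load :: "weighted_ring \<Rightarrow> (nat \<Rightarrow> nat set) \<Rightarrow> nat \<Rightarrow> real" where
  "edge_load I P e = (\<Sum>i | i < num_comm I \<and> e \<in> P i. dem I i)"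


section \<open>Polynomial time\<close>

text \<open>
  Programs run on a random access machine under the logarithmic cost criterion, with structured
  control flow. Memory cells are addressed by integers and hold integers of unbounded size; every
  evaluation step is charged the number of bits of its result (hence also of its operands, which are
  results of earlier steps). This model and multitape Turing machines simulate each other with
  polynomial overhead.
\<close>

type_synonym mem = "int \<Rightarrow> int"

datatype aexp =
    Lit int
  | Cell aexp  \<comment> \<open>contents of the cell whose address is the value of the argument\<close>
  | Plus aexp aexp
  | Minus aexp aexp
  | Times aexp aexp
  | Div aexp aexp

text \<open>\<open>Div\<close> rounds towards minus infinity, and division by \<open>0\<close> yields \<open>0\<close>.\<close>

fun aval :: "aexp \<Rightarrow> mem \<Rightarrow> int" where
  "aval (Lit z) m = z"
| "aval (Cell a) m = m (aval a m)"
| "aval (Plus a b) m = aval a m + aval b m"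
| "aval (Minus a b) m = aval a m - aval b m"
| "aval (Times a b) m = aval a m * aval b m"
| "aval (Div a b) m = aval a m div aval b m"

text \<open>Binary length including a sign bit; in particular it is positive.\<close>

definition int_size :: "int \<Rightarrow> nat" where
  "int_size z = nat (bitlen \<bar>z\<bar>) + 1"

fun acost :: "aexp \<Rightarrow> mem \<Rightarrow> nat" where
  "acost (Lit z) m = int_size z"
| "acost (Cell a) m = acost a m + int_size (m (aval a m))"
| "acost (Plus a b) m = acost a m + acost b m + int_size (aval a m + aval b m)"
| "acost (Minus a b) m = acost a m + acost b m + int_size (aval a m - aval b m)"
| "acost (Times a b) m = acost a m + acost b m + int_size (aval a m * aval b m)"
| "acost (Div a b) m = acost a m + acost b m + int_size (aval a m div aval b m)"

text \<open>
  \<open>Store a b\<close> writes the value of \<open>b\<close> to the cell whose address is the value of \<open>a\<close>. A test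
  succeeds iff the value of the expression is positive.
\<close>

datatype com =
    Skip
  | Store aexp aexp
  | Seq com com
  | Cond aexp com com
  | While aexp com

text \<open>\<open>exec c m r m'\<close>: started in memory \<open>m\<close>, \<open>c\<close> terminates in memory \<open>m'\<close> at cost \<open>r\<close>.\<close>

inductive exec :: "com \<Rightarrow> mem \<Rightarrow> nat \<Rightarrow> mem \<Rightarrow> bool" where
  Skip: "exec Skip m 1 m"
| Store: "exec (Store a b) m (acost a m + acost b m) (m(aval a m := aval b m))"
| Seq: "exec c m r m' \<Longrightarrow> exec c' m' r' m'' \<Longrightarrow> exec (Seq c c') m (r + r') m''"
| CondTrue: "0 < aval a m \<Longrightarrow> exec c m r m' \<Longrightarrow> exec (Cond a c c') m (acost a m + r) m'"
| CondFalse: "\<not> 0 < aval a m \<Longrightarrow> exec c' m r m' \<Longrightarrow> exec (Cond a c c') m (acost a m + r) m'"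
| WhileFalse: "\<not> 0 < aval a m \<Longrightarrow> exec (While a c) m (acost a m) m"
| WhileTrue: "0 < aval a m \<Longrightarrow> exec c m r m' \<Longrightarrow> exec (While a c) m' r' m'' \<Longrightarrow>
    exec (While a c) m (acost a m + r + r') m''"

lemma exec_deterministic:
  "exec c m r m' \<Longrightarrow> exec c m q n \<Longrightarrow> q = r \<and> n = m'"
proof (induction arbitrary: q n rule: exec.induct)
  case (Seq c m r m' c' r' m'')
  from Seq.prems show ?case by cases (use Seq.IH in blast)
next
  case (CondTrue a m c r m' c')
  from CondTrue.prems CondTrue.hyps show ?case by cases (use CondTrue.IH in blast)+
next
  case (CondFalse a m c' r m' c)
  from CondFalse.prems CondFalse.hyps show ?case by cases (use CondFalse.IH in blast)+
next
  case (WhileTrue a m c r m' r' m'')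
  from WhileTrue.prems WhileTrue.hyps show ?case by cases (use WhileTrue.IH in blast)+
qed (auto elim: exec.cases)

text \<open>The input is written to the cells \<open>0, 1, \<dots>\<close>; all other cells initially hold \<open>0\<close>.\<close>

definition init_mem :: "int list \<Rightarrow> mem" where
  "init_mem xs a = (if 0 \<le> a \<and> nat a < length xs then xs ! nat a else 0)"

definition input_size :: "int list \<Rightarrow> nat" where
  "input_size xs = sum_list (map int_size xs)"

definition solves_in_poly_time ::
  "com \<Rightarrow> ('a \<Rightarrow> int list) \<Rightarrow> 'a set \<Rightarrow> ('a \<Rightarrow> mem \<Rightarrow> bool) \<Rightarrow> bool" where
  "solves_in_poly_time c enc D post \<longleftrightarrow>
     (\<exists>p :: nat poly. \<forall>X\<in>D. \<exists>r m.
        exec c (init_mem (enc X)) r m \<and> r \<le> poly p (input_size (enc X)) \<and> post X m)"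


section \<open>Encoding of rational instances\<close>

definition frac_code :: "real \<Rightarrow> int list" where
  "frac_code r = (case quotient_of (THE q. real_of_rat q = r) of (a, b) \<Rightarrow> [a, b])"

definition encode_instance :: "weighted_ring \<times> (nat \<Rightarrow> real) \<Rightarrow> int list" where
  "encode_instance = (\<lambda>(I, x).
     [int (ring_size I), int (num_comm I)]
     @ concat (map (\<lambda>i. [int (src I i), int (snk I i)] @ frac_code (dem I i)) [0..<num_comm I])
     @ concat (map (\<lambda>e. frac_code (ecost I e) @ frac_code (x e)) [0..<ring_size I]))"

definition rational_data :: "weighted_ring \<Rightarrow> (nat \<Rightarrow> real) \<Rightarrow> bool" where
  "rational_data I x \<longleftrightarrow>
     (\<forall>i<num_comm I. dem I i \<in> \<rat>) \<and> (\<forall>e<ring_size I. ecost I e \<in> \<rat> \<and> x e \<in> \<rat>)"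

text \<open>The choice made for commodity \<open>i\<close> is left in cell \<open>i\<close>, as the number \<open>1\<close> or \<open>2\<close> of the path.\<close>

definition encodes_solution :: "weighted_ring \<Rightarrow> mem \<Rightarrow> (nat \<Rightarrow> nat set) \<Rightarrow> bool" where
  "encodes_solution I m P \<longleftrightarrow>
     (\<forall>i<num_comm I. m (int i) = 1 \<and> P i = path1 I i \<or> m (int i) = 2 \<and> P i = path2 I i)"

end

theory Submission
  imports Defs
begin

text \<open>
  Cut the cycle at vertex \<open>0\<close>: commodity \<open>i\<close> becomes the interval between its ends, and a fractional
  routing is an amount \<open>a i \<in> [0, d i]\<close> sent along the interval. Split commodities whose intervals do
  not cross can be shifted until one of them is unsplit, without increasing any load, so the split
  commodities may be assumed to cross pairwise. Then every deviation of a load has, up to sign, the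
  form \<open>2 S\<^sub>j - S\<^sub>m\<close> for the partial sums \<open>S\<^sub>j\<close> of the changes in the order of left ends.

  For changes of the form \<open>\<plusminus> d i\<close> there are signs with all these deviations at most \<open>2 d\<^sub>m\<^sub>a\<^sub>x\<close>: the map
  that sends \<open>q\<close> through \<open>q \<mapsto> \<bar>q - d i\<bar>\<close> for all \<open>i\<close> is continuous on \<open>[0, d\<^sub>m\<^sub>a\<^sub>x]\<close>, and at its first
  fixed point it has slope \<open>-1\<close>; the corresponding walk towards \<open>0\<close> ends in the negative of its
  start. These signs may be reversed, and one of the two choices does not increase the cost.

  Round \<open>a i / d i\<close> to a multiple of \<open>2\<^sup>-\<^sup>k\<close>, in the direction that does not increase the cost, and remove
  the binary digits one by one, least significant first, with such signs for the odd numerators. The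
  geometric series of errors stays below \<open>2 d\<^sub>m\<^sub>a\<^sub>x\<close>, and the initial rounding adds at most \<open>k 2\<^sup>-\<^sup>k d\<^sub>m\<^sub>a\<^sub>x\<close>.

  The program is given only the loads. By the cut condition on a cycle, a commodity can be routed with
  amount \<open>t\<close> on its interval iff \<open>2 t\<close> and \<open>2 (d i - t)\<close> do not exceed the slacks of the pairs of edges
  inside and outside the interval. Commodities that can be routed unsplit are fixed first; those that
  remain cross pairwise, since otherwise a shift would unsplit one of them.
\<close>

section \<open>Fractional routings\<close>

text \<open>Balanced signs handle only changes by one common fraction of the demands, whereas the
  fractions \<open>a i / d i\<close> are unrelated to each other. The common denominator
  \<open>2 ^ k\<close> removes this obstacle: all odd numerators have to move by one unit, and the
  even ones may stay. Starting from the least significant digit makes each unit twice as large as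
  the one before, so the total error is less than twice that of the last round. The constant is
  \<open>13 / 5 = 2 + 1 / 2 + 1 / 10\<close>. The series of rounds accounts for 2,
  \<open>1 / 2\<close> bounds \<open>k / 2 ^ k\<close>, and \<open>1 / 10\<close> pays for integral
  approximations of real demands, because the search for signs works on integers. Rational demands
  are scaled to integers without error. Pairwise crossing intervals have distinct left ends. The
  data of the split commodities are therefore stored at vertices, and a scan of the vertices visits
  them in the required order without any sorting.\<close>

locale chords =
  fixes n k :: nat and l r :: "nat \<Rightarrow> nat" and d :: "nat \<Rightarrow> real"
  assumes lr: "i < k \<Longrightarrow> l i < r i" "i < k \<Longrightarrow> r i < n"
    and d_nonneg: "i < k \<Longrightarrow> 0 \<le> d i"
begin

definition inside :: "nat \<Rightarrow> nat \<Rightarrow> bool" where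
  "inside i e \<longleftrightarrow> l i \<le> e \<and> e < r i"

definition load :: "nat set \<Rightarrow> (nat \<Rightarrow> real) \<Rightarrow> nat \<Rightarrow> real" where
  "load R a e = (\<Sum>i\<in>R. if inside i e then a i else d i - a i)"

text \<open>Surplus of the cut that removes the edges \<open>e\<close> and \<open>f\<close>: a
  commodity crosses this cut iff its interval contains exactly one of them. For \<open>e = f\<close>
  nothing crosses, and the value is \<open>2 * X e\<close>.\<close>

definition slack :: "nat set \<Rightarrow> (nat \<Rightarrow> real) \<Rightarrow> nat \<Rightarrow> nat \<Rightarrow> real" where
  "slack R X e f = X e + X f - (\<Sum>i\<in>R. if inside i e = inside i f then 0 else d i)"

definition feasible :: "nat set \<Rightarrow> (nat \<Rightarrow> real) \<Rightarrow> (nat \<Rightarrow> real) \<Rightarrow> bool" where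
  "feasible R X a \<longleftrightarrow> (\<forall>i\<in>R. 0 \<le> a i \<and> a i \<le> d i) \<and> (\<forall>e<n. load R a e \<le> X e)"

text \<open>The diagonal pairs \<open>e = f\<close> are included on purpose: they say that no
  capacity is negative, which is what remains of the condition once \<open>R\<close> is
  empty.\<close>

definition cut :: "nat set \<Rightarrow> (nat \<Rightarrow> real) \<Rightarrow> bool" where
  "cut R X \<longleftrightarrow> (\<forall>e<n. \<forall>f<n. 0 \<le> slack R X e f)"

definition crossing :: "nat \<Rightarrow> nat \<Rightarrow> bool" where
  "crossing i j \<longleftrightarrow> l i < l j \<and> l j < r i \<and> r i < r j \<or> l j < l i \<and> l i < r j \<and> r j < r i"

definition route :: "nat \<Rightarrow> real \<Rightarrow> (nat \<Rightarrow> real) \<Rightarrow> nat \<Rightarrow> real" where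
  "route i t X e = X e - (if inside i e then t else d i - t)"

lemma slack_commute: "slack R X e f = slack R X f e"
  unfolding slack_def by (simp add: eq_commute add.commute)

lemma slack_remove:
  assumes "finite R" "i \<in> R"
  shows "slack R X e f = slack (R - {i}) X e f - (if inside i e = inside i f then 0 else d i)"
  unfolding slack_def using assms by (simp add: sum.remove)

lemma load_remove:
  assumes "finite R" "i \<in> R"
  shows "load R a e = load (R - {i}) a e + (if inside i e then a i else d i - a i)"
  unfolding load_def using assms by (simp add: sum.remove)

text \<open>A commodity that separates \<open>e\<close> from \<open>f\<close> loads the two edges
  with \<open>t\<close> and \<open>d i - t\<close>, so capacity and demand of the cut drop equally.
  Otherwise both edges carry the same amount, hence the factor 2.\<close>

lemma slack_route:
  assumes "finite R" "i \<in> R"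
  shows "slack (R - {i}) (route i t X) e f = slack R X e f -
    (if inside i e \<and> inside i f then 2 * t else if inside i e \<or> inside i f then 0 else 2 * (d i - t))"
  unfolding slack_remove[OF assms] by (auto simp: slack_def route_def)

lemma load_ge_cut:
  assumes "\<And>i. i \<in> R \<Longrightarrow> 0 \<le> a i \<and> a i \<le> d i"
  shows "(\<Sum>i\<in>R. if inside i e = inside i f then 0 else d i) \<le> load R a e + load R a f"
  unfolding load_def sum.distrib[symmetric] by (rule sum_mono) (use assms in force)

lemma feasible_slack:
  assumes "feasible R X a" "e < n" "f < n"
  shows "0 \<le> slack R X e f"
proof -
  have "(\<Sum>i\<in>R. if inside i e = inside i f then 0 else d i) \<le> load R a e + load R a f"
    using assms by (intro load_ge_cut) (auto simp: feasible_def)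
  moreover have "load R a e \<le> X e" "load R a f \<le> X f" using assms by (auto simp: feasible_def)
  ultimately show ?thesis by (simp add: slack_def)
qed

text \<open>Commodity \<open>i\<close> loads both edges with the same amount, and the others need at
  least what they send across the cut. This is how a small slack forces every feasible routing to
  split \<open>i\<close>.\<close>

lemma feasible_slack_ge:
  assumes "finite R" "i \<in> R" "feasible R X a" "e < n" "f < n"
  shows "inside i e \<and> inside i f \<Longrightarrow> 2 * a i \<le> slack R X e f"
    and "\<not> inside i e \<and> \<not> inside i f \<Longrightarrow> 2 * (d i - a i) \<le> slack R X e f"
proof -
  have "(\<Sum>j\<in>R - {i}. if inside j e = inside j f then 0 else d j) \<le> load (R - {i}) a e + load (R - {i}) a f"
    using assms(3) by (intro load_ge_cut) (auto simp: feasible_def)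
  moreover have "load R a e \<le> X e" "load R a f \<le> X f" using assms by (auto simp: feasible_def)
  ultimately show "inside i e \<and> inside i f \<Longrightarrow> 2 * a i \<le> slack R X e f"
    and "\<not> inside i e \<and> \<not> inside i f \<Longrightarrow> 2 * (d i - a i) \<le> slack R X e f"
    using slack_remove[OF assms(1,2), of X e f] load_remove[OF assms(1,2), of a]
    by (auto simp: slack_def[of "R - {i}"])
qed

lemma feasible_insert:
  assumes "finite R" "i \<in> R" "0 \<le> t" "t \<le> d i" "feasible (R - {i}) (route i t X) a"
  shows "feasible R X (a(i := t))"
proof -
  have "load (R - {i}) (a(i := t)) e = load (R - {i}) a e" for e
    unfolding load_def by (rule sum.cong) auto
  then show ?thesis
    using assms unfolding feasible_def
    by (auto simp: load_remove[OF assms(1,2)] route_def split: if_splits)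
qed

section \<open>Sufficiency of the cut condition\<close>

lemma cut_route:
  assumes "finite R" "i \<in> R" "cut R X"
    and "\<And>e f. e < n \<Longrightarrow> f < n \<Longrightarrow> inside i e \<Longrightarrow> inside i f \<Longrightarrow> 2 * t \<le> slack R X e f"
    and "\<And>e f. e < n \<Longrightarrow> f < n \<Longrightarrow> \<not> inside i e \<Longrightarrow> \<not> inside i f \<Longrightarrow> 2 * (d i - t) \<le> slack R X e f"
  shows "cut (R - {i}) (route i t X)"
  using assms unfolding cut_def slack_route[OF assms(1,2)] by auto

text \<open>Uncrossing: the cuts \<open>{e, f'}\<close>, \<open>{f, e'}\<close> separate every commodity at least as often as \<open>{e, f}\<close>, \<open>{e', f'}\<close> do.\<close>

lemma slack_uncross_ordered:
  assumes "R \<subseteq> {..<k}" "i \<in> R" "cut R X" "e < n" "f < n" "e' < n" "f' < n"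
    and io: "inside i e" "inside i f" "\<not> inside i e'" "\<not> inside i f'"
    and ord: "e \<le> f" "e' < l i \<and> f' < l i \<and> f' \<le> e' \<or> r i \<le> f' \<and> r i \<le> e' \<and> f' \<le> e' \<or> r i \<le> f' \<and> e' < l i"
  shows "2 * d i \<le> slack R X e f + slack R X e' f'"
proof -
  let ?s = "\<lambda>j e f. if inside j e = inside j f then 0 else d j"
  have fin: "finite R" using assms(1) finite_subset by auto
  have "?s j e f + ?s j e' f' + (if j = i then 2 * d i else 0) \<le> ?s j e f' + ?s j f e'" if "j \<in> R" for j
  proof -
    have j: "j < k" "i < k" using that assms by auto
    note L = lr[OF j(1)] lr[OF j(2)]
    \<comment> \<open>In cyclic order the edges are \<open>e\<close>, \<open>f\<close>,
      \<open>f'\<close>, \<open>e'\<close>, and no interval contains two opposite ones while missing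
      the other two. These two patterns are the only ones in which the exchange of pairs would
      lose.\<close>
    have 1: "\<not> (inside j e \<and> \<not> inside j f \<and> inside j f' \<and> \<not> inside j e')"
      using L io ord unfolding inside_def by linarith
    have 2: "\<not> (\<not> inside j e \<and> inside j f \<and> \<not> inside j f' \<and> inside j e')"
      using L io ord unfolding inside_def by linarith
    show ?thesis
      using 1 2 io d_nonneg[OF j(1)]
      by (cases "inside j e"; cases "inside j f"; cases "inside j e'"; cases "inside j f'") auto
  qed
  then have "(\<Sum>j\<in>R. ?s j e f + ?s j e' f' + (if j = i then 2 * d i else 0)) \<le> (\<Sum>j\<in>R. ?s j e f' + ?s j f e')"
    by (rule sum_mono)
  then have "(\<Sum>j\<in>R. ?s j e f) + (\<Sum>j\<in>R. ?s j e' f') + 2 * d i \<le> (\<Sum>j\<in>R. ?s j e f') + (\<Sum>j\<in>R. ?s j f e')"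
    using fin assms(2) by (simp add: sum.distrib)
  moreover have "0 \<le> slack R X e f'" "0 \<le> slack R X f e'" using assms by (auto simp: cut_def)
  ultimately show ?thesis unfolding slack_def by linarith
qed

text \<open>Within each pair the names can be swapped until the four edges appear in the required
  cyclic order.\<close>

lemma slack_uncross:
  assumes "R \<subseteq> {..<k}" "i \<in> R" "cut R X" "e < n" "f < n" "e' < n" "f' < n"
    "inside i e" "inside i f" "\<not> inside i e'" "\<not> inside i f'"
  shows "2 * d i \<le> slack R X e f + slack R X e' f'"
proof -
  have *: "2 * d i \<le> slack R X e f + slack R X e' f'"
    if "e \<le> f" "e < n" "f < n" "inside i e" "inside i f" for e f
  proof -
    let ?o = "\<lambda>e' f'. e' < l i \<and> f' < l i \<and> f' \<le> e' \<or> r i \<le> f' \<and> r i \<le> e' \<and> f' \<le> e' \<or> r i \<le> f' \<and> e' < l i"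
    have "?o e' f' \<or> ?o f' e'" using assms(10,11) unfolding inside_def by linarith
    then show ?thesis
      using slack_uncross_ordered[of R i X e f e' f'] slack_uncross_ordered[of R i X e f f' e'] assms that
      by (auto simp: slack_commute[of R X f' e'])
  qed
  show ?thesis using *[of e f] *[of f e] assms by (cases "e \<le> f") (auto simp: slack_commute[of R X f e])
qed

lemma route_bounds_exist:
  assumes "R \<subseteq> {..<k}" "i \<in> R" "cut R X"
  shows "\<exists>t. 0 \<le> t \<and> t \<le> d i \<and>
    (\<forall>e<n. \<forall>f<n. inside i e \<longrightarrow> inside i f \<longrightarrow> 2 * t \<le> slack R X e f) \<and>
    (\<forall>e<n. \<forall>f<n. \<not> inside i e \<longrightarrow> \<not> inside i f \<longrightarrow> 2 * (d i - t) \<le> slack R X e f)"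
proof -
  \<comment> \<open>The minimum of \<open>S\<close> is twice the largest amount that the demand and
    the pairs inside the interval permit. Room for the rest outside comes from uncrossing; if
    \<open>2 * d i\<close> attains the minimum, the rest is \<open>0\<close>.\<close>
  define S where "S = insert (2 * d i) ((\<lambda>(e, f). slack R X e f) ` {(e, f). e < n \<and> f < n \<and> inside i e \<and> inside i f})"
  define t where "t = Min S / 2"
  have "finite {(e, f). e < n \<and> f < n \<and> inside i e \<and> inside i f}"
    by (rule finite_subset[of _ "{..<n} \<times> {..<n}"]) auto
  then have S: "finite S" "S \<noteq> {}" by (auto simp: S_def)
  have d: "0 \<le> d i" using assms d_nonneg by auto
  have "Min S \<in> S" using S by (rule Min_in)
  moreover have le: "Min S \<le> s" if "s \<in> S" for s using S that by simp
  moreover have "0 \<le> s" if "s \<in> S" for s using that assms(3) d by (auto simp: S_def cut_def)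
  moreover have "2 * d i \<le> s + slack R X e f"
    if "s \<in> S" "e < n" "f < n" "\<not> inside i e" "\<not> inside i f" for s e f
  proof -
    have "0 \<le> slack R X e f" using that assms(3) by (auto simp: cut_def)
    then show ?thesis using that slack_uncross[OF assms] by (auto simp: S_def)
  qed
  ultimately have m: "0 \<le> Min S" "\<And>e f. e < n \<Longrightarrow> f < n \<Longrightarrow> \<not> inside i e \<Longrightarrow> \<not> inside i f \<Longrightarrow> 2 * d i \<le> Min S + slack R X e f"
    by blast+
  have "Min S \<le> 2 * d i" by (rule le) (simp add: S_def)
  moreover have "Min S \<le> slack R X e f" if "e < n" "f < n" "inside i e" "inside i f" for e f
    using that by (intro le) (auto simp: S_def)
  ultimately have "0 \<le> t \<and> t \<le> d i \<and>
    (\<forall>e<n. \<forall>f<n. inside i e \<longrightarrow> inside i f \<longrightarrow> 2 * t \<le> slack R X e f) \<and>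
    (\<forall>e<n. \<forall>f<n. \<not> inside i e \<longrightarrow> \<not> inside i f \<longrightarrow> 2 * (d i - t) \<le> slack R X e f)"
    using m by (fastforce simp: t_def)
  then show ?thesis by blast
qed

text \<open>A special case of the Okamura-Seymour theorem. One commodity is routed at a time, by an
  amount that leaves the cut condition intact for the others.\<close>

lemma cut_feasible:
  assumes "R \<subseteq> {..<k}" "cut R X"
  shows "\<exists>a. feasible R X a"
proof -
  have "finite R" using assms(1) finite_subset by auto
  then show ?thesis using assms
  proof (induction R arbitrary: X rule: finite_psubset_induct)
    case (psubset R)
    show ?case
    proof (cases "R = {}")
      case True
      then have "0 \<le> X e" if "e < n" for e
        using psubset.prems(2) that by (fastforce simp: cut_def slack_def)
      then show ?thesis using True by (auto simp: feasible_def load_def)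
    next
      case False
      then obtain i where i: "i \<in> R" by blast
      obtain t where t: "0 \<le> t" "t \<le> d i"
        "\<forall>e<n. \<forall>f<n. inside i e \<longrightarrow> inside i f \<longrightarrow> 2 * t \<le> slack R X e f"
        "\<forall>e<n. \<forall>f<n. \<not> inside i e \<longrightarrow> \<not> inside i f \<longrightarrow> 2 * (d i - t) \<le> slack R X e f"
        using route_bounds_exist[OF psubset.prems(1) i psubset.prems(2)] by blast
      have "cut (R - {i}) (route i t X)"
        using t i psubset by (intro cut_route) auto
      then obtain a where "feasible (R - {i}) (route i t X) a"
        using psubset.IH[of "R - {i}" "route i t X"] i psubset.prems by auto
      then show ?thesis using feasible_insert[OF psubset.hyps i t(1,2)] by blast
    qed
  qed
qed

section \<open>Removing split commodities that do not cross\<close>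

lemma load_upd2:
  assumes "finite R" "i \<in> R" "j \<in> R" "i \<noteq> j"
  shows "load R (a(i := u, j := v)) e = load R a e
     + (if inside i e then u - a i else a i - u) + (if inside j e then v - a j else a j - v)"
proof -
  have "load (R - {i} - {j}) (a(i := u, j := v)) e = load (R - {i} - {j}) a e"
    unfolding load_def by (rule sum.cong) auto
  then show ?thesis
    using assms by (simp add: load_remove[of R i] load_remove[of "R - {i}" j])
qed

text \<open>Two split commodities that do not cross have edge-disjoint paths; moving equal amounts to
  these paths does not increase any load, and can be continued until one of the two is unsplit.\<close>

lemma unsplit_parallel:
  assumes "R \<subseteq> {..<k}" "i \<in> R" "j \<in> R" "i \<noteq> j" "feasible R X a" "\<not> crossing i j"
    and "0 < a i" "a i < d i" "0 < a j" "a j < d j"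
  shows "\<exists>u v. feasible R X (a(i := u, j := v)) \<and> (u \<in> {0, d i} \<or> v \<in> {0, d j})"
proof -
  have fin: "finite R" using assms(1) finite_subset by auto
  have L: "l i < r i" "l j < r j" using assms lr by auto
  have ok: "feasible R X (a(i := u, j := v))"
    if "0 \<le> u" "u \<le> d i" "0 \<le> v" "v \<le> d j"
      "\<And>e. (if inside i e then u - a i else a i - u) + (if inside j e then v - a j else a j - v) \<le> 0" for u v
  proof -
    have "load R (a(i := u, j := v)) e \<le> load R a e" for e
      using that(5)[of e] by (simp add: load_upd2[OF fin assms(2-4)] add.assoc)
    then show ?thesis using that(1-4) assms(5) unfolding feasible_def by (force intro: order_trans)
  qed
  consider (disj) "r i \<le> l j \<or> r j \<le> l i" | (sub) "l j \<le> l i \<and> r i \<le> r j" | (sup) "l i \<le> l j \<and> r j \<le> r i"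
    using assms(6) L unfolding crossing_def by linarith
  then show ?thesis
  proof cases
    case disj
    define t where "t = min (d i - a i) (d j - a j)"
    have "feasible R X (a(i := a i + t, j := a j + t))"
      using assms disj by (intro ok) (auto simp: t_def inside_def)
    moreover have "a i + t = d i \<or> a j + t = d j" by (auto simp: t_def min_def)
    ultimately show ?thesis by blast
  next
    case sub
    define t where "t = min (d i - a i) (a j)"
    have "feasible R X (a(i := a i + t, j := a j - t))"
      using assms sub by (intro ok) (auto simp: t_def inside_def)
    moreover have "a i + t = d i \<or> a j - t = 0" by (auto simp: t_def min_def)
    ultimately show ?thesis by blast
  next
    case sup
    define t where "t = min (a i) (d j - a j)"
    have "feasible R X (a(i := a i - t, j := a j + t))"
      using assms sup by (intro ok) (auto simp: t_def inside_def)
    moreover have "a i - t = 0 \<or> a j + t = d j" by (auto simp: t_def min_def)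
    ultimately show ?thesis by blast
  qed
qed

text \<open>A routing with the fewest split commodities works, since a pair that does not cross
  would allow one more to be unsplit. This serves real data; the program obtains crossing
  commodities from the cut condition.\<close>

lemma feasible_crossing_exists:
  assumes "feasible {..<k} X a"
  shows "\<exists>b. feasible {..<k} X b \<and>
    (\<forall>i<k. \<forall>j<k. i \<noteq> j \<longrightarrow> b i \<notin> {0, d i} \<longrightarrow> b j \<notin> {0, d j} \<longrightarrow> crossing i j)"
proof -
  let ?m = "\<lambda>b. card {i. i < k \<and> b i \<notin> {0, d i}}"
  obtain b where b: "feasible {..<k} X b" and min: "\<And>b'. feasible {..<k} X b' \<Longrightarrow> ?m b \<le> ?m b'"
    using ex_has_least_nat[of "feasible {..<k} X" a ?m] assms by blast
  have "crossing i j" if ij: "i < k" "j < k" "i \<noteq> j" "b i \<notin> {0, d i}" "b j \<notin> {0, d j}" for i j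
  proof (rule ccontr)
    assume "\<not> crossing i j"
    moreover have "0 < b i" "b i < d i" "0 < b j" "b j < d j"
      using b ij by (auto simp: feasible_def less_le)
    ultimately obtain u v where uv: "feasible {..<k} X (b(i := u, j := v))" "u \<in> {0, d i} \<or> v \<in> {0, d j}"
      using unsplit_parallel[of "{..<k}" i j X b] b ij by auto
    have "{h. h < k \<and> (b(i := u, j := v)) h \<notin> {0, d h}} \<subset> {h. h < k \<and> b h \<notin> {0, d h}}"
      using uv(2) ij by (auto split: if_splits)
    then have "?m (b(i := u, j := v)) < ?m b" by (intro psubset_card_mono) auto
    then show False using min[OF uv(1)] by simp
  qed
  then show ?thesis using b by blast
qed

end

section \<open>Balanced signs\<close>

text \<open>
  \<open>pos d q\<close> is the greedy walk from \<open>q\<close> towards \<open>0\<close>. It represents the unit interval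
  \<open>[pos d q j, pos d q j + 1]\<close>, whose interior never meets \<open>0\<close>; absolute values evolve by the
  continuous map \<open>p \<mapsto> \<bar>p - d j\<bar>\<close>.
\<close>

fun pos :: "(nat \<Rightarrow> int) \<Rightarrow> int \<Rightarrow> nat \<Rightarrow> int" where
  "pos d q 0 = q"
| "pos d q (Suc j) = (if pos d q j < 0 then pos d q j + d j else pos d q j - d j)"

definition dir :: "(nat \<Rightarrow> int) \<Rightarrow> int \<Rightarrow> nat \<Rightarrow> int" where
  "dir d q j = (if pos d q j < 0 then 1 else -1)"

text \<open>The partial sum and the remaining sum enter with opposite signs, as the two paths of a
  commodity do. Polymorphic, because it is bounded over the integers in the halving rounds and then
  applied to real loads.\<close>

definition tilt :: "nat \<Rightarrow> (nat \<Rightarrow> 'a::comm_ring_1) \<Rightarrow> nat \<Rightarrow> 'a" where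
  "tilt n u j = 2 * (\<Sum>v<j. u v) - (\<Sum>v<n. u v)"

definition bracket :: "(nat \<Rightarrow> int) \<Rightarrow> nat \<Rightarrow> int \<Rightarrow> int \<Rightarrow> int \<Rightarrow> bool" where
  "bracket d n D lo hi \<longleftrightarrow> 0 \<le> lo \<and> lo < hi \<and> hi \<le> D \<and> (lo = 0 \<or> lo < \<bar>pos d lo n\<bar>) \<and> \<bar>pos d hi n\<bar> \<le> hi"

text \<open>A bracket of width 1 is left unchanged, so surplus iterations do no harm.\<close>

definition bisect :: "(nat \<Rightarrow> int) \<Rightarrow> nat \<Rightarrow> int \<times> int \<Rightarrow> int \<times> int" where
  "bisect d n = (\<lambda>(lo, hi). if hi - lo > 1 then
     let mid = (lo + hi) div 2 in if \<bar>pos d mid n\<bar> > mid then (mid, hi) else (lo, mid) else (lo, hi))"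

lemma pos_eq_sum: "(\<Sum>v<j. dir d q v * d v) = pos d q j - q"
  by (induction j) (auto simp: dir_def)

lemma abs_pos_le:
  assumes "\<And>j. j < n \<Longrightarrow> 0 \<le> d j \<and> d j \<le> D" "0 \<le> q" "q \<le> D" "j \<le> n"
  shows "\<bar>pos d q j\<bar> \<le> D"
  using assms(4)
proof (induction j)
  case (Suc j)
  then show ?case using assms(1)[of j] by auto
qed (use assms in auto)

text \<open>A start below \<open>D\<close> makes the upper bound strict. Over the integers this
  leaves one unit of room, which \<open>bracket_tilt\<close> uses up.\<close>

lemma pos_less:
  assumes "\<And>j. j < n \<Longrightarrow> 0 \<le> d j \<and> d j \<le> D" "0 \<le> q" "q < D" "j \<le> n"
  shows "- D \<le> pos d q j \<and> pos d q j < D"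
  using assms(4)
proof (induction j)
  case (Suc j)
  then show ?case using assms(1)[of j] by auto
qed (use assms in auto)

text \<open>The right end \<open>pos d q j + 1\<close> never has the sign opposite to that of the
  left end. So in absolute value it too evolves by \<open>p \<mapsto> \<bar>p - d j\<bar>\<close>,
  exactly as the walk from \<open>q + 1\<close> does.\<close>

lemma abs_pos_Suc: "\<bar>pos d (q + 1) j\<bar> = \<bar>pos d q j + 1\<bar>" if "0 \<le> q"
proof (induction j)
  case (Suc j)
  then show ?case by (auto simp: abs_if split: if_splits)
qed (use that in auto)

lemma bracket_bisect:
  assumes "bracket d n D lo hi" "hi - lo \<le> 2 ^ Suc b" "bisect d n (lo, hi) = (lo', hi')"
  shows "bracket d n D lo' hi' \<and> hi' - lo' \<le> 2 ^ b"
proof -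
  have "1 \<le> (2::int) ^ b" by simp
  then show ?thesis
    using assms unfolding bracket_def bisect_def by (auto simp: Let_def split: if_splits)
qed

lemma bracket_init:
  assumes "\<And>j. j < n \<Longrightarrow> 0 \<le> d j \<and> d j \<le> D" "0 < D"
  shows "bracket d n D 0 D"
  using assms abs_pos_le[of n d D D n] by (auto simp: bracket_def)

lemma bracket_iterate:
  assumes "bracket d n D lo hi" "hi - lo \<le> 2 ^ b"
  shows "\<exists>q. (bisect d n ^^ b) (lo, hi) = (q, q + 1) \<and> bracket d n D q (q + 1)"
  using assms
proof (induction b arbitrary: lo hi)
  case 0
  then have "hi = lo + 1" by (auto simp: bracket_def)
  then show ?case using 0 by simp
next
  case (Suc b)
  obtain lo' hi' where *: "bisect d n (lo, hi) = (lo', hi')" by fastforce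
  show ?case
    using Suc.IH[of lo' hi'] bracket_bisect[OF Suc.prems *] * by (simp add: funpow_swap1)
qed

text \<open>For \<open>q > 0\<close> the left end finishes outside \<open>[- q, q]\<close> and the
  right end inside \<open>[- (q + 1), q + 1]\<close>; only the negative side allows both, so the
  unit interval ends up reversed. The value \<open>0\<close> occurs only for
  \<open>q = 0\<close>.\<close>

lemma bracket_unit:
  assumes "bracket d n D q (q + 1)"
  shows "- 2 \<le> q + pos d q n \<and> q + pos d q n \<le> 0"
  using assms abs_pos_Suc[of q d n] unfolding bracket_def by auto

text \<open>The walk from some real start in \<open>[q, q + 1]\<close> ends in the negative of its start, so it stays
  centred within \<open>[- D, D]\<close>.\<close>

lemma bracket_tilt:
  assumes "\<And>j. j < n \<Longrightarrow> 0 \<le> d j \<and> d j \<le> D" "bracket d n D q (q + 1)" "j \<le> n"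
  shows "\<bar>tilt n (\<lambda>v. dir d q v * d v) j\<bar> \<le> 2 * D"
  \<comment> \<open>The tilt equals \<open>2 * pos d q j - (q + pos d q n)\<close>, which lies
    between \<open>- 2 * D\<close> and \<open>2 * (D - 1) + 2\<close>.\<close>
  using pos_less[of n d D q j] bracket_unit[OF assms(2)] assms
  unfolding tilt_def pos_eq_sum bracket_def by auto


section \<open>Halving\<close>

text \<open>After \<open>t\<close> rounds the numerators \<open>N\<close> have denominator
  \<open>2 ^ (K - t)\<close>; multiplied by \<open>2 ^ t\<close> they are comparable with the
  initial \<open>N0\<close> over \<open>2 ^ K\<close>. The factor \<open>2 ^ t - 1\<close> is the
  sum of the weights \<open>1, 2, ..., 2 ^ (t - 1)\<close> of the rounds done.\<close>

definition halving_inv ::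
  "nat \<Rightarrow> nat \<Rightarrow> (nat \<Rightarrow> int) \<Rightarrow> int \<Rightarrow> (nat \<Rightarrow> real) \<Rightarrow> (nat \<Rightarrow> int) \<Rightarrow> nat \<Rightarrow> (nat \<Rightarrow> int) \<Rightarrow> bool" where
  "halving_inv n K dd D H N0 t N \<longleftrightarrow> (\<forall>v<n. 0 \<le> N v \<and> N v \<le> 2 ^ (K - t)) \<and>
     (\<Sum>v<n. H v * real_of_int (N v * 2 ^ t - N0 v)) \<le> 0 \<and>
     (\<forall>j\<le>n. \<bar>tilt n (\<lambda>v. dd v * (N v * 2 ^ t - N0 v)) j\<bar> \<le> (2 ^ t - 1) * (2 * D))"

lemma tilt_add: "tilt n (\<lambda>v. u v + w v) j = tilt n u j + tilt n w j"
  by (simp add: tilt_def sum.distrib algebra_simps)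

lemma tilt_mult: "tilt n (\<lambda>v. c * u v) j = c * tilt n u j"
  by (simp add: tilt_def sum_distrib_left algebra_simps)

lemma halving_step:
  assumes inv: "halving_inv n K dd D H N0 t N" and t: "t < K" and D: "0 \<le> D"
    and e: "\<And>v. v < n \<Longrightarrow> if odd (N v) then \<bar>e v\<bar> = 1 else e v = 0"
    and tl: "\<And>j. j \<le> n \<Longrightarrow> \<bar>tilt n (\<lambda>v. dd v * e v) j\<bar> \<le> 2 * D"
    and cost: "(\<Sum>v<n. H v * real_of_int (e v)) \<le> 0"
    and N': "\<And>v. v < n \<Longrightarrow> N' v = (N v + e v) div 2"
  shows "halving_inv n K dd D H N0 (Suc t) N'"
proof -
  have 2: "2 * N' v = N v + e v" if "v < n" for v
  proof -
    have "even (N v + e v)" using e[OF that] by (auto split: if_splits simp: abs_if)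
    then show ?thesis using N'[OF that] by simp
  qed
  have eq: "N' v * 2 ^ Suc t - N0 v = (N v * 2 ^ t - N0 v) + 2 ^ t * e v" if "v < n" for v
  proof -
    have "N' v * 2 ^ Suc t = (2 * N' v) * 2 ^ t" by simp
    then show ?thesis unfolding 2[OF that] by (simp add: algebra_simps)
  qed
  \<comment> \<open>An odd numerator lies strictly between the even bounds \<open>0\<close> and
    \<open>2 ^ (K - t)\<close>, so one unit cannot take it out of the range.\<close>
  have "0 \<le> N' v \<and> N' v \<le> 2 ^ (K - Suc t)" if "v < n" for v
  proof -
    have K: "(2::int) ^ (K - t) = 2 * 2 ^ (K - Suc t)" using t by (metis Suc_diff_Suc power_Suc)
    have "0 \<le> N v" "N v \<le> 2 ^ (K - t)" using inv that by (auto simp: halving_inv_def)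
    moreover have "\<bar>e v\<bar> \<le> 1" using e[OF that] by (auto split: if_splits)
    ultimately show ?thesis using 2[OF that] K by linarith
  qed
  moreover have "(\<Sum>v<n. H v * real_of_int (N' v * 2 ^ Suc t - N0 v)) =
      (\<Sum>v<n. H v * real_of_int (N v * 2 ^ t - N0 v)) + 2 ^ t * (\<Sum>v<n. H v * real_of_int (e v))"
    unfolding sum_distrib_left sum.distrib[symmetric]
    by (rule sum.cong) (auto simp: eq[simplified] algebra_simps)
  moreover have "2 ^ t * (\<Sum>v<n. H v * real_of_int (e v)) \<le> 0"
    using cost by (simp add: mult_le_0_iff)
  moreover have "\<bar>tilt n (\<lambda>v. dd v * (N' v * 2 ^ Suc t - N0 v)) j\<bar> \<le> (2 ^ Suc t - 1) * (2 * D)" if "j \<le> n" for j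
  proof -
    have "tilt n (\<lambda>v. dd v * (N' v * 2 ^ Suc t - N0 v)) j =
        tilt n (\<lambda>v. dd v * (N v * 2 ^ t - N0 v) + 2 ^ t * (dd v * e v)) j"
      using that unfolding tilt_def
      by (intro arg_cong2[of _ _ _ _ minus] arg_cong[of _ _ "(*) 2"] sum.cong) (auto simp: eq[simplified] algebra_simps)
    also have "\<dots> = tilt n (\<lambda>v. dd v * (N v * 2 ^ t - N0 v)) j + 2 ^ t * tilt n (\<lambda>v. dd v * e v) j"
      by (simp add: tilt_add tilt_mult)
    also have "\<bar>\<dots>\<bar> \<le> (2 ^ t - 1) * (2 * D) + 2 ^ t * (2 * D)"
      using inv tl[OF that] that
      by (intro order_trans[OF abs_triangle_ineq] add_mono) (auto simp: halving_inv_def abs_mult)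
    finally show ?thesis by (simp add: algebra_simps)
  qed
  ultimately show ?thesis using inv unfolding halving_inv_def by auto
qed

lemma halving_init:
  assumes "\<And>v. v < n \<Longrightarrow> 0 \<le> N v \<and> N v \<le> 2 ^ K"
  shows "halving_inv n K dd D H N 0 N"
  using assms by (simp add: halving_inv_def tilt_def)

text \<open>Even numerators take part in the walk with demand \<open>0\<close>, so they do not move
  it. Reversing all signs through \<open>s\<close> keeps the absolute tilt and negates the
  cost.\<close>

lemma halving_round:
  assumes inv: "halving_inv n K dd D H N0 t N" and t: "t < K"
    and dd: "\<And>v. v < n \<Longrightarrow> 0 \<le> dd v \<and> dd v \<le> D"
    and q: "bracket (\<lambda>v. if odd (N v) then dd v else 0) n D q (q + 1)"
    and e: "\<And>v. v < n \<Longrightarrow> e v = (if odd (N v) then dir (\<lambda>v. if odd (N v) then dd v else 0) q v else 0)"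
    and s: "s = (if (\<Sum>v<n. H v * real_of_int (e v)) \<le> 0 then 1 else - 1)"
    and N': "\<And>v. v < n \<Longrightarrow> N' v = (N v + s * e v) div 2"
  shows "halving_inv n K dd D H N0 (Suc t) N'"
proof (rule halving_step[OF inv t])
  let ?d = "\<lambda>v. if odd (N v) then dd v else 0"
  show "0 \<le> D" using q by (simp add: bracket_def)
  show "if odd (N v) then \<bar>s * e v\<bar> = 1 else s * e v = 0" if "v < n" for v
    using that e s by (auto simp: dir_def)
  have d: "0 \<le> ?d v \<and> ?d v \<le> D" if "v < n" for v using dd[OF that] \<open>0 \<le> D\<close> by auto
  show "\<bar>tilt n (\<lambda>v. dd v * (s * e v)) j\<bar> \<le> 2 * D" if "j \<le> n" for j
  proof -
    have "tilt n (\<lambda>v. dd v * (s * e v)) j = tilt n (\<lambda>v. s * (dir ?d q v * ?d v)) j"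
      using that unfolding tilt_def
      by (intro arg_cong2[of _ _ _ _ minus] arg_cong[of _ _ "(*) 2"] sum.cong) (auto simp: e)
    then have "\<bar>tilt n (\<lambda>v. dd v * (s * e v)) j\<bar> = \<bar>tilt n (\<lambda>v. dir ?d q v * ?d v) j\<bar>"
      by (simp only: tilt_mult) (simp add: s)
    then show ?thesis using bracket_tilt[OF d q that] by simp
  qed
  have "(\<Sum>v<n. H v * real_of_int (s * e v)) = real_of_int s * (\<Sum>v<n. H v * real_of_int (e v))"
    by (simp add: sum_distrib_left algebra_simps)
  then show "(\<Sum>v<n. H v * real_of_int (s * e v)) \<le> 0" by (auto simp: s)
qed (use N' in auto)

lemma halving_exists:
  assumes dd: "\<And>v. v < n \<Longrightarrow> 0 \<le> dd v \<and> dd v \<le> D" and "0 < D"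
    and "\<And>v. v < n \<Longrightarrow> 0 \<le> N0 v \<and> N0 v \<le> 2 ^ K"
  shows "\<exists>N. halving_inv n K dd D H N0 K N"
proof -
  have "\<exists>N. halving_inv n K dd D H N0 t N" if "t \<le> K" for t
    using that
  proof (induction t)
    case 0
    then show ?case using halving_init assms(3) by blast
  next
    case (Suc t)
    then obtain N where N: "halving_inv n K dd D H N0 t N" by auto
    let ?d = "\<lambda>v. if odd (N v) then dd v else 0"
    have "bracket ?d n D 0 D" using assms by (intro bracket_init) auto
    \<comment> \<open>For existence any sufficient number of bisection steps will do; the program
      uses the bit length of the largest demand.\<close>
    moreover have "D - 0 \<le> 2 ^ nat D"
      using of_nat_less_two_power[of "nat D", where 'a = int] assms(2) by simp
    ultimately obtain q where "bracket ?d n D q (q + 1)" using bracket_iterate by blast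
    moreover define e where "e v = (if odd (N v) then dir ?d q v else 0)" for v
    moreover define s :: int where "s = (if (\<Sum>v<n. H v * real_of_int (e v)) \<le> 0 then 1 else - 1)"
    ultimately have "halving_inv n K dd D H N0 (Suc t) (\<lambda>v. (N v + s * e v) div 2)"
      using Suc.prems by (intro halving_round[OF N _ dd]) auto
    then show ?case by blast
  qed
  then show ?thesis by blast
qed


section \<open>Rounding a fractional routing with crossing split commodities\<close>

definition cost_diff :: "nat \<Rightarrow> (nat \<Rightarrow> real) \<Rightarrow> nat \<Rightarrow> nat \<Rightarrow> real" where
  "cost_diff n c lo hi = (\<Sum>e<n. if lo \<le> e \<and> e < hi then c e else - c e)"

context chords
begin

text \<open>Cost of the interval minus cost of the complementary path, that is, the rate at which
  the total cost grows with the amount on the interval.\<close>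

definition gain :: "(nat \<Rightarrow> real) \<Rightarrow> nat \<Rightarrow> real" where
  "gain c i = cost_diff n c (l i) (r i)"

text \<open>The cost is affine in the amounts, so two routings are compared through the sums of
  \<open>a i * gain c i\<close> alone.\<close>

lemma cost_load:
  "(\<Sum>e<n. c e * load R a e) =
   (\<Sum>i\<in>R. a i * gain c i) + (\<Sum>i\<in>R. d i * (\<Sum>e<n. if inside i e then 0 else c e))"
proof -
  have "(\<Sum>e<n. c e * load R a e) = (\<Sum>i\<in>R. \<Sum>e<n. c e * (if inside i e then a i else d i - a i))"
    unfolding load_def sum_distrib_left by (rule sum.swap)
  also have "\<dots> = (\<Sum>i\<in>R. a i * gain c i + d i * (\<Sum>e<n. if inside i e then 0 else c e))"
    unfolding gain_def cost_diff_def inside_def sum_distrib_left sum.distrib[symmetric]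
    by (intro sum.cong) (auto simp: algebra_simps)
  finally show ?thesis by (simp add: sum.distrib)
qed

text \<open>For pairwise crossing commodities, the set of those whose interval contains a given edge is an
  initial segment, or the complement of one, in the order of left ends.\<close>

lemma load_eq_tilt:
  fixes w :: "nat \<Rightarrow> real"
  assumes R: "R \<subseteq> {..<k}" and cr: "\<And>i j. i \<in> R \<Longrightarrow> j \<in> R \<Longrightarrow> i \<noteq> j \<Longrightarrow> crossing i j"
    and e: "e < n"
    and w: "\<And>v. v < n \<Longrightarrow> v \<notin> l ` R \<Longrightarrow> w v = 0"
  shows "\<exists>j\<le>n. \<bar>\<Sum>i\<in>R. if inside i e then w (l i) else - w (l i)\<bar> = \<bar>tilt n w j\<bar>"
proof -
  have fin: "finite R" using R finite_subset by auto
  have inj: "inj_on l R" by (rule inj_onI) (use cr in \<open>force simp: crossing_def\<close>)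
  have l: "l i < n" if "i \<in> R" for i using that R lr[of i] by auto
  have pre: "(\<Sum>v<j. w v) = (\<Sum>i\<in>R. if l i < j then w (l i) else 0)" if "j \<le> n" for j
  proof -
    have "(\<Sum>v<j. w v) = (\<Sum>v\<in>l ` {i\<in>R. l i < j}. w v)"
    proof (rule sum.mono_neutral_right)
      show "\<forall>v\<in>{..<j} - l ` {i \<in> R. l i < j}. w v = 0"
      proof
        fix v assume v: "v \<in> {..<j} - l ` {i \<in> R. l i < j}"
        then have "v \<notin> l ` R" by blast
        then show "w v = 0" using v that by (intro w) auto
      qed
    qed auto
    also have "\<dots> = (\<Sum>i\<in>{i\<in>R. l i < j}. w (l i))"
      by (rule sum.reindex_cong[of l]) (use inj in \<open>auto intro: inj_on_subset\<close>)
    finally show ?thesis using fin by (simp add: sum.inter_filter)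
  qed
  have tilt: "tilt n w j = (\<Sum>i\<in>R. if l i < j then w (l i) else - w (l i))" if "j \<le> n" for j
    unfolding tilt_def pre[OF that] pre[OF order_refl] sum_distrib_left sum_subtractf[symmetric]
    by (rule sum.cong) (auto dest: l)
  show ?thesis
  proof (cases "\<forall>i\<in>R. e < r i")
    \<comment> \<open>No interval of \<open>R\<close> ends at or before \<open>e\<close>, so those
      that start up to \<open>e\<close> are the ones that contain it.\<close>
    case True
    have "tilt n w (Suc e) = (\<Sum>i\<in>R. if inside i e then w (l i) else - w (l i))"
      using e True by (subst tilt) (auto simp: inside_def less_Suc_eq_le intro!: sum.cong)
    then show ?thesis using e by (intro exI[of _ "Suc e"]) simp
  next
    case False
    define S where "S = {i\<in>R. r i \<le> e}"
    have S: "finite S" "S \<noteq> {}" using fin False by (auto simp: S_def not_less)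
    \<comment> \<open>Crossing intervals have left and right ends in the same order, so those that
      end by \<open>e\<close> form an initial segment. Every other one starts before the last of
      these ends, and hence contains \<open>e\<close>.\<close>
    define j where "j = Suc (Max (l ` S))"
    have "Max (l ` S) \<in> l ` S" using S by (intro Max_in) auto
    then obtain m where m: "m \<in> S" "Max (l ` S) = l m" by auto
    have j: "j \<le> n" using m l[of m] by (simp add: j_def S_def Suc_leI)
    have iff: "inside i e \<longleftrightarrow> \<not> l i < j" if i: "i \<in> R" for i
    proof (cases "i = m")
      case True
      then show ?thesis using m by (auto simp: inside_def S_def j_def)
    next
      case False
      have "l i \<le> l m" if "i \<in> S" using that S unfolding m(2)[symmetric] by (intro Max_ge) auto
      then have "e < r i \<or> l i \<le> l m" using i unfolding S_def by (cases "e < r i") auto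
      moreover have "m \<in> R" "r m \<le> e" using m by (auto simp: S_def)
      moreover have "l i < r i" using i R lr(1)[of i] by auto
      moreover have "l i < l m \<and> l m < r i \<and> r i < r m \<or> l m < l i \<and> l i < r m \<and> r m < r i"
        using cr[OF i \<open>m \<in> R\<close> False] by (simp only: crossing_def)
      ultimately show ?thesis unfolding inside_def j_def m(2) less_Suc_eq_le by (elim disjE) simp_all
    qed
    have "tilt n w j = - (\<Sum>i\<in>R. if inside i e then w (l i) else - w (l i))"
      unfolding tilt[OF j] sum_negf[symmetric] by (rule sum.cong) (auto simp: iff)
    then show ?thesis using j by (intro exI[of _ j]) simp
  qed
qed

text \<open>The integers \<open>dd\<close> are the demands scaled by \<open>M\<close> up to an error \<open>\<eta>\<close>.\<close>

lemma round_crossing: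
  fixes z N dd :: "nat \<Rightarrow> int" and H :: "nat \<Rightarrow> real"
  assumes b: "feasible {..<k} x b"
    and R: "R \<subseteq> {..<k}" "\<And>i j. i \<in> R \<Longrightarrow> j \<in> R \<Longrightarrow> i \<noteq> j \<Longrightarrow> crossing i j"
      "\<And>i. i < k \<Longrightarrow> i \<notin> R \<Longrightarrow> b i \<in> {0, d i}" "\<And>i. i \<in> R \<Longrightarrow> 0 < d i \<and> d i \<le> Dm"
    and M: "0 < M" "0 < \<mu>" "real k * \<eta> \<le> M * Dm / 10" "real_of_int D \<le> M * Dm" "0 \<le> \<eta>" "0 \<le> Dm"
    and dd: "\<And>i. i \<in> R \<Longrightarrow> \<bar>M * d i - real_of_int (dd (l i))\<bar> \<le> \<eta>"
    and H: "\<And>i. i \<in> R \<Longrightarrow> H (l i) = \<mu> * d i * gain c i"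
    and N: "\<And>i. i \<in> R \<Longrightarrow> 0 \<le> N (l i) \<and> N (l i) \<le> 2 ^ k"
      "\<And>i. i \<in> R \<Longrightarrow> \<bar>real_of_int (N (l i)) * d i - 2 ^ k * b i\<bar> \<le> d i"
      "\<And>i. i \<in> R \<Longrightarrow> real_of_int (N (l i)) * d i * gain c i \<le> 2 ^ k * b i * gain c i"
    and out: "\<And>v. v < n \<Longrightarrow> v \<notin> l ` R \<Longrightarrow> dd v = 0 \<and> H v = 0"
    and z: "halving_inv n k dd D H N k z"
    and y: "\<And>i. i < k \<Longrightarrow> y i = (if i \<in> R then d i * real_of_int (z (l i)) else b i)"
  shows "\<forall>i<k. y i \<in> {0, d i}"
    and "(\<Sum>i<k. y i * gain c i) \<le> (\<Sum>i<k. b i * gain c i)"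
    and "\<forall>e<n. load {..<k} y e \<le> x e + 13 / 5 * Dm"
proof -
  have fin: "finite R" using R(1) finite_subset by auto
  have inj: "inj_on l R" by (rule inj_onI) (use R(2) in \<open>force simp: crossing_def\<close>)
  have l: "l i < n" "i < k" if "i \<in> R" for i using that R(1) lr[of i] by auto
  \<comment> \<open>After \<open>k\<close> rounds the denominator is \<open>2 ^ 0\<close>.\<close>
  have z01: "z (l i) \<in> {0, 1}" if "i \<in> R" for i
    using z l[OF that] unfolding halving_inv_def by force
  show "\<forall>i<k. y i \<in> {0, d i}" using y R(3) z01 by fastforce
  let ?P = "(2::real) ^ k"
  have P: "0 < ?P" by simp
  have split: "(\<Sum>i<k. f i) = (\<Sum>i\<in>R. f i) + (\<Sum>i\<in>{..<k} - R. f i)" for f :: "nat \<Rightarrow> real"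
    using R(1) by (metis add.commute finite_lessThan sum.subset_diff)
  have "(\<Sum>i\<in>R. H (l i) * real_of_int (z (l i) * 2 ^ k - N (l i))) =
      (\<Sum>v\<in>l ` R. H v * real_of_int (z v * 2 ^ k - N v))"
    using inj by (simp add: sum.reindex)
  also have "\<dots> = (\<Sum>v<n. H v * real_of_int (z v * 2 ^ k - N v))"
    using out l by (intro sum.mono_neutral_left) auto
  finally have "(\<Sum>i\<in>R. H (l i) * real_of_int (z (l i) * 2 ^ k - N (l i))) \<le> 0"
    using z by (simp add: halving_inv_def)
  then have "\<mu> * (\<Sum>i\<in>R. d i * gain c i * (real_of_int (z (l i)) * ?P - real_of_int (N (l i)))) \<le> 0"
    unfolding sum_distrib_left by (simp add: H algebra_simps)
  then have "(\<Sum>i\<in>R. d i * gain c i * (real_of_int (z (l i)) * ?P - real_of_int (N (l i)))) \<le> 0"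
    using M(2) by (simp add: mult_le_0_iff)
  then have "(\<Sum>i\<in>R. d i * gain c i * real_of_int (z (l i)) * ?P) \<le> (\<Sum>i\<in>R. real_of_int (N (l i)) * d i * gain c i)"
    by (simp add: algebra_simps sum_subtractf)
  also have "\<dots> \<le> (\<Sum>i\<in>R. ?P * b i * gain c i)" by (rule sum_mono) (rule N(3))
  finally have "?P * (\<Sum>i\<in>R. y i * gain c i) \<le> ?P * (\<Sum>i\<in>R. b i * gain c i)"
    unfolding sum_distrib_left using y l by (simp add: algebra_simps)
  then have "(\<Sum>i\<in>R. y i * gain c i) \<le> (\<Sum>i\<in>R. b i * gain c i)" using P by simp
  moreover have "(\<Sum>i\<in>{..<k} - R. y i * gain c i) = (\<Sum>i\<in>{..<k} - R. b i * gain c i)"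
    using y by (intro sum.cong) auto
  ultimately show "(\<Sum>i<k. y i * gain c i) \<le> (\<Sum>i<k. b i * gain c i)" unfolding split by simp
  show "\<forall>e<n. load {..<k} y e \<le> x e + 13 / 5 * Dm"
  proof (intro allI impI)
    fix e assume e: "e < n"
    \<comment> \<open>The part of the change that the halving rounds control, in the original scale.
      What \<open>f\<close> collects are the two rounding errors, of the demands and of the
      fractions.\<close>
    define w where "w v = real_of_int (dd v * (z v * 2 ^ k - N v)) / (M * ?P)" for v
    define f where "f i = (y i - b i) - w (l i)" for i
    have f: "\<bar>f i\<bar> \<le> \<eta> / M + Dm / ?P" if i: "i \<in> R" for i
    proof -
      let ?u = "real_of_int (z (l i)) - real_of_int (N (l i)) / ?P"
      have "real_of_int (N (l i)) \<le> real_of_int (2 ^ k)" using N(1)[OF i] by (simp only: of_int_le_iff)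
      then have "real_of_int (N (l i)) / ?P \<le> 1" using P by simp
      moreover have "0 \<le> real_of_int (N (l i)) / ?P" using N(1)[OF i] by simp
      moreover have "real_of_int (z (l i)) = 0 \<or> real_of_int (z (l i)) = 1" using z01[OF i] by auto
      ultimately have u: "\<bar>?u\<bar> \<le> 1" by linarith
      \<comment> \<open>\<open>?u\<close> is the change of the fraction. The first summand stems
        from the integral demands, the second from rounding \<open>b i / d i\<close>.\<close>
      have "f i = (M * d i - real_of_int (dd (l i))) / M * ?u + (real_of_int (N (l i)) * d i - ?P * b i) / ?P"
        using M(1) P i l[OF i] unfolding f_def w_def by (simp add: y field_simps)
      also have "\<bar>\<dots>\<bar> \<le> \<bar>(M * d i - real_of_int (dd (l i))) / M * ?u\<bar> + \<bar>(real_of_int (N (l i)) * d i - ?P * b i) / ?P\<bar>"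
        by (rule abs_triangle_ineq)
      also have "\<dots> \<le> \<eta> / M * 1 + Dm / ?P"
      proof (rule add_mono)
        show "\<bar>(M * d i - real_of_int (dd (l i))) / M * ?u\<bar> \<le> \<eta> / M * 1"
          unfolding abs_mult using dd[OF i] M u by (intro mult_mono) (auto simp: divide_right_mono)
        show "\<bar>(real_of_int (N (l i)) * d i - ?P * b i) / ?P\<bar> \<le> Dm / ?P"
          using N(2)[OF i] R(4)[OF i] by (simp add: divide_right_mono)
      qed
      finally show ?thesis by simp
    qed
    have "load {..<k} y e - load {..<k} b e = (\<Sum>i<k. if inside i e then y i - b i else - (y i - b i))"
      unfolding load_def sum_subtractf[symmetric] by (rule sum.cong) auto
    also have "\<dots> = (\<Sum>i\<in>R. if inside i e then y i - b i else - (y i - b i))"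
      using R(1) y by (intro sum.mono_neutral_right) auto
    also have "\<dots> = (\<Sum>i\<in>R. if inside i e then w (l i) else - w (l i)) + (\<Sum>i\<in>R. if inside i e then f i else - f i)"
      unfolding sum.distrib[symmetric] by (rule sum.cong) (auto simp: f_def)
    also have "\<dots> \<le> 2 * Dm + real k * (\<eta> / M + Dm / ?P)"
    proof (rule add_mono)
      obtain j where j: "j \<le> n" "\<bar>\<Sum>i\<in>R. if inside i e then w (l i) else - w (l i)\<bar> = \<bar>tilt n w j\<bar>"
        using load_eq_tilt[OF R(1,2) e, of w] out by (auto simp: w_def)
      have "tilt n w j = real_of_int (tilt n (\<lambda>v. dd v * (z v * 2 ^ k - N v)) j) / (M * ?P)"
        unfolding tilt_def w_def by (simp add: sum_divide_distrib[symmetric] diff_divide_distrib)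
      also have "\<bar>\<dots>\<bar> \<le> ?P * (2 * (M * Dm)) / (M * ?P)"
      proof -
        have "\<bar>tilt n (\<lambda>v. dd v * (z v * 2 ^ k - N v)) j\<bar> \<le> (2 ^ k - 1) * (2 * D)"
          using z j by (auto simp: halving_inv_def)
        then have "real_of_int \<bar>tilt n (\<lambda>v. dd v * (z v * 2 ^ k - N v)) j\<bar> \<le> real_of_int ((2 ^ k - 1) * (2 * D))"
          by (rule of_int_le_iff[THEN iffD2])
        also have "\<dots> = (?P - 1) * (2 * real_of_int D)" by simp
        also have "\<dots> \<le> (?P - 1) * (2 * (M * Dm))"
          using M(4) by (intro mult_left_mono) auto
        also have "\<dots> \<le> ?P * (2 * (M * Dm))"
          using M(1,6) by (intro mult_right_mono) auto
        finally have *: "\<bar>real_of_int (tilt n (\<lambda>v. dd v * (z v * 2 ^ k - N v)) j)\<bar> \<le> ?P * (2 * (M * Dm))" by simp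
        have MP: "\<bar>M * ?P\<bar> = M * ?P" "0 \<le> M * ?P" using M(1) by auto
        show ?thesis unfolding abs_divide MP(1) by (rule divide_right_mono[OF * MP(2)])
      qed
      also have "\<dots> = 2 * Dm" using M(1) P by simp
      finally show "(\<Sum>i\<in>R. if inside i e then w (l i) else - w (l i)) \<le> 2 * Dm" using j(2) by linarith
      have "(\<Sum>i\<in>R. if inside i e then f i else - f i) \<le> real (card R) * (\<eta> / M + Dm / ?P)"
        using f by (intro sum_bounded_above) (force simp: abs_le_iff)
      also have "\<dots> \<le> real k * (\<eta> / M + Dm / ?P)"
        using card_mono[OF _ R(1)] M by (intro mult_right_mono) auto
      finally show "(\<Sum>i\<in>R. if inside i e then f i else - f i) \<le> real k * (\<eta> / M + Dm / ?P)" .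
    qed
    \<comment> \<open>Besides \<open>2 * Dm\<close> for the signs: \<open>Dm / 10\<close> for the
      integral demands, and \<open>Dm / 2\<close> for the fractions, as
      \<open>2 * k \<le> 2 ^ k\<close>.\<close>
    also have "\<dots> \<le> 13 / 5 * Dm"
    proof -
      have "real k * (\<eta> / M) \<le> Dm / 10" using M(1,3) by (simp add: field_simps)
      moreover have "2 * real k \<le> ?P"
      proof (cases k)
        case (Suc m)
        have "real (Suc m) \<le> 2 ^ m" using of_nat_le_iff[of "Suc m" "2 ^ m", where 'a = real] less_exp[of m]
          by (simp add: Suc_le_eq del: of_nat_Suc)
        then show ?thesis using Suc by simp
      qed auto
      then have "real k * (Dm / ?P) \<le> Dm / 2" using P M(6) mult_right_mono[of "2 * real k" ?P Dm] by (simp add: field_simps)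
      ultimately show ?thesis unfolding distrib_left by linarith
    qed
    finally have "load {..<k} y e \<le> load {..<k} b e + 13 / 5 * Dm" by simp
    moreover have "load {..<k} b e \<le> x e" using b e by (auto simp: feasible_def)
    ultimately show "load {..<k} y e \<le> x e + 13 / 5 * Dm" by linarith
  qed
qed

end

section \<open>A language of loops over arrays\<close>

text \<open>Cell \<open>i\<close> of array \<open>j < 64\<close>; the input occupies the cells with negative index.\<close>

definition adr :: "nat \<Rightarrow> int \<Rightarrow> int" where
  "adr j i = - int j - 1 - 64 * i"

definition adx :: "nat \<Rightarrow> aexp \<Rightarrow> aexp" where
  "adx j a = Minus (Lit (- int j - 1)) (Times (Lit 64) a)"

abbreviation arr :: "nat \<Rightarrow> aexp \<Rightarrow> aexp" where
  "arr j a \<equiv> Cell (adx j a)"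

abbreviation var :: "nat \<Rightarrow> aexp" where
  "var j \<equiv> arr j (Lit 0)"

definition ar :: "mem \<Rightarrow> nat \<Rightarrow> int \<Rightarrow> int" where
  "ar m j i = m (adr j i)"

definition upd :: "mem \<Rightarrow> nat \<Rightarrow> int \<Rightarrow> int \<Rightarrow> mem" where
  "upd m j i v = m(adr j i := v)"

text \<open>A loop runs a number of times that is fixed on entry, so a program denotes a total
  function on memories. Writing is restricted to arrays, so that frame conditions can be read off
  the text of the program.\<close>

datatype cm =
    Asg nat aexp aexp
  | Sq cm cm (infixr \<open>;;\<close> 60)
  | Ite aexp cm cm
  | For nat nat cm

primrec compile :: "cm \<Rightarrow> com" where
  "compile (Asg j a b) = Store (adx j a) b"
| "compile (c ;; c') = Seq (compile c) (compile c')"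
| "compile (Ite a c c') = Cond a (compile c) (compile c')"
| "compile (For v j c) = Seq (Store (adx v (Lit 0)) (Lit 0))
     (While (Minus (var j) (var v)) (Seq (compile c) (Store (adx v (Lit 0)) (Plus (var v) (Lit 1)))))"

text \<open>The counter is set to its value rather than incremented. For checked programs this
  agrees with the compiled loop, as the body may not write array \<open>v\<close>.\<close>

primrec iter :: "nat \<Rightarrow> (mem \<Rightarrow> mem) \<Rightarrow> nat \<Rightarrow> mem \<Rightarrow> mem" where
  "iter v f 0 m = upd m v 0 0"
| "iter v f (Suc t) m = upd (f (iter v f t m)) v 0 (int (Suc t))"

primrec sem :: "cm \<Rightarrow> mem \<Rightarrow> mem" where
  "sem (Asg j a b) m = upd m j (aval a m) (aval b m)"
| "sem (c ;; c') m = sem c' (sem c m)"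
| "sem (Ite a c c') m = (if 0 < aval a m then sem c m else sem c' m)"
| "sem (For v j c) m = iter v (sem c) (nat (ar m j 0)) m"

primrec wr :: "cm \<Rightarrow> nat set" where
  "wr (Asg j a b) = {j}"
| "wr (c ;; c') = wr c \<union> wr c'"
| "wr (Ite a c c') = wr c \<union> wr c'"
| "wr (For v j c) = insert v (wr c)"

definition ro :: "nat set \<Rightarrow> aexp \<Rightarrow> bool" where
  "ro RO a \<longleftrightarrow> (\<exists>z. a = Lit z) \<or> (\<exists>j\<in>RO. \<exists>e. a = arr j e)"

text \<open>Products need a read-only factor, so that each step adds only boundedly many bits.\<close>

primrec lin :: "nat set \<Rightarrow> aexp \<Rightarrow> bool" where
  "lin RO (Lit z) \<longleftrightarrow> True"
| "lin RO (Cell a) \<longleftrightarrow> lin RO a"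
| "lin RO (Plus a b) \<longleftrightarrow> lin RO a \<and> lin RO b"
| "lin RO (Minus a b) \<longleftrightarrow> lin RO a \<and> lin RO b"
| "lin RO (Times a b) \<longleftrightarrow> ro RO a \<and> lin RO a \<and> lin RO b"
| "lin RO (Div a b) \<longleftrightarrow> lin RO a \<and> lin RO b"

text \<open>Arrays from \<open>60\<close> on hold the loop bounds.\<close>

primrec chk :: "nat set \<Rightarrow> cm \<Rightarrow> bool" where
  "chk RO (Asg j a b) \<longleftrightarrow> j < 64 \<and> j \<notin> RO \<and> lin RO a \<and> lin RO b"
| "chk RO (c ;; c') \<longleftrightarrow> chk RO c \<and> chk RO c'"
| "chk RO (Ite a c c') \<longleftrightarrow> lin RO a \<and> chk RO c \<and> chk RO c'"
| "chk RO (For v j c) \<longleftrightarrow> v < 64 \<and> v \<notin> RO \<and> v \<notin> wr c \<and> j \<in> RO \<and> 60 \<le> j \<and> j < 64 \<and> chk RO c"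

primrec sz :: "aexp \<Rightarrow> nat" where
  "sz (Lit z) = int_size z"
| "sz (Cell a) = sz a + 1"
| "sz (Plus a b) = sz a + sz b + 1"
| "sz (Minus a b) = sz a + sz b + 1"
| "sz (Times a b) = sz a + sz b + 1"
| "sz (Div a b) = sz a + sz b + 1"

text \<open>With at most \<open>K\<close> iterations per loop this governs both running time and
  growth of numbers: a unit of work adds at most \<open>b + 1\<close> bits when read-only cells have
  \<open>b\<close> bits.\<close>

primrec work :: "cm \<Rightarrow> nat \<Rightarrow> nat" where
  "work (Asg j a b) K = sz (adx j a) + sz b"
| "work (c ;; c') K = work c K + work c' K"
| "work (Ite a c c') K = sz a + work c K + work c' K"
| "work (For v j c) K = (work c K + (sz (adx v (Lit 0)) + sz (Lit 0) + sz (Minus (var j) (var v)) +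
     sz (adx v (Lit 0)) + sz (Plus (var v) (Lit 1)))) * (K + 1)"

lemma adr_eq_iff: "j < 64 \<Longrightarrow> j' < 64 \<Longrightarrow> adr j i = adr j' i' \<longleftrightarrow> j = j' \<and> i = i'"
proof -
  assume j: "j < 64" "j' < 64"
  have "int j + 64 * i = int j' + 64 * i' \<longrightarrow> int j = int j'"
  proof
    assume "int j + 64 * i = int j' + 64 * i'"
    then have "(int j + 64 * i) mod 64 = (int j' + 64 * i') mod 64" by simp
    then show "int j = int j'" using j by simp
  qed
  then show ?thesis by (auto simp: adr_def)
qed

lemma adr_neg: "0 \<le> i \<Longrightarrow> adr j i < 0"
  by (simp add: adr_def)

lemma aval_adx [simp]: "aval (adx j a) m = adr j (aval a m)"
  by (simp add: adx_def adr_def)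

lemma mem_adr [simp]: "m (adr j i) = ar m j i"
  by (simp add: ar_def)

lemma ar_upd [simp]:
  assumes "j < 64" "j' < 64"
  shows "ar (upd m j i v) j' = (if j = j' then (ar m j)(i := v) else ar m j')"
  using assms by (auto simp: fun_eq_iff ar_def upd_def adr_eq_iff simp del: mem_adr)

lemma upd_input: "0 \<le> i \<Longrightarrow> 0 \<le> a \<Longrightarrow> upd m j i v a = m a"
  using adr_neg[of i j] by (auto simp: upd_def)

lemma ro_simps [simp]: "ro RO (Lit z)" "j \<in> RO \<Longrightarrow> ro RO (arr j e)"
  by (auto simp: ro_def)

lemma lin_adx [simp]: "lin RO (adx j a) \<longleftrightarrow> lin RO a"
  by (simp add: adx_def)

lemma sem_frame: "chk RO c \<Longrightarrow> j \<notin> wr c \<Longrightarrow> j < 64 \<Longrightarrow> ar (sem c m) j = ar m j"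
proof (induction c arbitrary: m)
  case (For v b c)
  have "ar (iter v (sem c) t m) j = ar m j" for t
    by (induction t) (use For in auto)
  then show ?case by simp
qed auto

lemma chk_wr: "chk RO c \<Longrightarrow> wr c \<inter> RO = {}"
  by (induction c) auto

lemma iter_counter: "chk RO (For v j c) \<Longrightarrow> ar (iter v (sem c) t m) v 0 = int t"
  by (cases t) auto

text \<open>In the step the value of the counter and the arrays not written by the loop come for
  free, so invariants need not mention them.\<close>

lemma For_inv:
  assumes "chk RO (For v j c)" "ar m j 0 = int L"
    and "I 0 (upd m v 0 0)"
    and "\<And>t m'. t < L \<Longrightarrow> ar m' v 0 = int t \<Longrightarrow>
      (\<And>j. j < 64 \<Longrightarrow> j \<notin> insert v (wr c) \<Longrightarrow> ar m' j = ar m j) \<Longrightarrow>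
      I t m' \<Longrightarrow> I (Suc t) (upd (sem c m') v 0 (int (Suc t)))"
  shows "I L (sem (For v j c) m)"
proof -
  have chk: "v < 64" "chk RO c" using assms(1) by auto
  have "I t (iter v (sem c) t m) \<and> (\<forall>j<64. j \<notin> insert v (wr c) \<longrightarrow> ar (iter v (sem c) t m) j = ar m j)" if "t \<le> L" for t
    using that
  proof (induction t)
    case 0
    then show ?case using assms(3) chk by auto
  next
    case (Suc t)
    then show ?case
      using assms(4)[of t "iter v (sem c) t m"] iter_counter[OF assms(1), of t m] chk by (auto simp: sem_frame)
  qed
  then show ?thesis using assms(2) by simp
qed

section \<open>Cost of programs in the language\<close>

lemma int_size_le: "\<bar>z\<bar> \<le> 2 ^ b \<Longrightarrow> int_size z \<le> b + 2"
proof -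
  assume z: "\<bar>z\<bar> \<le> 2 ^ b"
  have "(2::int) ^ b < 2 ^ Suc b" by (rule power_strict_increasing) auto
  then have "\<bar>z\<bar> < 2 ^ nat (int (Suc b))" using z by (simp only: nat_int)
  then have "bitlen \<bar>z\<bar> \<le> int (Suc b)" by (intro bitlen_le_iff_power[THEN iffD2]) auto
  then show ?thesis by (simp add: int_size_def)
qed

lemma abs_le_int_size: "\<bar>z\<bar> \<le> 2 ^ int_size z"
proof -
  have "\<bar>z\<bar> < 2 ^ nat (bitlen \<bar>z\<bar>)"
    using bitlen_le_iff_power[of "\<bar>z\<bar>" "bitlen \<bar>z\<bar>"] by simp
  also have "\<dots> \<le> 2 ^ int_size z" by (rule power_increasing) (auto simp: int_size_def)
  finally show ?thesis by simp
qed

lemma int_size_pos: "0 < int_size z"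
  by (simp add: int_size_def)

lemma sz_pos: "0 < sz e"
  by (induction e) (auto simp: int_size_pos)

lemma abs_div_le: "\<bar>a div b\<bar> \<le> \<bar>a :: int\<bar>"
proof (cases "b = 0")
  case False
  have *: "\<bar>a div b\<bar> \<le> \<bar>a\<bar>" if "0 < b" for a b :: int
  proof (cases "0 \<le> a")
    case True
    then show ?thesis using that div_by_1[of a] zdiv_mono2[of a 1 b] by (simp add: pos_imp_zdiv_nonneg_iff)
  next
    case False
    then have "a \<le> a div b" using that zdiv_mono2_neg[of a 1 b] by simp
    moreover have "a div b < 0" using that False by (simp add: pos_imp_zdiv_neg_iff)
    ultimately show ?thesis by simp
  qed
  show ?thesis using *[of b a] *[of "- b" "- a"] False by (cases "0 < b") auto
qed auto

definition bounded :: "mem \<Rightarrow> nat \<Rightarrow> bool" where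
  "bounded m B \<longleftrightarrow> (\<forall>a. \<bar>m a\<bar> \<le> 2 ^ B)"

definition ro_bounded :: "nat set \<Rightarrow> mem \<Rightarrow> nat \<Rightarrow> bool" where
  "ro_bounded RO m b \<longleftrightarrow> (\<forall>j\<in>RO. \<forall>i. \<bar>ar m j i\<bar> \<le> 2 ^ b)"

lemma bounded_mono: "bounded m B \<Longrightarrow> B \<le> B' \<Longrightarrow> bounded m B'"
  unfolding bounded_def by (meson one_le_numeral order_trans power_increasing)

lemma add_pow_le:
  assumes "\<bar>x::int\<bar> \<le> 2 ^ s" "\<bar>y\<bar> \<le> 2 ^ t" "s + 1 \<le> u" "t + 1 \<le> u"
  shows "\<bar>x\<bar> + \<bar>y\<bar> \<le> 2 ^ u"
proof -
  have "(2::int) ^ (s + 1) \<le> 2 ^ u" "(2::int) ^ (t + 1) \<le> 2 ^ u" using assms by (simp_all only: power_increasing one_le_numeral)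
  then show ?thesis using assms by simp
qed

text \<open>Only one factor of a product can be as large as \<open>B\<close> permits; the other is a
  literal or has \<open>b\<close> bits. So nested expressions add to the exponent instead of
  multiplying it.\<close>

lemma aval_bound:
  assumes "bounded m B" "ro_bounded RO m b" "lin RO e"
  shows "\<bar>aval e m\<bar> \<le> 2 ^ (B + sz e * (b + 1))"
  using assms(3)
proof (induction e)
  case (Lit z)
  have "\<bar>z\<bar> \<le> 2 ^ int_size z" by (rule abs_le_int_size)
  also have "\<dots> \<le> 2 ^ (B + int_size z * (b + 1))" by (intro power_increasing) auto
  finally show ?case by simp
next
  case (Cell a)
  have "\<bar>m (aval a m)\<bar> \<le> 2 ^ B" using assms(1) by (simp add: bounded_def)
  also have "\<dots> \<le> 2 ^ (B + sz (Cell a) * (b + 1))" by (intro power_increasing) auto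
  finally show ?case by simp
next
  case (Plus x y)
  have "\<bar>aval x m\<bar> + \<bar>aval y m\<bar> \<le> 2 ^ (B + sz (Plus x y) * (b + 1))"
    using Plus sz_pos[of x] sz_pos[of y] by (intro add_pow_le) (auto simp: algebra_simps)
  then show ?case by simp
next
  case (Minus x y)
  have "\<bar>aval x m\<bar> + \<bar>aval y m\<bar> \<le> 2 ^ (B + sz (Minus x y) * (b + 1))"
    using Minus sz_pos[of x] sz_pos[of y] by (intro add_pow_le) (auto simp: algebra_simps)
  then show ?case by simp
next
  case (Times x y)
  have "\<bar>aval x m\<bar> \<le> 2 ^ (sz x * (b + 1))"
  proof -
    consider z where "x = Lit z" | j a where "j \<in> RO" "x = arr j a"
      using Times.prems by (auto simp: ro_def)
    then show ?thesis
    proof cases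
      case 1
      have "\<bar>z\<bar> \<le> 2 ^ int_size z" by (rule abs_le_int_size)
      also have "\<dots> \<le> 2 ^ (int_size z * (b + 1))" by (intro power_increasing) auto
      finally show ?thesis using 1 by simp
    next
      case 2
      then have "\<bar>aval x m\<bar> \<le> 2 ^ b" using assms(2) by (simp add: ro_bounded_def)
      also have "\<dots> \<le> 2 ^ (sz x * (b + 1))"
        using sz_pos[of x] mult_le_mono1[of 1 "sz x" "b + 1"] by (intro power_increasing) auto
      finally show ?thesis .
    qed
  qed
  moreover have "\<bar>aval y m\<bar> \<le> 2 ^ (B + sz y * (b + 1))" using Times by simp
  ultimately have "\<bar>aval x m\<bar> * \<bar>aval y m\<bar> \<le> 2 ^ (sz x * (b + 1)) * 2 ^ (B + sz y * (b + 1))"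
    by (intro mult_mono) auto
  also have "\<dots> = 2 ^ (sz x * (b + 1) + (B + sz y * (b + 1)))" by (rule power_add[symmetric])
  also have "\<dots> \<le> 2 ^ (B + sz (Times x y) * (b + 1))" by (intro power_increasing) (auto simp: algebra_simps)
  finally show ?case by (simp add: abs_mult)
next
  case (Div x y)
  have "\<bar>aval x m div aval y m\<bar> \<le> \<bar>aval x m\<bar>" by (rule abs_div_le)
  also have "\<dots> \<le> 2 ^ (B + sz x * (b + 1))" using Div by simp
  also have "\<dots> \<le> 2 ^ (B + sz (Div x y) * (b + 1))" by (intro power_increasing) (auto simp: algebra_simps)
  finally show ?case by simp
qed

lemma acost_bound:
  assumes "bounded m B" "ro_bounded RO m b" "lin RO e" "B + sz e * (b + 1) + 2 \<le> Z"
  shows "acost e m \<le> sz e * Z"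
  using assms(3,4)
proof (induction e)
  case (Lit z)
  have "int_size z * 1 \<le> int_size z * Z" using Lit by (intro mult_le_mono2) auto
  then show ?case by simp
next
  case (Cell a)
  then have "acost a m \<le> sz a * Z" by (simp add: algebra_simps)
  moreover have "int_size (m (aval a m)) \<le> B + 2"
    using assms(1) by (intro int_size_le) (simp add: bounded_def)
  ultimately show ?case using Cell(3) by (simp add: algebra_simps)
next
  case (Plus x y)
  have "int_size (aval (Plus x y) m) \<le> B + sz (Plus x y) * (b + 1) + 2"
    by (rule int_size_le[OF aval_bound[OF assms(1,2) Plus.prems(1)]])
  with Plus show ?case by (simp add: algebra_simps)
next
  case (Minus x y)
  have "int_size (aval (Minus x y) m) \<le> B + sz (Minus x y) * (b + 1) + 2"
    by (rule int_size_le[OF aval_bound[OF assms(1,2) Minus.prems(1)]])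
  with Minus show ?case by (simp add: algebra_simps)
next
  case (Times x y)
  have "int_size (aval (Times x y) m) \<le> B + sz (Times x y) * (b + 1) + 2"
    by (rule int_size_le[OF aval_bound[OF assms(1,2) Times.prems(1)]])
  with Times show ?case by (simp add: algebra_simps)
next
  case (Div x y)
  have "int_size (aval (Div x y) m) \<le> B + sz (Div x y) * (b + 1) + 2"
    by (rule int_size_le[OF aval_bound[OF assms(1,2) Div.prems(1)]])
  with Div show ?case by (simp add: algebra_simps)
qed

lemma bounded_ar: "bounded m B \<Longrightarrow> \<bar>ar m j i\<bar> \<le> 2 ^ B"
  unfolding bounded_def ar_def by blast

lemma bounded_upd:
  assumes "bounded m B" "\<bar>v\<bar> \<le> 2 ^ B" shows "bounded (upd m j i v) B"
  using assms by (auto simp: bounded_def upd_def)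

lemma exec_Store:
  assumes "bounded m B" "ro_bounded RO m b" "lin RO a" "lin RO e" "B + (sz (adx j a) + sz e) * (b + 1) + 2 \<le> Z"
  shows "exec (Store (adx j a) e) m (acost (adx j a) m + acost e m) (upd m j (aval a m) (aval e m))"
    and "acost (adx j a) m + acost e m \<le> (sz (adx j a) + sz e) * Z"
    and "bounded (upd m j (aval a m) (aval e m)) (B + sz e * (b + 1))"
proof -
  show "exec (Store (adx j a) e) m (acost (adx j a) m + acost e m) (upd m j (aval a m) (aval e m))"
    using exec.Store[of "adx j a" e m] by (simp add: upd_def)
  have "acost (adx j a) m \<le> sz (adx j a) * Z" "acost e m \<le> sz e * Z"
    using assms(3-5) by (auto intro!: acost_bound[OF assms(1,2)] simp: add_mult_distrib)
  then show "acost (adx j a) m + acost e m \<le> (sz (adx j a) + sz e) * Z" by (simp add: algebra_simps)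
  show "bounded (upd m j (aval a m) (aval e m)) (B + sz e * (b + 1))"
    using aval_bound[OF assms(1,2,4)] bounded_mono[OF assms(1)] by (intro bounded_upd) auto
qed

lemma ro_bounded_sem:
  assumes "chk RO c" "RO \<subseteq> {..<64}" "ro_bounded RO m b"
  shows "ro_bounded RO (sem c m) b"
  using assms chk_wr[OF assms(1)] sem_frame[OF assms(1)] unfolding ro_bounded_def
  by (metis disjoint_iff lessThan_iff subsetD)

lemma ro_bounded_upd:
  assumes "j < 64" "j \<notin> RO" "RO \<subseteq> {..<64}" "ro_bounded RO m b"
  shows "ro_bounded RO (upd m j i v) b"
  using assms unfolding ro_bounded_def by (auto split: if_splits)

text \<open>The memory bound \<open>B\<close> grows along the run, additively with the work. The
  majorants \<open>Q\<close>, \<open>W\<close> and \<open>Z\<close> are fixed for the whole program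
  before the induction, so that each expression costs at most its size times
  \<open>Z\<close>.\<close>

lemma exec_cm:
  assumes "chk RO c" "RO \<subseteq> {..<64}" "bounded m B" "ro_bounded RO m b"
    and "\<And>j. j \<in> RO \<Longrightarrow> 60 \<le> j \<Longrightarrow> ar m j 0 \<le> int K"
    and "B + work c K * (b + 1) \<le> Q" "Q + W * (b + 1) + 2 \<le> Z" "work c K \<le> W"
  shows "\<exists>r. exec (compile c) m r (sem c m) \<and> r \<le> work c K * Z \<and> bounded (sem c m) (B + work c K * (b + 1))"
  using assms
proof (induction c arbitrary: m B)
  case (Asg j a e)
  have "(sz (adx j a) + sz e) * (b + 1) \<le> W * (b + 1)" using Asg.prems by (intro mult_le_mono1) simp
  then have "B + (sz (adx j a) + sz e) * (b + 1) + 2 \<le> Z" using Asg.prems by simp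
  note S = exec_Store[OF Asg.prems(3,4) _ _ this]
  have "bounded (sem (Asg j a e) m) (B + work (Asg j a e) K * (b + 1))"
    by (rule bounded_mono[of _ "B + sz e * (b + 1)"]) (use S(3) Asg.prems(1) in \<open>auto simp: algebra_simps\<close>)
  then show ?case using S(1,2) Asg.prems(1) by auto
next
  case (Sq c c')
  obtain r where r: "exec (compile c) m r (sem c m)" "r \<le> work c K * Z" "bounded (sem c m) (B + work c K * (b + 1))"
    using Sq.IH(1)[of m B] Sq.prems by (auto simp: algebra_simps)
  have "ar (sem c m) j 0 \<le> int K" if "j \<in> RO" "60 \<le> j" for j
  proof -
    have "j \<notin> wr c" using chk_wr[of RO c] Sq.prems(1) that by auto
    then show ?thesis using that sem_frame[of RO c j m] Sq.prems(1,2,5) by auto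
  qed
  then obtain r' where "exec (compile c') (sem c m) r' (sem c' (sem c m))" "r' \<le> work c' K * Z"
     "bounded (sem c' (sem c m)) (B + work c K * (b + 1) + work c' K * (b + 1))"
    using Sq.IH(2)[of "sem c m" "B + work c K * (b + 1)"] Sq.prems r(3) ro_bounded_sem[of RO c m b]
    by (auto simp: algebra_simps)
  then show ?case using r exec.Seq[of "compile c" m r "sem c m" "compile c'" r']
    by (intro exI[of _ "r + r'"]) (auto simp: algebra_simps)
next
  case (Ite e c c')
  have "sz e * (b + 1) \<le> W * (b + 1)" using Ite.prems by (intro mult_le_mono1) simp
  then have e: "acost e m \<le> sz e * Z" using Ite.prems by (intro acost_bound[of m B RO b]) auto
  show ?case
  proof (cases "0 < aval e m")
    case True
    obtain r where "exec (compile c) m r (sem c m)" "r \<le> work c K * Z" "bounded (sem c m) (B + work c K * (b + 1))"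
      using Ite.IH(1)[of m B] Ite.prems by (auto simp: algebra_simps)
    then show ?thesis using True e exec.CondTrue[of e m "compile c" r "sem c m" "compile c'"]
      by (intro exI[of _ "acost e m + r"]) (auto simp: algebra_simps intro: bounded_mono)
  next
    case False
    obtain r where "exec (compile c') m r (sem c' m)" "r \<le> work c' K * Z" "bounded (sem c' m) (B + work c' K * (b + 1))"
      using Ite.IH(2)[of m B] Ite.prems by (auto simp: algebra_simps)
    then show ?thesis using False e exec.CondFalse[of e m "compile c'" r "sem c' m" "compile c"]
      by (intro exI[of _ "acost e m + r"]) (auto simp: algebra_simps intro: bounded_mono)
  qed
next
  case (For v j c)
  define w1 where "w1 = sz (adx v (Lit 0)) + sz (Lit 0)"
  define w2 where "w2 = sz (Minus (var j) (var v))"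
  define w3 where "w3 = sz (adx v (Lit 0)) + sz (Plus (var v) (Lit 1))"
  define w where "w = work c K + (w1 + w2 + w3)"
  define L where "L = nat (ar m j 0)"
  define M where "M t = iter v (sem c) t m" for t
  have work: "work (For v j c) K = w * (K + 1)" by (simp add: w_def w1_def w2_def w3_def)
  have chk: "chk RO c" "v < 64" "v \<notin> RO" "v \<notin> wr c" "j \<in> RO" "60 \<le> j" "j < 64" using For.prems by auto
  have L: "L \<le> K" using For.prems(5)[OF chk(5,6)] by (simp add: L_def)
  have wW: "w \<le> W" "w * K + w \<le> W" using For.prems(8)[unfolded work] by auto
  have wb: "x * (b + 1) \<le> w * (b + 1)" if "x \<le> w" for x using that by (rule mult_le_mono1)
  have ws: "w1 \<le> w" "w2 \<le> w" "w3 \<le> w" "work c K + w3 \<le> w" by (auto simp: w_def)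
  have tw: "t * w * (b + 1) + w * (b + 1) \<le> (w * (K + 1)) * (b + 1)" if "t \<le> K" for t
  proof -
    have "(t + 1) * w \<le> (K + 1) * w" using that by (intro mult_le_mono1) simp
    then have "(t + 1) * w * (b + 1) \<le> (K + 1) * w * (b + 1)" by (rule mult_le_mono1)
    then show ?thesis by (simp add: algebra_simps)
  qed
  have Q: "B + t * w * (b + 1) + w * (b + 1) \<le> Q" if "t \<le> K" for t
    using tw[OF that] For.prems(6)[unfolded work] by linarith
  have Z: "B + t * w * (b + 1) + x * (b + 1) + 2 \<le> Z" if "t \<le> K" "x \<le> w" for t x
    using Q[OF that(1)] wb[OF that(2)] For.prems(7) by linarith
  have bnd0: "bounded (M 0) B" using For.prems(3) by (auto simp: M_def intro: bounded_upd)
  have ro0: "ro_bounded RO (M 0) b" using For.prems chk by (auto simp: M_def intro: ro_bounded_upd)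
  have step: "\<exists>r. exec (Seq (compile c) (Store (adx v (Lit 0)) (Plus (var v) (Lit 1)))) (M t) r (M (Suc t)) \<and>
      r \<le> (work c K + w3) * Z \<and> bounded (M (Suc t)) (B + Suc t * w * (b + 1)) \<and> ro_bounded RO (M (Suc t)) b \<and>
      (\<forall>j\<in>RO. 60 \<le> j \<longrightarrow> ar (M (Suc t)) j 0 = ar m j 0)"
    if t: "t < L" "bounded (M t) (B + t * w * (b + 1))" "ro_bounded RO (M t) b"
      "\<forall>j\<in>RO. 60 \<le> j \<longrightarrow> ar (M t) j 0 = ar m j 0" for t
  proof -
    have tK: "t \<le> K" using t(1) L by simp
    have "B + t * w * (b + 1) + work c K * (b + 1) \<le> Q" using Q[OF tK] wb[of "work c K"] by (simp add: w_def)
    then obtain r where r: "exec (compile c) (M t) r (sem c (M t))" "r \<le> work c K * Z"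
        "bounded (sem c (M t)) (B + t * w * (b + 1) + work c K * (b + 1))"
      using For.IH[of "M t" "B + t * w * (b + 1)"] chk t For.prems wW by (auto simp: w_def)
    have ro: "ro_bounded RO (sem c (M t)) b" using ro_bounded_sem chk t For.prems by blast
    have v: "ar (sem c (M t)) v 0 = int t"
      using sem_frame[of RO c v "M t"] chk iter_counter[OF For.prems(1), of t m] by (simp add: M_def)
    have "B + t * w * (b + 1) + work c K * (b + 1) + w3 * (b + 1) + 2 \<le> Z"
      using Z[OF tK ws(4)] by (simp add: algebra_simps)
    note Z3 = this
    have lins: "lin RO (Lit 0)" "lin RO (Plus (var v) (Lit 1))" by simp_all
    note S = exec_Store[OF r(3) ro lins Z3[unfolded w3_def], folded w3_def, unfolded aval.simps aval_adx mem_adr v]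
    have M': "M (Suc t) = upd (sem c (M t)) v 0 (int t + 1)" by (simp add: M_def add.commute)
    have "bounded (M (Suc t)) (B + Suc t * w * (b + 1))" unfolding M'
    proof (rule bounded_mono[OF S(3)])
      have "sz (Plus (var v) (Lit 1)) * (b + 1) + work c K * (b + 1) \<le> w * (b + 1)"
        using wb[of "sz (Plus (var v) (Lit 1)) + work c K"] by (simp add: w_def w3_def algebra_simps)
      then show "B + t * w * (b + 1) + work c K * (b + 1) + sz (Plus (var v) (Lit 1)) * (b + 1) \<le> B + Suc t * w * (b + 1)"
        by (simp add: algebra_simps)
    qed
    moreover have "ro_bounded RO (M (Suc t)) b" unfolding M' using ro chk For.prems by (intro ro_bounded_upd) auto
    moreover have "\<forall>j\<in>RO. 60 \<le> j \<longrightarrow> ar (M (Suc t)) j 0 = ar m j 0"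
    proof (intro ballI impI)
      fix j assume j: "j \<in> RO" "60 \<le> j"
      then have "j \<notin> wr c" "j \<noteq> v" using chk_wr[OF chk(1)] chk(3) by auto
      then show "ar (M (Suc t)) j 0 = ar m j 0"
        unfolding M' using j chk(2) t(4) For.prems(2) sem_frame[OF chk(1), of j "M t"] by (auto simp: subset_iff)
    qed
    ultimately show ?thesis
      using exec.Seq[OF r(1) S(1)] S(2) r(2) unfolding M' by (auto simp: algebra_simps intro!: exI)
  qed
  have inv: "bounded (M t) (B + t * w * (b + 1)) \<and> ro_bounded RO (M t) b \<and>
      (\<forall>j\<in>RO. 60 \<le> j \<longrightarrow> ar (M t) j 0 = ar m j 0)" if "t \<le> L" for t
    using that
  proof (induction t)
    case 0
    have "v \<noteq> j" if "j \<in> RO" for j using that chk by blast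
    then show ?case using bnd0 ro0 chk(2) For.prems(2) by (auto simp: M_def subset_iff)
  next
    case (Suc t)
    then show ?case using step[of t] by auto
  qed
  have loop: "\<exists>r. exec (While (Minus (var j) (var v)) (Seq (compile c) (Store (adx v (Lit 0)) (Plus (var v) (Lit 1))))) (M t) r (M L) \<and>
      r \<le> ((L - t) * (work c K + w3 + w2) + w2) * Z" (is "\<exists>r. exec ?while _ r _ \<and> _")
    if "t \<le> L" for t
    using that
  proof (induction "L - t" arbitrary: t)
    have cost: "acost (Minus (var j) (var v)) (M t) \<le> w2 * Z" if "t \<le> L" for t
      unfolding w2_def using inv[OF that] Z[of t w2] ws that L
      by (intro acost_bound[of _ "B + t * w * (b + 1)" RO b]) (auto simp: w2_def)
    have val: "aval (Minus (var j) (var v)) (M t) = ar m j 0 - int t" if "t \<le> L" for t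
      using inv[OF that] chk iter_counter[OF For.prems(1), of t m] by (simp add: M_def)
    {
      case 0
      then have "t = L" by simp
      then have "\<not> 0 < aval (Minus (var j) (var v)) (M t)" unfolding val[OF 0(2)] L_def by simp
      from exec.WhileFalse[OF this] \<open>t = L\<close> cost[OF 0(2)] show ?case
        by (intro exI[of _ "acost (Minus (var j) (var v)) (M t)"]) (simp del: acost.simps)
    next
      case (Suc u)
      then have t: "t < L" "u = L - Suc t" by auto
      then have pos: "0 < aval (Minus (var j) (var v)) (M t)" unfolding val[OF Suc(3)] L_def by simp
      obtain r where r: "exec (Seq (compile c) (Store (adx v (Lit 0)) (Plus (var v) (Lit 1)))) (M t) r (M (Suc t))"
        "r \<le> (work c K + w3) * Z" using step[OF t(1)] inv[of t] t by auto
      obtain r' where r': "exec ?while (M (Suc t)) r' (M L)"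
        "r' \<le> ((L - Suc t) * (work c K + w3 + w2) + w2) * Z"
        using Suc.hyps(1)[OF t(2)] t by auto
      have "L - t = Suc (L - Suc t)" using t by simp
      then have "acost (Minus (var j) (var v)) (M t) + r + r' \<le> ((L - t) * (work c K + w3 + w2) + w2) * Z"
        using cost[of t] r(2) r'(2) t by (simp add: algebra_simps)
      then show ?case using exec.WhileTrue[OF pos r(1) r'(1)] by blast
    }
  qed
  have "B + (sz (adx v (Lit 0)) + sz (Lit 0)) * (b + 1) + 2 \<le> Z"
    using Z[of 0 w1] ws by (simp add: w1_def)
  note Z1 = this
  have lin0: "lin RO (Lit 0)" by simp
  note S = exec_Store[OF For.prems(3,4) lin0 lin0 Z1, folded w1_def, unfolded aval.simps]
  have M0: "M 0 = upd m v 0 0" by (simp add: M_def)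
  obtain r where r: "exec ?while (M 0) r (M L)" "r \<le> (L * (work c K + w3 + w2) + w2) * Z"
    using loop[of 0] by auto
  have "exec (compile (For v j c)) m (acost (adx v (Lit 0)) m + acost (Lit 0) m + r) (M L)"
    using exec.Seq[OF S(1) r(1)[unfolded M0]] by simp
  moreover have "acost (adx v (Lit 0)) m + acost (Lit 0) m + r \<le> work (For v j c) K * Z"
  proof -
    have "L * (work c K + w3 + w2) \<le> K * w" using L by (intro mult_le_mono) (auto simp: w_def)
    \<comment> \<open>Initialisation and the final failing test are paid for by the extra round in
      \<open>K + 1\<close>.\<close>
    then have "w1 + (L * (work c K + w3 + w2) + w2) \<le> w * (K + 1)" by (simp add: w_def algebra_simps)
    then have "(w1 + (L * (work c K + w3 + w2) + w2)) * Z \<le> w * (K + 1) * Z" by (rule mult_le_mono1)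
    then show ?thesis using S(2) r(2) unfolding work by (simp add: algebra_simps)
  qed
  moreover have "bounded (M L) (B + work (For v j c) K * (b + 1))"
  proof (rule bounded_mono)
    show "bounded (M L) (B + L * w * (b + 1))" using inv by blast
    show "B + L * w * (b + 1) \<le> B + work (For v j c) K * (b + 1)"
      using tw[OF L] unfolding work by simp
  qed
  ultimately show ?case by (auto simp: M_def L_def)
qed


text \<open>Leaves in array \<open>62\<close> the number of halvings that take array \<open>24\<close> to \<open>0\<close>; this bounds the bisection.\<close>

definition bits_body :: com where
  "bits_body = Seq (Store (adx 3 (Lit 0)) (Div (var 3) (Lit 2))) (Store (adx 62 (Lit 0)) (Plus (var 62) (Lit 1)))"

text \<open>A genuine \<open>While\<close>, since no cell holds the number of halvings yet. Its
  result turns the bisection into a bounded loop.\<close>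

definition bits_com :: com where
  "bits_com = Seq (Seq (Store (adx 3 (Lit 0)) (var 24)) (Store (adx 62 (Lit 0)) (Lit 0))) (While (var 3) bits_body)"

text \<open>The results go to the cells \<open>0, 1, ...\<close> that held the input, hence not to
  an array; this is left to the end, when the input has been read.\<close>

definition output_body :: com where
  "output_body = Seq (Store (var 3) (arr 4 (var 3))) (Store (adx 3 (Lit 0)) (Plus (var 3) (Lit 1)))"

definition output_com :: com where
  "output_com = Seq (Store (adx 3 (Lit 0)) (Lit 0)) (While (Minus (var 61) (var 3)) output_body)"

lemma acost_le:
  assumes "bounded m B" "lin {} e" "B + sz e + 2 \<le> Z"
  shows "acost e m \<le> sz e * Z"
  using acost_bound[OF assms(1), of "{}" 0 e Z] assms(2,3) by (simp add: ro_bounded_def)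

definition bits_work :: nat where
  "bits_work = sz (var 3) + sz (adx 3 (Lit 0)) + sz (Div (var 3) (Lit 2)) + sz (adx 62 (Lit 0)) + sz (Plus (var 62) (Lit 1)) + sz (var 24) + sz (Lit 0)"

text \<open>\<open>\<beta>\<close> counts the halvings still to come, on top of \<open>t\<close>
  earlier ones. The a priori bound \<open>u\<close> controls the cost, and
  \<open>ar m 3 0 < 2 ^ \<beta>\<close> is what the bisection needs.\<close>

lemma exec_bits_loop:
  assumes "bounded m B" "0 \<le> ar m 3 0" "ar m 3 0 < 2 ^ u" "ar m 62 0 = int t" "int (t + u) \<le> 2 ^ B"
    and Z: "B + bits_work + 2 \<le> Z"
  shows "\<exists>r m' \<beta>. exec (While (var 3) bits_body) m r m' \<and> r \<le> (u + 1) * (bits_work * Z) \<and> bounded m' B \<and>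
    ar m' 62 0 = int (t + \<beta>) \<and> \<beta> \<le> u \<and> ar m 3 0 < 2 ^ \<beta> \<and> (\<forall>j<64. j \<noteq> 62 \<longrightarrow> j \<noteq> 3 \<longrightarrow> ar m' j = ar m j)"
  using assms(1-5)
proof (induction u arbitrary: m t)
  case 0
  then have z: "\<not> 0 < aval (var 3) m" by simp
  have "acost (var 3) m \<le> sz (var 3) * Z"
    using Z by (intro acost_le[OF 0(1)]) (auto simp: bits_work_def)
  also have "\<dots> \<le> bits_work * Z" by (intro mult_le_mono1) (simp add: bits_work_def)
  finally show ?case using exec.WhileFalse[OF z, of bits_body] 0
    by (intro exI[of _ "acost (var 3) m"] exI[of _ m] exI[of _ 0]) (simp del: acost.simps)
next
  case (Suc u)
  have c: "acost (var 3) m \<le> sz (var 3) * Z"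
    using Z by (intro acost_le[OF Suc.prems(1)]) (auto simp: bits_work_def)
  show ?case
  proof (cases "0 < ar m 3 0")
    case False
    then have z: "\<not> 0 < aval (var 3) m" by simp
    have "sz (var 3) * Z \<le> bits_work * Z" by (intro mult_le_mono1) (simp add: bits_work_def)
    also have "\<dots> \<le> (Suc u + 1) * (bits_work * Z)" by simp
    finally have "acost (var 3) m \<le> (Suc u + 1) * (bits_work * Z)" using c by simp
    then show ?thesis using exec.WhileFalse[OF z, of bits_body] Suc.prems False
      by (intro exI[of _ "acost (var 3) m"] exI[of _ m] exI[of _ 0]) (simp del: acost.simps)
  next
    case True
    define m1 where "m1 = upd m 3 0 (ar m 3 0 div 2)"
    define m2 where "m2 = upd m1 62 0 (int (Suc t))"
    have e1: "exec (Store (adx 3 (Lit 0)) (Div (var 3) (Lit 2))) m (acost (adx 3 (Lit 0)) m + acost (Div (var 3) (Lit 2)) m) m1"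
      using exec.Store[of "adx 3 (Lit 0)" "Div (var 3) (Lit 2)" m] by (simp add: m1_def upd_def del: acost.simps)
    have "ar m1 62 0 = int t" using Suc.prems(4) by (simp add: m1_def)
    then have e2: "exec (Store (adx 62 (Lit 0)) (Plus (var 62) (Lit 1))) m1 (acost (adx 62 (Lit 0)) m1 + acost (Plus (var 62) (Lit 1)) m1) m2"
      using exec.Store[of "adx 62 (Lit 0)" "Plus (var 62) (Lit 1)" m1] by (simp add: m2_def upd_def add.commute del: acost.simps)
    have abs: "\<bar>ar m 3 0\<bar> \<le> 2 ^ B" by (rule bounded_ar[OF Suc.prems(1)])
    have b1: "bounded m1 B" unfolding m1_def
      using Suc.prems(1) order_trans[OF abs_div_le abs] by (rule bounded_upd)
    have b2: "bounded m2 B" unfolding m2_def using b1 Suc.prems(5) by (intro bounded_upd) auto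
    have a: "acost (adx 3 (Lit 0)) m \<le> sz (adx 3 (Lit 0)) * Z" "acost (Div (var 3) (Lit 2)) m \<le> sz (Div (var 3) (Lit 2)) * Z"
      "acost (adx 62 (Lit 0)) m1 \<le> sz (adx 62 (Lit 0)) * Z" "acost (Plus (var 62) (Lit 1)) m1 \<le> sz (Plus (var 62) (Lit 1)) * Z"
      by (rule acost_le[OF Suc.prems(1)] acost_le[OF b1]; use Z in \<open>simp add: bits_work_def\<close>)+
    have m2: "ar m2 3 0 = ar m 3 0 div 2" "ar m2 62 0 = int (Suc t)" by (auto simp: m2_def m1_def)
    have "0 \<le> ar m2 3 0" "ar m2 3 0 < 2 ^ u" using Suc.prems(2,3) by (auto simp: m2)
    moreover have "int (Suc t + u) \<le> 2 ^ B" using Suc.prems(5) by simp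
    ultimately obtain r m' \<beta> where r: "exec (While (var 3) bits_body) m2 r m'" "r \<le> (u + 1) * (bits_work * Z)" "bounded m' B"
      "ar m' 62 0 = int (Suc t + \<beta>)" "\<beta> \<le> u" "ar m 3 0 div 2 < 2 ^ \<beta>"
      "\<forall>j<64. j \<noteq> 62 \<longrightarrow> j \<noteq> 3 \<longrightarrow> ar m' j = ar m2 j"
      using Suc.IH[OF b2 _ _ m2(2)] unfolding m2(1) by blast
    have pos: "0 < aval (var 3) m" using True by simp
    have body: "exec bits_body m ((acost (adx 3 (Lit 0)) m + acost (Div (var 3) (Lit 2)) m) + (acost (adx 62 (Lit 0)) m1 + acost (Plus (var 62) (Lit 1)) m1)) m2"
      (is "exec _ _ ?b _") unfolding bits_body_def by (rule exec.Seq[OF e1 e2])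
    have "acost (var 3) m + ?b \<le> (sz (var 3) + sz (adx 3 (Lit 0)) + sz (Div (var 3) (Lit 2)) + sz (adx 62 (Lit 0)) + sz (Plus (var 62) (Lit 1))) * Z"
      unfolding add_mult_distrib using a c by linarith
    also have "\<dots> \<le> bits_work * Z" by (intro mult_le_mono1) (simp add: bits_work_def)
    finally have "acost (var 3) m + ?b + r \<le> (Suc u + 1) * (bits_work * Z)" using r(2) by simp
    moreover have "ar m 3 0 < 2 ^ Suc \<beta>" using r(6) by simp
    moreover have "\<forall>j<64. j \<noteq> 62 \<longrightarrow> j \<noteq> 3 \<longrightarrow> ar m' j = ar m j" using r(7) by (simp add: m2_def m1_def)
    ultimately show ?thesis using exec.WhileTrue[OF pos body r(1)] r(3,4,5)
      by (intro exI[of _ "acost (var 3) m + ?b + r"] exI[of _ m'] exI[of _ "Suc \<beta>"]) (simp del: acost.simps)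
  qed
qed

lemma exec_bits:
  assumes "bounded m B" "0 \<le> ar m 24 0" and Z: "B + bits_work + 3 \<le> Z"
  shows "\<exists>r m' \<beta>. exec bits_com m r m' \<and> r \<le> (B + 3) * (bits_work * Z) \<and> bounded m' (B + 1) \<and>
    ar m' 62 0 = int \<beta> \<and> \<beta> \<le> B + 1 \<and> ar m 24 0 < 2 ^ \<beta> \<and> (\<forall>j<64. j \<noteq> 62 \<longrightarrow> j \<noteq> 3 \<longrightarrow> ar m' j = ar m j)"
proof -
  define m1 where "m1 = upd m 3 0 (ar m 24 0)"
  define m2 where "m2 = upd m1 62 0 0"
  have e1: "exec (Store (adx 3 (Lit 0)) (var 24)) m (acost (adx 3 (Lit 0)) m + acost (var 24) m) m1"
    using exec.Store[of "adx 3 (Lit 0)" "var 24" m] by (simp add: m1_def upd_def del: acost.simps)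
  have e2: "exec (Store (adx 62 (Lit 0)) (Lit 0)) m1 (acost (adx 62 (Lit 0)) m1 + acost (Lit 0) m1) m2"
    using exec.Store[of "adx 62 (Lit 0)" "Lit 0" m1] by (simp add: m2_def upd_def del: acost.simps)
  have abs: "\<bar>ar m 24 0\<bar> \<le> 2 ^ B" by (rule bounded_ar[OF assms(1)])
  have b1: "bounded m1 B" unfolding m1_def using assms(1) abs by (rule bounded_upd)
  then have b2: "bounded m2 (B + 1)" unfolding m2_def using bounded_mono[of m1 B "B + 1"] by (intro bounded_upd) auto
  have a: "acost (adx 3 (Lit 0)) m \<le> sz (adx 3 (Lit 0)) * Z" "acost (var 24) m \<le> sz (var 24) * Z"
    "acost (adx 62 (Lit 0)) m1 \<le> sz (adx 62 (Lit 0)) * Z" "acost (Lit 0) m1 \<le> sz (Lit 0) * Z"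
    by (rule acost_le[OF assms(1)] acost_le[OF b1]; use Z in \<open>simp add: bits_work_def\<close>)+
  have "(2::int) ^ B < 2 ^ Suc B" by (rule power_strict_increasing) auto
  then have "ar m 24 0 < 2 ^ Suc B" using abs by linarith
  then have 3: "0 \<le> ar m2 3 0" "ar m2 3 0 < 2 ^ Suc B" using assms(2) by (simp_all add: m2_def m1_def)
  have 62: "ar m2 62 0 = int 0" by (simp add: m2_def)
  have "int (0 + Suc B) \<le> 2 ^ (B + 1)"
    using of_nat_less_two_power[of "Suc B", where 'a = int] by simp
  moreover have "B + 1 + bits_work + 2 \<le> Z" using Z by simp
  ultimately obtain r m' \<beta> where r: "exec (While (var 3) bits_body) m2 r m'" "r \<le> (Suc B + 1) * (bits_work * Z)"
    "bounded m' (B + 1)" "ar m' 62 0 = int (0 + \<beta>)" "\<beta> \<le> Suc B" "ar m2 3 0 < 2 ^ \<beta>"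
    "\<forall>j<64. j \<noteq> 62 \<longrightarrow> j \<noteq> 3 \<longrightarrow> ar m' j = ar m2 j"
    using exec_bits_loop[OF b2 3 62] by blast
  have "exec bits_com m (((acost (adx 3 (Lit 0)) m + acost (var 24) m) + (acost (adx 62 (Lit 0)) m1 + acost (Lit 0) m1)) + r) m'"
    (is "exec _ _ (?b + r) _") unfolding bits_com_def by (rule exec.Seq[OF exec.Seq[OF e1 e2] r(1)])
  moreover have "?b + r \<le> (B + 3) * (bits_work * Z)"
  proof -
    have "?b \<le> (sz (adx 3 (Lit 0)) + sz (var 24) + sz (adx 62 (Lit 0)) + sz (Lit 0)) * Z"
      unfolding add_mult_distrib using a by linarith
    also have "\<dots> \<le> bits_work * Z" by (intro mult_le_mono1) (simp add: bits_work_def)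
    finally show ?thesis using r(2) by (simp add: algebra_simps)
  qed
  ultimately show ?thesis using r
    by (intro exI[of _ "?b + r"] exI[of _ m'] exI[of _ \<beta>]) (simp add: m2_def m1_def del: acost.simps)
qed

definition output_work :: nat where
  "output_work = sz (Minus (var 61) (var 3)) + sz (var 3) + sz (arr 4 (var 3)) + sz (adx 3 (Lit 0)) + sz (Plus (var 3) (Lit 1)) + sz (Lit 0)"

lemma ar_raw: "0 \<le> a \<Longrightarrow> 0 \<le> i \<Longrightarrow> ar (m(a := v)) j i = ar m j i"
  using adr_neg[of i j] by (auto simp: ar_def simp del: mem_adr)

lemma exec_output_loop:
  assumes "bounded m B" "ar m 61 0 = int (t + u)" "ar m 3 0 = int t" "int (t + u) \<le> 2 ^ B"
    and Z: "B + output_work + 2 \<le> Z"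
  shows "\<exists>r m'. exec (While (Minus (var 61) (var 3)) output_body) m r m' \<and> r \<le> (u + 1) * (output_work * Z) \<and>
    (\<forall>i. t \<le> i \<longrightarrow> i < t + u \<longrightarrow> m' (int i) = ar m 4 (int i)) \<and> (\<forall>i<t. m' (int i) = m (int i))"
  using assms(1-4)
proof (induction u arbitrary: m t)
  case 0
  then have z: "\<not> 0 < aval (Minus (var 61) (var 3)) m" by simp
  have "acost (Minus (var 61) (var 3)) m \<le> sz (Minus (var 61) (var 3)) * Z"
    using Z by (intro acost_le[OF 0(1)]) (auto simp: output_work_def)
  also have "\<dots> \<le> output_work * Z" by (intro mult_le_mono1) (simp add: output_work_def)
  finally show ?case using exec.WhileFalse[OF z, of output_body] 0
    by (intro exI[of _ "acost (Minus (var 61) (var 3)) m"] exI[of _ m]) (simp del: acost.simps)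
next
  case (Suc u)
  have pos: "0 < aval (Minus (var 61) (var 3)) m" using Suc.prems by simp
  define m1 where "m1 = m(int t := ar m 4 (int t))"
  define m2 where "m2 = upd m1 3 0 (int (Suc t))"
  have ar1: "ar m1 j i = ar m j i" if "0 \<le> i" for j i using that by (simp add: m1_def ar_raw)
  have e1: "exec (Store (var 3) (arr 4 (var 3))) m (acost (var 3) m + acost (arr 4 (var 3)) m) m1"
    using exec.Store[of "var 3" "arr 4 (var 3)" m] Suc.prems by (simp add: m1_def del: acost.simps)
  have e2: "exec (Store (adx 3 (Lit 0)) (Plus (var 3) (Lit 1))) m1 (acost (adx 3 (Lit 0)) m1 + acost (Plus (var 3) (Lit 1)) m1) m2"
    using exec.Store[of "adx 3 (Lit 0)" "Plus (var 3) (Lit 1)" m1] Suc.prems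
    by (simp add: m2_def upd_def ar1 add.commute del: acost.simps)
  have b1: "bounded m1 B" using Suc.prems(1) bounded_ar[OF Suc.prems(1)] by (auto simp: bounded_def m1_def)
  have b2: "bounded m2 B" unfolding m2_def using b1 Suc.prems(4) by (intro bounded_upd) auto
  have a: "acost (Minus (var 61) (var 3)) m \<le> sz (Minus (var 61) (var 3)) * Z"
    "acost (var 3) m \<le> sz (var 3) * Z" "acost (arr 4 (var 3)) m \<le> sz (arr 4 (var 3)) * Z"
    "acost (adx 3 (Lit 0)) m1 \<le> sz (adx 3 (Lit 0)) * Z" "acost (Plus (var 3) (Lit 1)) m1 \<le> sz (Plus (var 3) (Lit 1)) * Z"
    by (rule acost_le[OF Suc.prems(1)] acost_le[OF b1]; use Z in \<open>simp add: output_work_def\<close>)+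
  have "bounded m2 B" "ar m2 61 0 = int (Suc t + u)" "ar m2 3 0 = int (Suc t)" "int (Suc t + u) \<le> 2 ^ B"
    using b2 Suc.prems by (auto simp: m2_def ar1)
  from Suc.IH[OF this] obtain r m' where r: "exec (While (Minus (var 61) (var 3)) output_body) m2 r m'"
    "r \<le> (u + 1) * (output_work * Z)"
    "\<forall>i. Suc t \<le> i \<longrightarrow> i < Suc t + u \<longrightarrow> m' (int i) = ar m2 4 (int i)" "\<forall>i<Suc t. m' (int i) = m2 (int i)"
    by blast
  have body: "exec output_body m ((acost (var 3) m + acost (arr 4 (var 3)) m) + (acost (adx 3 (Lit 0)) m1 + acost (Plus (var 3) (Lit 1)) m1)) m2"
    (is "exec _ _ ?b _") unfolding output_body_def by (rule exec.Seq[OF e1 e2])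
  have "acost (Minus (var 61) (var 3)) m + ?b \<le> (sz (Minus (var 61) (var 3)) + sz (var 3) + sz (arr 4 (var 3)) + sz (adx 3 (Lit 0)) + sz (Plus (var 3) (Lit 1))) * Z"
    unfolding add_mult_distrib using a by linarith
  also have "\<dots> \<le> output_work * Z" by (intro mult_le_mono1) (simp add: output_work_def)
  finally have "acost (Minus (var 61) (var 3)) m + ?b + r \<le> (Suc u + 1) * (output_work * Z)" using r(2) by simp
  moreover have m2: "m2 (int i) = m1 (int i)" "ar m2 4 (int i) = ar m 4 (int i)" for i
    by (simp_all add: m2_def upd_input ar1)
  have "m' (int i) = ar m 4 (int i)" if "t \<le> i" "i < t + Suc u" for i
  proof (cases "i = t")
    case True
    then have "m' (int i) = m1 (int i)" using r(4) m2(1) by simp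
    then show ?thesis using True by (simp add: m1_def)
  next
    case False
    then show ?thesis using r(3) m2(2) that by simp
  qed
  moreover have "m' (int i) = m (int i)" if "i < t" for i
    using r(4) m2(1) that by (simp add: m1_def)
  ultimately show ?case using exec.WhileTrue[OF pos body r(1)]
    by (intro exI[of _ "acost (Minus (var 61) (var 3)) m + ?b + r"] exI[of _ m']) (simp del: acost.simps)
qed

lemma exec_output:
  assumes "bounded m B" "ar m 61 0 = int u" and Z: "B + output_work + 2 \<le> Z"
  shows "\<exists>r m'. exec output_com m r m' \<and> r \<le> (u + 2) * (output_work * Z) \<and> (\<forall>i<u. m' (int i) = ar m 4 (int i))"
proof -
  define m1 where "m1 = upd m 3 0 0"
  have e1: "exec (Store (adx 3 (Lit 0)) (Lit 0)) m (acost (adx 3 (Lit 0)) m + acost (Lit 0) m) m1"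
    using exec.Store[of "adx 3 (Lit 0)" "Lit 0" m] by (simp add: m1_def upd_def del: acost.simps)
  have b1: "bounded m1 B" unfolding m1_def using assms(1) by (intro bounded_upd) auto
  have a: "acost (adx 3 (Lit 0)) m \<le> sz (adx 3 (Lit 0)) * Z" "acost (Lit 0) m \<le> sz (Lit 0) * Z"
    by (rule acost_le[OF assms(1)]; use Z in \<open>simp add: output_work_def\<close>)+
  have "int u \<le> 2 ^ B" using assms(1,2) unfolding bounded_def by (metis abs_of_nat mem_adr)
  then obtain r m' where r: "exec (While (Minus (var 61) (var 3)) output_body) m1 r m'" "r \<le> (u + 1) * (output_work * Z)"
    "\<forall>i<u. m' (int i) = ar m1 4 (int i)"
    using exec_output_loop[of m1 B 0 u Z] b1 assms(2) Z by (auto simp: m1_def)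
  have "acost (adx 3 (Lit 0)) m + acost (Lit 0) m + r \<le> (u + 2) * (output_work * Z)"
  proof -
    have "acost (adx 3 (Lit 0)) m + acost (Lit 0) m \<le> (sz (adx 3 (Lit 0)) + sz (Lit 0)) * Z"
      unfolding add_mult_distrib using a by linarith
    also have "\<dots> \<le> output_work * Z" by (intro mult_le_mono1) (simp add: output_work_def)
    finally show ?thesis using r(2) by (simp add: algebra_simps)
  qed
  then show ?thesis using exec.Seq[OF e1 r(1)] r(3) unfolding output_com_def
    by (intro exI[of _ "acost (adx 3 (Lit 0)) m + acost (Lit 0) m + r"] exI[of _ m']) (simp add: m1_def del: acost.simps)
qed

section \<open>Polynomially bounded functions\<close>

definition poly_bounded :: "(nat \<Rightarrow> nat) \<Rightarrow> bool" where
  "poly_bounded f \<longleftrightarrow> (\<exists>p :: nat poly. \<forall>N. f N \<le> poly p N)"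

lemma poly_bounded_const: "poly_bounded (\<lambda>N. c)"
  unfolding poly_bounded_def by (rule exI[of _ "[:c:]"]) simp

lemma poly_bounded_id: "poly_bounded (\<lambda>N. N)"
  unfolding poly_bounded_def by (rule exI[of _ "[:0, 1:]"]) simp

lemma poly_bounded_add: "poly_bounded f \<Longrightarrow> poly_bounded g \<Longrightarrow> poly_bounded (\<lambda>N. f N + g N)"
  unfolding poly_bounded_def by (metis add_mono poly_add)

lemma poly_bounded_mult: "poly_bounded f \<Longrightarrow> poly_bounded g \<Longrightarrow> poly_bounded (\<lambda>N. f N * g N)"
  unfolding poly_bounded_def by (metis mult_le_mono poly_mult)

lemma poly_bounded_work: "poly_bounded f \<Longrightarrow> poly_bounded (\<lambda>N. work c (f N))"
  by (induction c) (auto intro!: poly_bounded_const poly_bounded_add poly_bounded_mult simp del: add_Suc_right)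


section \<open>The program\<close>

declare sem.simps(4) [simp del]

text \<open>
  Arrays: \<open>4\<close> output; \<open>5\<close>--\<open>9\<close> loop counters; \<open>10\<close>--\<open>17\<close> input (terminals, demands, costs, loads);
  \<open>18\<close> common denominator; \<open>19\<close>, \<open>20\<close> interval ends; \<open>21\<close>, \<open>22\<close>, \<open>23\<close> scaled demands, costs, loads; \<open>24\<close> maximum
  demand; \<open>25\<close> slacks of cuts; \<open>26\<close> set to \<open>1\<close> for commodities fixed as unsplit; \<open>27\<close> twice the amount routed on
  the interval; \<open>28\<close> set to \<open>1\<close> if the interval is chosen; \<open>32\<close>, \<open>33\<close>, \<open>34\<close> numerators, demands and cost
  differences of split commodities, indexed by left ends; \<open>60\<close>, \<open>61\<close>, \<open>62\<close> loop bounds.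
\<close>

definition skip :: cm where
  "skip = Asg 3 (Lit 0) (Lit 0)"

text \<open>Tests succeed on positive values, so a weak inequality \<open>lo \<le> b\<close> between
  integers becomes \<open>0 < b - lo + 1\<close>.\<close>

definition In :: "aexp \<Rightarrow> aexp \<Rightarrow> cm \<Rightarrow> cm \<Rightarrow> cm" where
  "In a b c c' = Ite (Plus (Minus b (arr 19 a)) (Lit 1)) (Ite (Minus (arr 20 a) b) c c') c'"

definition init_prog :: cm where
  "init_prog = Asg 60 (Lit 0) (Cell (Lit 0)) ;; Asg 61 (Lit 0) (Cell (Lit 1))"

definition copy_comm :: cm where
  "copy_comm =
     Asg 10 (var 5) (Cell (Plus (Lit 2) (Times (Lit 4) (var 5)))) ;;
     Asg 11 (var 5) (Cell (Plus (Lit 3) (Times (Lit 4) (var 5)))) ;;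
     Asg 12 (var 5) (Cell (Plus (Lit 4) (Times (Lit 4) (var 5)))) ;;
     Asg 13 (var 5) (Cell (Plus (Lit 5) (Times (Lit 4) (var 5)))) ;;
     Ite (Minus (arr 11 (var 5)) (arr 10 (var 5)))
       (Asg 19 (var 5) (arr 10 (var 5)) ;; Asg 20 (var 5) (arr 11 (var 5)))
       (Asg 19 (var 5) (arr 11 (var 5)) ;; Asg 20 (var 5) (arr 10 (var 5)))"

definition copy_edge :: cm where
  "copy_edge =
     Asg 14 (var 6) (Cell (Plus (Lit 2) (Times (Lit 4) (Plus (var 61) (var 6))))) ;;
     Asg 15 (var 6) (Cell (Plus (Lit 3) (Times (Lit 4) (Plus (var 61) (var 6))))) ;;
     Asg 16 (var 6) (Cell (Plus (Lit 4) (Times (Lit 4) (Plus (var 61) (var 6))))) ;;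
     Asg 17 (var 6) (Cell (Plus (Lit 5) (Times (Lit 4) (Plus (var 61) (var 6)))))"

definition copy_prog :: cm where
  "copy_prog = For 5 61 copy_comm ;; For 6 60 copy_edge"

definition scale_comm :: cm where
  "scale_comm =
     Asg 21 (var 5) (Times (arr 12 (var 5)) (Div (var 18) (arr 13 (var 5)))) ;;
     Ite (Minus (arr 21 (var 5)) (var 24)) (Asg 24 (Lit 0) (arr 21 (var 5))) skip"

definition scale_edge :: cm where
  "scale_edge =
     Asg 22 (var 6) (Times (arr 14 (var 6)) (Div (var 18) (arr 15 (var 6)))) ;;
     Asg 23 (var 6) (Times (arr 16 (var 6)) (Div (var 18) (arr 17 (var 6))))"

text \<open>The plain product of all denominators serves as common denominator: its length is
  bounded by the sum of their lengths, and each multiplication has an input array as one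
  factor.\<close>

definition scale_prog :: cm where
  "scale_prog =
     Asg 18 (Lit 0) (Lit 1) ;;
     For 5 61 (Asg 18 (Lit 0) (Times (arr 13 (var 5)) (var 18))) ;;
     For 6 60 (Asg 18 (Lit 0) (Times (arr 15 (var 6)) (Times (arr 17 (var 6)) (var 18)))) ;;
     Asg 24 (Lit 0) (Lit 0) ;;
     For 5 61 scale_comm ;;
     For 6 60 scale_edge"

abbreviation slk :: aexp where
  "slk \<equiv> Plus (Times (var 60) (var 6)) (var 7)"

definition grid :: "cm \<Rightarrow> cm" where
  "grid c = For 6 60 (For 7 60 c)"

definition slack_sub :: cm where
  "slack_sub = Asg 25 slk (Minus (arr 25 slk) (arr 21 (var 5)))"

definition slack_loop :: cm where
  "slack_loop = In (var 5) (var 6) (In (var 5) (var 7) skip slack_sub) (In (var 5) (var 7) slack_sub skip)"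

definition slack_body :: cm where
  "slack_body =
     Asg 25 slk (Plus (arr 23 (var 6)) (arr 23 (var 7))) ;;
     For 5 61 slack_loop"

definition scan_body :: cm where
  "scan_body =
     In (var 5) (var 6)
       (In (var 5) (var 7) (Ite (Minus (var 29) (arr 25 slk)) (Asg 29 (Lit 0) (arr 25 slk)) skip) skip)
       (In (var 5) (var 7) skip (Ite (Minus (var 30) (arr 25 slk)) (Asg 30 (Lit 0) (arr 25 slk)) skip))"

text \<open>Arrays \<open>29\<close> and \<open>30\<close> receive twice the largest amounts that
  demand and slacks permit on the interval and on its complement.\<close>

definition scan :: cm where
  "scan =
     Asg 29 (Lit 0) (Times (Lit 2) (arr 21 (var 5))) ;;
     Asg 30 (Lit 0) (Times (Lit 2) (arr 21 (var 5))) ;;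
     grid scan_body"

definition route_body :: cm where
  "route_body =
     In (var 5) (var 6)
       (In (var 5) (var 7) (Asg 25 slk (Minus (arr 25 slk) (arr 27 (var 5)))) skip)
       (In (var 5) (var 7) skip
         (Asg 25 slk (Minus (arr 25 slk) (Minus (Times (Lit 2) (arr 21 (var 5))) (arr 27 (var 5))))))"

definition fix_comm :: "aexp \<Rightarrow> aexp \<Rightarrow> cm" where
  "fix_comm a b = Asg 27 (var 5) a ;; Asg 26 (var 5) (Lit 1) ;; Asg 28 (var 5) b ;; grid route_body"

text \<open>A commodity is fixed if one of its two unsplit routings keeps the cut condition; the
  interval is tried before its complement.\<close>

definition decide1 :: cm where
  "decide1 =
     Ite (Plus (Minus (var 29) (Times (Lit 2) (arr 21 (var 5)))) (Lit 1))
       (fix_comm (Times (Lit 2) (arr 21 (var 5))) (Lit 1))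
       (Ite (Plus (Minus (var 30) (Times (Lit 2) (arr 21 (var 5)))) (Lit 1)) (fix_comm (Lit 0) (Lit 0)) skip)"

text \<open>The largest possible amount is taken greedily. Array \<open>27\<close> holds it doubled,
  because half of an integral slack need not be integral.\<close>

definition decide2 :: cm where
  "decide2 = Asg 27 (var 5) (var 29) ;; grid route_body"

definition pass :: "cm \<Rightarrow> cm" where
  "pass c = For 5 61 (Ite (Minus (Lit 1) (arr 26 (var 5))) (scan ;; c) skip)"

definition diff_body :: cm where
  "diff_body =
     In (var 5) (var 6) (Asg 31 (Lit 0) (Plus (var 31) (arr 22 (var 6)))) (Asg 31 (Lit 0) (Minus (var 31) (arr 22 (var 6))))"

text \<open>Array \<open>42\<close> becomes \<open>2 ^ k\<close> times the doubled amount. Since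
  \<open>Div\<close> rounds down, rounding up for a nonpositive gain takes two negations.\<close>

definition vertex_body :: cm where
  "vertex_body =
     Asg 31 (Lit 0) (Lit 0) ;; For 6 60 diff_body ;;
     Asg 42 (Lit 0) (arr 27 (var 5)) ;; For 7 61 (Asg 42 (Lit 0) (Times (Lit 2) (var 42))) ;;
     Asg 33 (arr 19 (var 5)) (arr 21 (var 5)) ;;
     Asg 34 (arr 19 (var 5)) (Times (arr 21 (var 5)) (var 31)) ;;
     Ite (var 31)
       (Asg 32 (arr 19 (var 5)) (Div (var 42) (Times (Lit 2) (arr 21 (var 5)))))
       (Asg 32 (arr 19 (var 5)) (Minus (Lit 0) (Div (Minus (Lit 0) (var 42)) (Times (Lit 2) (arr 21 (var 5))))))"

definition split_prog :: cm where
  "split_prog =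
     grid slack_body ;; pass decide1 ;; pass decide2 ;;
     For 5 61 (Ite (Minus (Lit 1) (arr 26 (var 5))) vertex_body skip)"

text \<open>The outer test is positive iff the numerator is odd. Array \<open>39\<close> holds the
  position, array \<open>41\<close> the cost change of the signs chosen so far.\<close>

definition walk_body :: cm where
  "walk_body =
     Ite (Minus (arr 32 (var 6)) (Times (Lit 2) (Div (arr 32 (var 6)) (Lit 2))))
       (Ite (Minus (Lit 0) (var 39))
         (Asg 39 (Lit 0) (Plus (var 39) (arr 33 (var 6))) ;; Asg 41 (Lit 0) (Plus (var 41) (arr 34 (var 6))) ;;
          Asg 35 (var 6) (Lit 1))
         (Asg 39 (Lit 0) (Minus (var 39) (arr 33 (var 6))) ;; Asg 41 (Lit 0) (Minus (var 41) (arr 34 (var 6))) ;;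
          Asg 35 (var 6) (Lit (- 1))))
       (Asg 35 (var 6) (Lit 0))"

definition walk :: "nat \<Rightarrow> cm" where
  "walk q = Asg 39 (Lit 0) (var q) ;; Asg 41 (Lit 0) (Lit 0) ;; For 6 60 walk_body"

definition bisect_body :: cm where
  "bisect_body =
     Ite (Minus (Minus (var 37) (var 36)) (Lit 1))
       (Asg 38 (Lit 0) (Div (Plus (var 36) (var 37)) (Lit 2)) ;; walk 38 ;;
        Ite (Minus (Lit 0) (var 39)) (Asg 39 (Lit 0) (Minus (Lit 0) (var 39))) skip ;;
        Ite (Minus (var 39) (var 38)) (Asg 36 (Lit 0) (var 38)) (Asg 37 (Lit 0) (var 38)))
       skip"

definition halve_body :: cm where
  "halve_body =
     Ite (var 41) (Asg 32 (var 6) (Div (Minus (arr 32 (var 6)) (arr 35 (var 6))) (Lit 2)))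
       (Asg 32 (var 6) (Div (Plus (arr 32 (var 6)) (arr 35 (var 6))) (Lit 2)))"

definition level_body :: cm where
  "level_body =
     Asg 36 (Lit 0) (Lit 0) ;; Asg 37 (Lit 0) (var 24) ;; For 9 62 bisect_body ;; walk 36 ;; For 6 60 halve_body"

text \<open>The fractions have \<open>k\<close> binary digits, so the number of commodities bounds
  this loop as well.\<close>

definition level_prog :: cm where
  "level_prog = For 8 61 level_body"

definition choose_body :: cm where
  "choose_body =
     Ite (Minus (Lit 1) (arr 26 (var 5))) (Asg 28 (var 5) (arr 32 (arr 19 (var 5)))) skip ;;
     Ite (arr 28 (var 5))
       (Ite (Minus (arr 11 (var 5)) (arr 10 (var 5))) (Asg 4 (var 5) (Lit 1)) (Asg 4 (var 5) (Lit 2)))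
       (Ite (Minus (arr 11 (var 5)) (arr 10 (var 5))) (Asg 4 (var 5) (Lit 2)) (Asg 4 (var 5) (Lit 1)))"

definition choose_prog :: cm where
  "choose_prog = For 5 61 choose_body"

definition ring_program :: com where
  "ring_program =
     Seq (compile init_prog) (Seq (compile copy_prog) (Seq (compile scale_prog) (Seq bits_com
       (Seq (compile split_prog) (Seq (compile level_prog) (Seq (compile choose_prog) output_com))))))"

lemmas prog_defs = skip_def In_def init_prog_def copy_comm_def copy_edge_def copy_prog_def scale_comm_def
  scale_edge_def scale_prog_def grid_def slack_sub_def slack_loop_def slack_body_def scan_body_def scan_def route_body_def
  fix_comm_def decide1_def decide2_def pass_def diff_body_def vertex_body_def split_prog_def walk_body_def
  walk_def bisect_body_def halve_body_def level_body_def level_prog_def choose_body_def choose_prog_def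

text \<open>The program is cut into phases because an array computed in one phase may be a read-only
  factor in a later one. Bits grow additively within a phase and at most polynomially from one phase
  to the next.\<close>

lemma chk_progs:
  "chk {} init_prog" "chk {60, 61} copy_prog" "chk {60, 61, 12, 13, 14, 15, 16, 17} scale_prog"
  "chk {60, 61, 19, 20, 21, 22, 23} split_prog" "chk {60, 61, 62, 24, 33, 34} level_prog" "chk {60, 61} choose_prog"
  by (simp_all add: prog_defs)

lemma sem_skip [simp]: "j < 64 \<Longrightarrow> j \<noteq> 3 \<Longrightarrow> ar (sem skip m) j = ar m j"
  by (simp add: skip_def)

lemma sem_In [simp]:
  "sem (In a b c c') m =
    (if ar m 19 (aval a m) \<le> aval b m \<and> aval b m < ar m 20 (aval a m) then sem c m else sem c' m)"
  by (simp add: In_def)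

text \<open>Indexing the invariant by the set of visited pairs hides the nesting of the two
  loops.\<close>

lemma grid_inv:
  assumes "chk RO (grid c)" "ar m 60 0 = int n" "60 \<notin> wr c"
    and "J {} m"
    and "\<And>P m' v x. v \<in> {6, 7} \<Longrightarrow> J P m' \<Longrightarrow> J P (upd m' v 0 x)"
    and "\<And>P e f m'. e < n \<Longrightarrow> f < n \<Longrightarrow> (e, f) \<notin> P \<Longrightarrow> ar m' 6 0 = int e \<Longrightarrow> ar m' 7 0 = int f \<Longrightarrow>
      (\<And>j. j < 64 \<Longrightarrow> j \<notin> insert 6 (insert 7 (wr c)) \<Longrightarrow> ar m' j = ar m j) \<Longrightarrow>
      J P m' \<Longrightarrow> J (insert (e, f) P) (sem c m')"
  shows "J ({..<n} \<times> {..<n}) (sem (grid c) m)"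
  unfolding grid_def
proof (rule For_inv[where I = "\<lambda>t. J ({..<t} \<times> {..<n})", OF assms(1)[unfolded grid_def] assms(2)])
  show "J ({..<0} \<times> {..<n}) (upd m 6 0 0)" using assms(4,5) by simp
  fix t m' assume t: "t < n" "ar m' 6 0 = int t" "J ({..<t} \<times> {..<n}) m'"
    and fr: "\<And>j. j < 64 \<Longrightarrow> j \<notin> insert 6 (wr (For 7 60 c)) \<Longrightarrow> ar m' j = ar m j"
  have chk: "chk RO (For 7 60 c)" "6 \<notin> wr c" using assms(1) by (auto simp: grid_def)
  have "J ({..<t} \<times> {..<n} \<union> {t} \<times> {..<n}) (sem (For 7 60 c) m')"
  proof (rule For_inv[where I = "\<lambda>s. J ({..<t} \<times> {..<n} \<union> {t} \<times> {..<s})", OF chk(1)])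
    show "ar m' 60 0 = int n" using fr[of 60] assms(2,3) by simp
    show "J ({..<t} \<times> {..<n} \<union> {t} \<times> {..<0}) (upd m' 7 0 0)" using t(3) assms(5) by simp
    fix s m2 assume s: "s < n" "ar m2 7 0 = int s" "J ({..<t} \<times> {..<n} \<union> {t} \<times> {..<s}) m2"
      and fr2: "\<And>j. j < 64 \<Longrightarrow> j \<notin> insert 7 (wr c) \<Longrightarrow> ar m2 j = ar m' j"
    have "ar m2 6 0 = int t" using fr2[of 6] chk(2) t(2) by simp
    moreover have "ar m2 j = ar m j" if "j < 64" "j \<notin> insert 6 (insert 7 (wr c))" for j
      using fr[of j] fr2[of j] that by auto
    ultimately have "J (insert (t, s) ({..<t} \<times> {..<n} \<union> {t} \<times> {..<s})) (sem c m2)"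
      using s t(1) by (intro assms(6)) auto
    moreover have "insert (t, s) ({..<t} \<times> {..<n} \<union> {t} \<times> {..<s}) = {..<t} \<times> {..<n} \<union> {t} \<times> {..<Suc s}"
      by auto
    ultimately show "J ({..<t} \<times> {..<n} \<union> {t} \<times> {..<Suc s}) (upd (sem c m2) 7 0 (int (Suc s)))"
      using assms(5) by simp
  qed
  moreover have "{..<t} \<times> {..<n} \<union> {t} \<times> {..<n} = {..<Suc t} \<times> {..<n}" by auto
  ultimately show "J ({..<Suc t} \<times> {..<n}) (upd (sem (For 7 60 c) m') 6 0 (int (Suc t)))"
    using assms(5) by simp
qed


section \<open>Correctness of the program\<close>

lemma copy_comm_spec:
  assumes "ar m 61 0 = int k" "\<And>a. 0 \<le> a \<Longrightarrow> m a = inp a"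
  defines "m' \<equiv> sem (For 5 61 copy_comm) m"
  shows "(\<forall>a\<ge>0. m' a = inp a) \<and> (\<forall>i<k. ar m' 10 (int i) = inp (2 + 4 * int i) \<and>
      ar m' 11 (int i) = inp (3 + 4 * int i) \<and>
      ar m' 12 (int i) = inp (4 + 4 * int i) \<and> ar m' 13 (int i) = inp (5 + 4 * int i) \<and>
      ar m' 19 (int i) = min (inp (2 + 4 * int i)) (inp (3 + 4 * int i)) \<and>
      ar m' 20 (int i) = max (inp (2 + 4 * int i)) (inp (3 + 4 * int i)))" (is "?I k m'")
  unfolding m'_def
  by (rule For_inv[where RO = "{60, 61}" and I = ?I])
    (use assms in \<open>auto simp: copy_comm_def upd_input less_Suc_eq\<close>)

lemma copy_edge_spec:
  assumes "ar m 60 0 = int n" "ar m 61 0 = int k" "\<And>a. 0 \<le> a \<Longrightarrow> m a = inp a"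
  defines "m' \<equiv> sem (For 6 60 copy_edge) m"
  shows "(\<forall>a\<ge>0. m' a = inp a) \<and> (\<forall>e<n. ar m' 14 (int e) = inp (2 + 4 * (int k + int e)) \<and>
      ar m' 15 (int e) = inp (3 + 4 * (int k + int e)) \<and>
      ar m' 16 (int e) = inp (4 + 4 * (int k + int e)) \<and> ar m' 17 (int e) = inp (5 + 4 * (int k + int e)))"
    (is "?I n m'")
  unfolding m'_def
  by (rule For_inv[where RO = "{60, 61}" and I = ?I])
    (use assms in \<open>auto simp: copy_edge_def upd_input less_Suc_eq\<close>)

lemma scale_comm_spec:
  assumes "ar m 61 0 = int k" "ar m 24 0 = 0"
  defines "m' \<equiv> sem (For 5 61 scale_comm) m" and "D \<equiv> \<lambda>i. ar m 12 (int i) * (ar m 18 0 div ar m 13 (int i))"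
  shows "(\<forall>i<k. ar m' 21 (int i) = D i \<and> D i \<le> ar m' 24 0) \<and> 0 \<le> ar m' 24 0 \<and>
    (ar m' 24 0 = 0 \<or> (\<exists>i<k. ar m' 24 0 = D i))" (is "?I k m'")
  unfolding m'_def
proof (rule For_inv[where RO = "{60, 61, 12}" and I = ?I])
  fix t m'
  assume t: "t < k" "ar m' 5 0 = int t" "\<And>j. j < 64 \<Longrightarrow> j \<notin> insert 5 (wr scale_comm) \<Longrightarrow> ar m' j = ar m j"
    and I: "?I t m'"
  have "ar m' 12 = ar m 12" "ar m' 13 = ar m 13" "ar m' 18 = ar m 18"
    using t(3) by (simp_all add: scale_comm_def skip_def)
  then have "ar m' 12 (int t) * (ar m' 18 0 div ar m' 13 (int t)) = D t" by (simp add: D_def)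
  then show "?I (Suc t) (upd (sem scale_comm m') 5 0 (int (Suc t)))"
    using I t(2) by (fastforce simp: scale_comm_def less_Suc_eq)
qed (use assms(1,2) in \<open>auto simp: scale_comm_def skip_def\<close>)

lemma scale_edge_spec:
  assumes "ar m 60 0 = int n"
  defines "m' \<equiv> sem (For 6 60 scale_edge) m"
  shows "\<forall>e<n. ar m' 22 (int e) = ar m 14 (int e) * (ar m 18 0 div ar m 15 (int e)) \<and>
      ar m' 23 (int e) = ar m 16 (int e) * (ar m 18 0 div ar m 17 (int e))" (is "?I n m'")
  unfolding m'_def
  by (rule For_inv[where RO = "{60, 61, 14, 16}" and I = ?I]) (use assms(1) in \<open>auto simp: scale_edge_def less_Suc_eq\<close>)

lemma scale_spec:
  assumes "ar m 60 0 = int n" "ar m 61 0 = int k"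
  defines "m' \<equiv> sem scale_prog m"
    and "P \<equiv> (\<Prod>i<k. ar m 13 (int i)) * (\<Prod>e<n. ar m 15 (int e) * ar m 17 (int e))"
  defines "D \<equiv> \<lambda>i. ar m 12 (int i) * (P div ar m 13 (int i))"
  shows "\<forall>i<k. ar m' 21 (int i) = D i \<and> D i \<le> ar m' 24 0"
    and "0 \<le> ar m' 24 0" and "ar m' 24 0 = 0 \<or> (\<exists>i<k. ar m' 24 0 = D i)"
    and "\<forall>e<n. ar m' 22 (int e) = ar m 14 (int e) * (P div ar m 15 (int e)) \<and>
      ar m' 23 (int e) = ar m 16 (int e) * (P div ar m 17 (int e))"
proof -
  let ?b1 = "Asg 18 (Lit 0) (Times (arr 13 (var 5)) (var 18))"
  let ?b2 = "Asg 18 (Lit 0) (Times (arr 15 (var 6)) (Times (arr 17 (var 6)) (var 18)))"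
  define m1 where "m1 = upd m 18 0 1"
  define m2 where "m2 = sem (For 5 61 ?b1) m1"
  define m3 where "m3 = sem (For 6 60 ?b2) m2"
  define m4 where "m4 = upd m3 24 0 0"
  define m5 where "m5 = sem (For 5 61 scale_comm) m4"
  have m': "m' = sem (For 6 60 scale_edge) m5"
    by (simp add: m'_def scale_prog_def m1_def m2_def m3_def m4_def m5_def)
  let ?RO = "{60, 61, 12, 13, 14, 15, 16, 17}"
  have f1: "ar m1 j = ar m j" if "j < 64" "j \<noteq> 18" for j using that by (simp add: m1_def)
  have f2: "ar m2 j = ar m j" if "j < 64" "j \<noteq> 18" "j \<noteq> 5" for j
    unfolding m2_def using sem_frame[of ?RO "For 5 61 ?b1" j m1] f1[of j] that by simp
  have f3: "ar m3 j = ar m j" if "j < 64" "j \<noteq> 18" "j \<noteq> 5" "j \<noteq> 6" for j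
    unfolding m3_def using sem_frame[of ?RO "For 6 60 ?b2" j m2] f2[of j] that by simp
  have f4: "ar m4 j = ar m j" if "j < 64" "j \<noteq> 18" "j \<noteq> 5" "j \<noteq> 6" "j \<noteq> 24" for j
    unfolding m4_def using f3[of j] that by simp
  have f5: "ar m5 j = ar m4 j" if "j < 64" "j \<noteq> 21" "j \<noteq> 5" "j \<noteq> 24" "j \<noteq> 3" for j
    unfolding m5_def using sem_frame[of ?RO "For 5 61 scale_comm" j m4] that by (simp add: scale_comm_def skip_def)
  have f6: "ar m' j = ar m5 j" if "j < 64" "j \<noteq> 22" "j \<noteq> 23" "j \<noteq> 6" for j
    unfolding m' using sem_frame[of ?RO "For 6 60 scale_edge" j m5] that by (simp add: scale_edge_def)
  have "ar m2 18 0 = (\<Prod>i<k. ar m 13 (int i))" unfolding m2_def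
    by (rule For_inv[where RO = ?RO and I = "\<lambda>t m'. ar m' 18 0 = (\<Prod>i<t. ar m 13 (int i))"])
      (use assms(2) f1 in \<open>auto simp: m1_def\<close>)
  then have "ar m3 18 0 = P" unfolding m3_def P_def
    by (intro For_inv[where RO = ?RO and I = "\<lambda>t m'. ar m' 18 0 = (\<Prod>i<k. ar m 13 (int i)) * (\<Prod>e<t. ar m 15 (int e) * ar m 17 (int e))"])
      (use assms(1) f2 in auto)
  then have P: "ar m4 18 0 = P" by (simp add: m4_def)
  have 24: "ar m4 24 0 = 0" by (simp add: m4_def)
  have D: "ar m4 12 (int i) * (ar m4 18 0 div ar m4 13 (int i)) = D i" for i by (simp add: f4 P D_def)
  have "ar m4 61 0 = int k" by (simp add: f4 assms(2))
  note S = scale_comm_spec[OF this 24, folded m5_def, unfolded D]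
  show "\<forall>i<k. ar m' 21 (int i) = D i \<and> D i \<le> ar m' 24 0" "0 \<le> ar m' 24 0" "ar m' 24 0 = 0 \<or> (\<exists>i<k. ar m' 24 0 = D i)"
    using S by (simp_all add: f6)
  show "\<forall>e<n. ar m' 22 (int e) = ar m 14 (int e) * (P div ar m 15 (int e)) \<and>
      ar m' 23 (int e) = ar m 16 (int e) * (P div ar m 17 (int e))"
    using scale_edge_spec[of m5 n, folded m'] assms(1) P by (simp add: f5 f4)
qed

section \<open>The table of slacks\<close>

lemma slk_inj:
  assumes "f < n" "f' < n"
  shows "int n * int e + int f = int n * int e' + int f' \<longleftrightarrow> e = e' \<and> f = f'"
proof
  assume "int n * int e + int f = int n * int e' + int f'"
  then have *: "n * e + f = n * e' + f'" by (metis of_nat_add of_nat_eq_iff of_nat_mult)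
  have "(n * e + f) div n = e" "(n * e' + f') div n = e'" "(n * e + f) mod n = f" "(n * e' + f') mod n = f'"
    using assms by auto
  then show "e = e' \<and> f = f'" using * by metis
qed auto

definition slacks :: "mem \<Rightarrow> nat \<Rightarrow> nat \<Rightarrow> nat \<Rightarrow> int" where
  "slacks m n e f = ar m 25 (int n * int e + int f)"

text \<open>Each pair has a cell of its own, and the new entry depends on no other entry, so the
  double loop acts on the table pointwise.\<close>

lemma grid_slacks:
  assumes "chk RO (grid c)" "ar m 60 0 = int n" "60 \<notin> wr c"
    and step: "\<And>e f m'. e < n \<Longrightarrow> f < n \<Longrightarrow> ar m' 6 0 = int e \<Longrightarrow> ar m' 7 0 = int f \<Longrightarrow>
      (\<And>j. j < 64 \<Longrightarrow> j \<notin> insert 6 (insert 7 (wr c)) \<Longrightarrow> ar m' j = ar m j) \<Longrightarrow>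
      ar (sem c m') 25 = (ar m' 25)(int n * int e + int f := h e f (slacks m' n e f))"
  shows "\<forall>e<n. \<forall>f<n. slacks (sem (grid c) m) n e f = h e f (slacks m n e f)"
proof -
  let ?J = "\<lambda>P m'. \<forall>e<n. \<forall>f<n. slacks m' n e f = (if (e, f) \<in> P then h e f (slacks m n e f) else slacks m n e f)"
  have "?J ({..<n} \<times> {..<n}) (sem (grid c) m)"
  proof (rule grid_inv[where J = ?J, OF assms(1-3)])
    fix P e f m'
    assume ef: "e < n" "f < n" "(e, f) \<notin> P" "ar m' 6 0 = int e" "ar m' 7 0 = int f"
      and fr: "\<And>j. j < 64 \<Longrightarrow> j \<notin> insert 6 (insert 7 (wr c)) \<Longrightarrow> ar m' j = ar m j" and J: "?J P m'"
    from step[OF ef(1,2,4,5) fr]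
    have "ar (sem c m') 25 = (ar m' 25)(int n * int e + int f := h e f (slacks m' n e f))" by blast
    then show "?J (insert (e, f) P) (sem c m')"
      using ef(1-3) J by (auto simp: slacks_def slk_inj)
  qed (auto simp: slacks_def)
  then show ?thesis by auto
qed

lemma slack_loop_spec:
  assumes "ar m 61 0 = int k" "ar m 60 0 = int n" "ar m 6 0 = int e" "ar m 7 0 = int f"
    and lr: "\<And>i. i < k \<Longrightarrow> ar m 19 (int i) = int (l i) \<and> ar m 20 (int i) = int (r i)"
  defines "ins \<equiv> \<lambda>i e. l i \<le> e \<and> e < r i" and "m' \<equiv> sem (For 5 61 slack_loop) m"
  shows "ar m' 25 = (ar m 25)(int n * int e + int f :=
    slacks m n e f - (\<Sum>i<k. if ins i e = ins i f then 0 else ar m 21 (int i)))" (is "?I k m'")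
  unfolding m'_def
proof (rule For_inv[where RO = "{60, 61, 21}" and I = ?I])
  show "chk {60, 61, 21} (For 5 61 slack_loop)" by (simp add: slack_loop_def In_def skip_def slack_sub_def)
  show "ar m 61 0 = int k" by fact
  show "?I 0 (upd m 5 0 0)" by (simp add: slacks_def)
  fix t m'
  assume t: "t < k" "ar m' 5 0 = int t" and I: "?I t m'"
    and fr: "\<And>j. j < 64 \<Longrightarrow> j \<notin> insert 5 (wr slack_loop) \<Longrightarrow> ar m' j = ar m j"
  have fr: "ar m' 6 = ar m 6" "ar m' 7 = ar m 7" "ar m' 19 = ar m 19" "ar m' 20 = ar m 20" "ar m' 21 = ar m 21" "ar m' 60 = ar m 60"
    by (intro fr; simp add: slack_loop_def In_def skip_def slack_sub_def)+
  show "?I (Suc t) (upd (sem slack_loop m') 5 0 (int (Suc t)))"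
    using assms(2-4) lr[OF t(1)] t(2) by (auto simp: fr I slack_loop_def slack_sub_def ins_def)
qed

lemma slack_body_spec:
  assumes "ar m 60 0 = int n" "ar m 61 0 = int k"
    and lr: "\<And>i. i < k \<Longrightarrow> ar m 19 (int i) = int (l i) \<and> ar m 20 (int i) = int (r i)"
  defines "ins \<equiv> \<lambda>i e. l i \<le> e \<and> e < r i"
  shows "\<forall>e<n. \<forall>f<n. slacks (sem (grid slack_body) m) n e f =
    ar m 23 (int e) + ar m 23 (int f) - (\<Sum>i<k. if ins i e = ins i f then 0 else ar m 21 (int i))"
proof (rule grid_slacks[where RO = "{60, 61, 21}"])
  show "chk {60, 61, 21} (grid slack_body)" by (simp add: prog_defs)
  show "ar m 60 0 = int n" by fact
  show "60 \<notin> wr slack_body" by (simp add: prog_defs)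
  fix e f m'
  assume ef: "e < n" "f < n" "ar m' 6 0 = int e" "ar m' 7 0 = int f"
    and fr: "\<And>j. j < 64 \<Longrightarrow> j \<notin> insert 6 (insert 7 (wr slack_body)) \<Longrightarrow> ar m' j = ar m j"
  have fr: "ar m' 19 = ar m 19" "ar m' 20 = ar m 20" "ar m' 21 = ar m 21" "ar m' 23 = ar m 23" "ar m' 60 = ar m 60" "ar m' 61 = ar m 61"
    by (intro fr; simp add: prog_defs)+
  define m1 where "m1 = sem (Asg 25 slk (Plus (arr 23 (var 6)) (arr 23 (var 7)))) m'"
  have m1: "ar m1 j = ar m' j" if "j < 64" "j \<noteq> 25" for j using that by (simp add: m1_def)
  have 25: "ar m1 25 = (ar m' 25)(int n * int e + int f := ar m 23 (int e) + ar m 23 (int f))"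
    using ef assms(1) by (simp add: m1_def fr)
  have "sem slack_body m' = sem (For 5 61 slack_loop) m1" by (simp add: slack_body_def m1_def)
  moreover have "ar (sem (For 5 61 slack_loop) m1) 25 =
    (ar m1 25)(int n * int e + int f := slacks m1 n e f - (\<Sum>i<k. if ins i e = ins i f then 0 else ar m1 21 (int i)))"
    unfolding ins_def by (rule slack_loop_spec) (use ef assms lr in \<open>auto simp: m1 fr\<close>)
  ultimately show "ar (sem slack_body m') 25 = (ar m' 25)(int n * int e + int f :=
      ar m 23 (int e) + ar m 23 (int f) - (\<Sum>i<k. if ins i e = ins i f then 0 else ar m 21 (int i)))"
    by (simp add: 25 m1 fr slacks_def cong: if_cong)
qed

lemma route_spec:
  assumes "ar m 60 0 = int n" "ar m 5 0 = int i" "ar m 19 (int i) = int lo" "ar m 20 (int i) = int hi"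
  defines "ins \<equiv> \<lambda>e. lo \<le> e \<and> e < hi"
  shows "\<forall>e<n. \<forall>f<n. slacks (sem (grid route_body) m) n e f = slacks m n e f -
    (if ins e \<and> ins f then ar m 27 (int i) else if ins e \<or> ins f then 0 else 2 * ar m 21 (int i) - ar m 27 (int i))"
proof (rule grid_slacks[where RO = "{60, 61, 21}" and h = "\<lambda>e f s. s - (if ins e \<and> ins f then ar m 27 (int i) else if ins e \<or> ins f then 0 else 2 * ar m 21 (int i) - ar m 27 (int i))"])
  fix e f m'
  assume ef: "e < n" "f < n" "ar m' 6 0 = int e" "ar m' 7 0 = int f"
    and fr: "\<And>j. j < 64 \<Longrightarrow> j \<notin> insert 6 (insert 7 (wr route_body)) \<Longrightarrow> ar m' j = ar m j"
  have fr: "ar m' 5 = ar m 5" "ar m' 19 = ar m 19" "ar m' 20 = ar m 20" "ar m' 21 = ar m 21" "ar m' 27 = ar m 27" "ar m' 60 = ar m 60"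
    by (intro fr; simp add: prog_defs)+
  show "ar (sem route_body m') 25 = (ar m' 25)(int n * int e + int f :=
      slacks m' n e f - (if ins e \<and> ins f then ar m 27 (int i) else if ins e \<or> ins f then 0 else 2 * ar m 21 (int i) - ar m 27 (int i)))"
    using ef assms(1-4) by (auto simp: route_body_def fr ins_def slacks_def)
qed (use assms(1) in \<open>simp_all add: prog_defs\<close>)

lemma scan_spec:
  assumes "ar m 60 0 = int n" "ar m 5 0 = int i" "ar m 19 (int i) = int lo" "ar m 20 (int i) = int hi"
  defines "ins \<equiv> \<lambda>e. lo \<le> e \<and> e < hi"
  defines "m' \<equiv> sem scan m" and "d2 \<equiv> 2 * ar m 21 (int i)"
  shows "ar m' 29 0 \<le> d2 \<and> (\<forall>e<n. \<forall>f<n. ins e \<longrightarrow> ins f \<longrightarrow> ar m' 29 0 \<le> slacks m n e f) \<and>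
      (ar m' 29 0 = d2 \<or> (\<exists>e<n. \<exists>f<n. ins e \<and> ins f \<and> ar m' 29 0 = slacks m n e f)) \<and>
    ar m' 30 0 \<le> d2 \<and> (\<forall>e<n. \<forall>f<n. \<not> ins e \<longrightarrow> \<not> ins f \<longrightarrow> ar m' 30 0 \<le> slacks m n e f) \<and>
      (ar m' 30 0 = d2 \<or> (\<exists>e<n. \<exists>f<n. \<not> ins e \<and> \<not> ins f \<and> ar m' 30 0 = slacks m n e f))"
proof -
  \<comment> \<open>One scheme for both minima. That a minimum is attained matters as much as that
    it is a bound: a tight pair certifies that a commodity has to be split.\<close>
  define U where "U P u I \<longleftrightarrow> u \<le> d2 \<and> (\<forall>(e, f)\<in>P. I e \<longrightarrow> I f \<longrightarrow> u \<le> slacks m n e f) \<and>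
    (u = d2 \<or> (\<exists>e<n. \<exists>f<n. I e \<and> I f \<and> u = slacks m n e f))" for P u and I :: "nat \<Rightarrow> bool"
  have U_insert: "U (insert (e, f) P) (if I e \<and> I f \<and> slacks m n e f < u then slacks m n e f else u) I"
    if "U P u I" "e < n" "f < n" for P u I e f
    using that unfolding U_def by fastforce
  let ?J = "\<lambda>P m'. U P (ar m' 29 0) ins \<and> U P (ar m' 30 0) (\<lambda>e. \<not> ins e)"
  define m1 where "m1 = upd (upd m 29 0 d2) 30 0 d2"
  have m1: "ar m1 j = ar m j" if "j < 64" "j \<noteq> 29" "j \<noteq> 30" for j using that by (simp add: m1_def)
  have "?J ({..<n} \<times> {..<n}) (sem (grid scan_body) m1)"
  proof (rule grid_inv[where J = ?J and RO = "{60, 61, 21}"])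
    show "ar m1 60 0 = int n" using m1 assms(1) by simp
    show "?J {} m1" by (simp add: m1_def U_def)
    fix P e f m2
    assume ef: "e < n" "f < n" "ar m2 6 0 = int e" "ar m2 7 0 = int f" and J: "?J P m2"
      and fr: "\<And>j. j < 64 \<Longrightarrow> j \<notin> insert 6 (insert 7 (wr scan_body)) \<Longrightarrow> ar m2 j = ar m1 j"
    have fr: "ar m2 5 = ar m 5" "ar m2 19 = ar m 19" "ar m2 20 = ar m 20" "ar m2 25 = ar m 25" "ar m2 60 = ar m 60"
      by (subst fr, simp, simp add: prog_defs, rule m1; simp)+
    have "ar (sem scan_body m2) 29 0 = (if ins e \<and> ins f \<and> slacks m n e f < ar m2 29 0 then slacks m n e f else ar m2 29 0)"
      "ar (sem scan_body m2) 30 0 = (if \<not> ins e \<and> \<not> ins f \<and> slacks m n e f < ar m2 30 0 then slacks m n e f else ar m2 30 0)"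
      using ef assms(1-4) by (simp_all add: scan_body_def fr ins_def slacks_def)
    then show "?J (insert (e, f) P) (sem scan_body m2)"
      using U_insert[of P "ar m2 29 0" ins e f] U_insert[of P "ar m2 30 0" "\<lambda>e. \<not> ins e" e f] J ef by simp
  qed (simp_all add: prog_defs, auto)
  moreover have "m' = sem (grid scan_body) m1"
    using assms(2) by (simp add: m'_def scan_def m1_def d2_def)
  ultimately show ?thesis unfolding U_def by auto
qed

section \<open>Invariants of the two routing passes\<close>

locale int_chords = chords n k l r "\<lambda>i. real_of_int (D i)" for n k l r and D :: "nat \<Rightarrow> int" +
  fixes X0 :: "nat \<Rightarrow> int"
begin

text \<open>Capacity left for \<open>R\<close> once the other commodities are routed unsplit,
  \<open>F i\<close> being \<open>1\<close> for the interval and \<open>0\<close> for its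
  complement.\<close>

definition resid :: "nat set \<Rightarrow> (nat \<Rightarrow> int) \<Rightarrow> nat \<Rightarrow> real" where
  "resid R F e = real_of_int (X0 e) - load ({..<k} - R) (\<lambda>i. real_of_int (F i * D i)) e"

text \<open>The last clause speaks of all feasible routings of the remaining commodities. In this
  form it survives later fixings, and it refutes any shift that would unsplit a commodity.\<close>

definition first_inv :: "nat \<Rightarrow> nat set \<Rightarrow> (nat \<Rightarrow> int) \<Rightarrow> (nat \<Rightarrow> nat \<Rightarrow> int) \<Rightarrow> bool" where
  "first_inv t R F W \<longleftrightarrow> R \<subseteq> {..<k} \<and> {t..<k} \<subseteq> R \<and> (\<forall>i<k. i \<notin> R \<longrightarrow> F i \<in> {0, 1}) \<and>
     (\<forall>e<n. \<forall>f<n. real_of_int (W e f) = slack R (resid R F) e f) \<and> cut R (resid R F) \<and>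
     (\<forall>i\<in>R. i < t \<longrightarrow> (\<forall>a. feasible R (resid R F) a \<longrightarrow> 0 < a i \<and> a i < real_of_int (D i)))"

definition scanned :: "nat \<Rightarrow> (nat \<Rightarrow> nat \<Rightarrow> int) \<Rightarrow> int \<Rightarrow> int \<Rightarrow> bool" where
  "scanned i W U V \<longleftrightarrow>
     U \<le> 2 * D i \<and> (\<forall>e<n. \<forall>f<n. inside i e \<longrightarrow> inside i f \<longrightarrow> U \<le> W e f) \<and>
       (U = 2 * D i \<or> (\<exists>e<n. \<exists>f<n. inside i e \<and> inside i f \<and> U = W e f)) \<and>
     V \<le> 2 * D i \<and> (\<forall>e<n. \<forall>f<n. \<not> inside i e \<longrightarrow> \<not> inside i f \<longrightarrow> V \<le> W e f) \<and>
       (V = 2 * D i \<or> (\<exists>e<n. \<exists>f<n. \<not> inside i e \<and> \<not> inside i f \<and> V = W e f))"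

definition routed :: "nat \<Rightarrow> int \<Rightarrow> (nat \<Rightarrow> nat \<Rightarrow> int) \<Rightarrow> nat \<Rightarrow> nat \<Rightarrow> int" where
  "routed i A W e f = W e f - (if inside i e \<and> inside i f then A else if inside i e \<or> inside i f then 0 else 2 * D i - A)"

lemma resid_fix:
  assumes "i \<in> R" "R \<subseteq> {..<k}"
  shows "resid (R - {i}) (F(i := c)) = route i (real_of_int (c * D i)) (resid R F)"
proof
  fix e
  have 1: "{..<k} - (R - {i}) - {i} = {..<k} - R" using assms by auto
  have "load ({..<k} - (R - {i})) (\<lambda>j. real_of_int ((F(i := c)) j * D j)) e =
      load ({..<k} - R) (\<lambda>j. real_of_int ((F(i := c)) j * D j)) e + (if inside i e then real_of_int (c * D i) else real_of_int (D i) - real_of_int (c * D i))"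
    using load_remove[of "{..<k} - (R - {i})" i "\<lambda>j. real_of_int ((F(i := c)) j * D j)" e] assms unfolding 1 by auto
  moreover have "load ({..<k} - R) (\<lambda>j. real_of_int ((F(i := c)) j * D j)) e = load ({..<k} - R) (\<lambda>j. real_of_int (F j * D j)) e"
    unfolding load_def using assms(1) by (intro sum.cong) auto
  ultimately show "resid (R - {i}) (F(i := c)) e = route i (real_of_int (c * D i)) (resid R F) e"
    by (simp add: resid_def route_def)
qed

lemma first_inv_init:
  assumes "\<forall>e<n. \<forall>f<n. W e f = X0 e + X0 f - (\<Sum>i<k. if inside i e = inside i f then 0 else D i)"
    and "feasible {..<k} (\<lambda>e. real_of_int (X0 e)) a"
  shows "first_inv 0 {..<k} F W"
proof -
  have X: "resid {..<k} F = (\<lambda>e. real_of_int (X0 e))" by (simp add: resid_def load_def fun_eq_iff)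
  have "real_of_int (W e f) = slack {..<k} (\<lambda>e. real_of_int (X0 e)) e f" if "e < n" "f < n" for e f
    using assms(1) that by (simp add: slack_def if_distrib cong: if_cong)
  moreover have "cut {..<k} (\<lambda>e. real_of_int (X0 e))"
    using feasible_slack[OF assms(2)] by (auto simp: cut_def)
  ultimately show ?thesis by (auto simp: first_inv_def X)
qed

lemma first_inv_fix:
  assumes inv: "first_inv t R F W" and t: "t < k" and sc: "scanned t W U V"
    and c: "c = 1 \<and> 2 * D t \<le> U \<or> c = 0 \<and> 2 * D t \<le> V"
  shows "first_inv (Suc t) (R - {t}) (F(t := c)) (routed t (2 * (c * D t)) W)"
proof -
  have R: "R \<subseteq> {..<k}" "t \<in> R" "finite R" using inv t finite_subset[of R "{..<k}"] by (auto simp: first_inv_def)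
  have cut: "cut R (resid R F)" using inv by (simp add: first_inv_def)
  have W: "real_of_int (W e f) = slack R (resid R F) e f" if "e < n" "f < n" for e f
    using inv that by (auto simp: first_inv_def)
  have D: "0 \<le> D t" using d_nonneg[OF t] by simp
  have W0: "0 \<le> W e f" if "e < n" "f < n" for e f
    using cut W[OF that] that unfolding cut_def by (metis of_int_0_le_iff)
  have 1: "2 * (c * D t) \<le> W e f" if "e < n" "f < n" "inside t e" "inside t f" for e f
  proof -
    have "U \<le> W e f" using sc that unfolding scanned_def by blast
    then show ?thesis using c W0[OF that(1,2)] by auto
  qed
  have 2: "2 * (D t - c * D t) \<le> W e f" if "e < n" "f < n" "\<not> inside t e" "\<not> inside t f" for e f
  proof -
    have "V \<le> W e f" using sc that unfolding scanned_def by blast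
    then show ?thesis using c W0[OF that(1,2)] by auto
  qed
  have "cut (R - {t}) (route t (real_of_int (c * D t)) (resid R F))"
  proof (rule cut_route[OF R(3,2) cut])
    show "2 * real_of_int (c * D t) \<le> slack R (resid R F) e f" if "e < n" "f < n" "inside t e" "inside t f" for e f
    proof -
      have "real_of_int (2 * (c * D t)) \<le> real_of_int (W e f)" using 1[OF that] by (simp only: of_int_le_iff)
      then show ?thesis by (simp add: W[OF that(1,2)])
    qed
    show "2 * (real_of_int (D t) - real_of_int (c * D t)) \<le> slack R (resid R F) e f"
      if "e < n" "f < n" "\<not> inside t e" "\<not> inside t f" for e f
    proof -
      have "real_of_int (2 * (D t - c * D t)) \<le> real_of_int (W e f)" using 2[OF that] by (simp only: of_int_le_iff)
      then show ?thesis by (simp add: W[OF that(1,2)])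
    qed
  qed
  moreover have "real_of_int (routed t (2 * (c * D t)) W e f) = slack (R - {t}) (route t (real_of_int (c * D t)) (resid R F)) e f"
    if "e < n" "f < n" for e f
    unfolding slack_route[OF R(3,2)] by (simp add: routed_def W[OF that])
  \<comment> \<open>A routing of the commodities left extends, by the fixed amount of
    \<open>t\<close>, to a routing from before the step; so those known to be split remain
    so.\<close>
  moreover have "0 < a i \<and> a i < real_of_int (D i)"
    if "i \<in> R - {t}" "i < Suc t" "feasible (R - {t}) (route t (real_of_int (c * D t)) (resid R F)) a" for i a
  proof -
    have "feasible R (resid R F) (a(t := real_of_int (c * D t)))"
      using c D that(3) by (intro feasible_insert R) auto
    then have "0 < (a(t := real_of_int (c * D t))) i \<and> (a(t := real_of_int (c * D t))) i < real_of_int (D i)"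
      using inv that(1,2) unfolding first_inv_def by (metis DiffD1 DiffD2 less_SucE singletonI)
    then show ?thesis using that(1) by auto
  qed
  ultimately show ?thesis
    using inv c R(1) unfolding first_inv_def resid_fix[OF R(2,1)] by auto
qed

text \<open>A pair that attains \<open>V < 2 * D t\<close> has too little slack for the whole demand
  to avoid the interval, and one that attains \<open>U\<close> too little for all of it to use the
  interval.\<close>

lemma first_inv_keep:
  assumes inv: "first_inv t R F W" and t: "t < k" and sc: "scanned t W U V"
    and c: "U < 2 * D t" "V < 2 * D t"
  shows "first_inv (Suc t) R F W"
proof -
  have R: "R \<subseteq> {..<k}" "t \<in> R" "finite R" using inv t finite_subset[of R "{..<k}"] by (auto simp: first_inv_def)
  have W: "real_of_int (W e f) = slack R (resid R F) e f" if "e < n" "f < n" for e f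
    using inv that by (auto simp: first_inv_def)
  have "0 < a t \<and> a t < real_of_int (D t)" if a: "feasible R (resid R F) a" for a
  proof
    obtain e f where ef: "e < n" "f < n" "\<not> inside t e" "\<not> inside t f" "V = W e f"
      using sc less_imp_neq[OF c(2)] unfolding scanned_def by blast
    have "2 * (real_of_int (D t) - a t) \<le> real_of_int (W e f)"
      using feasible_slack_ge(2)[OF R(3,2) a ef(1,2)] ef(3,4) unfolding W[OF ef(1,2)] by blast
    moreover have "real_of_int (W e f) < real_of_int (2 * D t)" using c(2) ef(5) by (simp only: of_int_less_iff)
    ultimately show "0 < a t" by simp
    obtain e f where ef: "e < n" "f < n" "inside t e" "inside t f" "U = W e f"
      using sc less_imp_neq[OF c(1)] unfolding scanned_def by blast
    have "2 * a t \<le> real_of_int (W e f)"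
      using feasible_slack_ge(1)[OF R(3,2) a ef(1,2)] ef(3,4) unfolding W[OF ef(1,2)] by blast
    moreover have "real_of_int (W e f) < real_of_int (2 * D t)" using c(1) ef(5) by (simp only: of_int_less_iff)
    ultimately show "a t < real_of_int (D t)" by simp
  qed
  then show ?thesis using inv unfolding first_inv_def by (auto simp: less_Suc_eq)
qed

text \<open>The cut condition yields one routing \<open>a\<close>. If two remaining commodities did
  not cross, a shift would turn it into a feasible routing with one of them unsplit, which the
  invariant excludes.\<close>

lemma first_inv_final:
  assumes "first_inv k R F W"
  shows "\<And>i j. i \<in> R \<Longrightarrow> j \<in> R \<Longrightarrow> i \<noteq> j \<Longrightarrow> crossing i j" and "\<And>i. i \<in> R \<Longrightarrow> 0 < D i"
proof -
  have R: "R \<subseteq> {..<k}" using assms by (simp add: first_inv_def)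
  have strict: "0 < a i \<and> a i < real_of_int (D i)" if "i \<in> R" "feasible R (resid R F) a" for i a
  proof -
    have "i < k" using R that(1) by auto
    moreover have "\<forall>i\<in>R. i < k \<longrightarrow> (\<forall>a. feasible R (resid R F) a \<longrightarrow> 0 < a i \<and> a i < real_of_int (D i))"
      using assms by (simp add: first_inv_def)
    ultimately show ?thesis using that by blast
  qed
  have "cut R (resid R F)" using assms by (simp add: first_inv_def)
  then obtain a where a: "feasible R (resid R F) a"
    using cut_feasible[OF R] by blast
  show "0 < D i" if "i \<in> R" for i using strict[OF that a] by simp
  show "crossing i j" if ij: "i \<in> R" "j \<in> R" "i \<noteq> j" for i j
  proof (rule ccontr)
    assume "\<not> crossing i j"
    then obtain u v where uv: "feasible R (resid R F) (a(i := u, j := v))" "u \<in> {0, real_of_int (D i)} \<or> v \<in> {0, real_of_int (D j)}"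
      using unsplit_parallel[OF R ij a] strict[OF ij(1) a] strict[OF ij(2) a] by blast
    have "0 < u" "u < real_of_int (D i)" "0 < v" "v < real_of_int (D j)"
      using strict[OF ij(1) uv(1)] strict[OF ij(2) uv(1)] ij(3) by simp_all
    then show False using uv(2) by simp
  qed
qed

text \<open>Now \<open>R\<close> stays fixed: commodities below \<open>t\<close> have received half
  of \<open>A\<close>, and table and cut condition refer to those from \<open>t\<close> on.\<close>

definition second_inv :: "nat set \<Rightarrow> (nat \<Rightarrow> real) \<Rightarrow> nat \<Rightarrow> (nat \<Rightarrow> int) \<Rightarrow> (nat \<Rightarrow> nat \<Rightarrow> int) \<Rightarrow> bool" where
  "second_inv R X t A W \<longleftrightarrow> (let Q = {i\<in>R. t \<le> i}; Y = (\<lambda>e. X e - load {i\<in>R. i < t} (\<lambda>i. real_of_int (A i) / 2) e) in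
     (\<forall>e<n. \<forall>f<n. real_of_int (W e f) = slack Q Y e f) \<and> cut Q Y \<and>
     (\<forall>i\<in>R. i < t \<longrightarrow> 0 \<le> A i \<and> A i \<le> 2 * D i))"

lemma second_inv_init:
  assumes "first_inv k R F W"
  shows "second_inv R (resid R F) 0 A W"
  using assms unfolding second_inv_def first_inv_def by (auto simp: load_def Let_def)

lemma second_inv_skip:
  assumes "second_inv R X t A W" "t \<notin> R"
  shows "second_inv R X (Suc t) A W"
proof -
  have "{i\<in>R. Suc t \<le> i} = {i\<in>R. t \<le> i}" "{i\<in>R. i < Suc t} = {i\<in>R. i < t}"
    using assms(2) by (auto simp: less_Suc_eq Suc_le_eq le_less)
  then show ?thesis using assms unfolding second_inv_def Let_def by (auto simp: less_Suc_eq)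
qed

lemma second_inv_step:
  assumes inv: "second_inv R X t A W" and t: "t \<in> R" "R \<subseteq> {..<k}" and sc: "scanned t W U V"
  shows "second_inv R X (Suc t) (A(t := U)) (routed t U W)"
proof -
  define Q where "Q = {i\<in>R. t \<le> i}"
  define Y where "Y = (\<lambda>e. X e - load {i\<in>R. i < t} (\<lambda>i. real_of_int (A i) / 2) e)"
  have inv': "(\<forall>e<n. \<forall>f<n. real_of_int (W e f) = slack Q Y e f)" "cut Q Y" "\<forall>i\<in>R. i < t \<longrightarrow> 0 \<le> A i \<and> A i \<le> 2 * D i"
    using inv unfolding second_inv_def Let_def Q_def Y_def by blast+
  have Q: "finite Q" "t \<in> Q" "Q \<subseteq> {..<k}" "Q - {t} = {i\<in>R. Suc t \<le> i}"
    using t finite_subset[OF t(2)] by (auto simp: Q_def)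
  have W: "real_of_int (W e f) = slack Q Y e f" if "e < n" "f < n" for e f using inv'(1) that by blast
  have W0: "0 \<le> W e f" if "e < n" "f < n" for e f
    using inv'(2) W[OF that] that unfolding cut_def by (metis of_int_0_le_iff)
  have D: "0 \<le> D t" using d_nonneg[of t] t by auto
  have "U = 2 * D t \<or> (\<exists>e<n. \<exists>f<n. U = W e f)" using sc unfolding scanned_def by blast
  then have U0: "0 \<le> U" using W0 D by auto
  \<comment> \<open>If a pair inside the interval limits \<open>U\<close>, uncrossing provides the
    complementary slack outside; if the demand limits it, nothing is left to send outside.\<close>
  have out: "2 * D t - U \<le> W e' f'" if o: "e' < n" "f' < n" "\<not> inside t e'" "\<not> inside t f'" for e' f'
  proof (cases "U = 2 * D t")
    case True
    then show ?thesis using W0[OF o(1,2)] by simp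
  next
    case False
    then obtain e f where ef: "e < n" "f < n" "inside t e" "inside t f" "U = W e f"
      using sc unfolding scanned_def by blast
    have "real_of_int (2 * D t) \<le> real_of_int (W e f + W e' f')"
      using slack_uncross[OF Q(3,2) inv'(2) ef(1,2) o(1,2) ef(3,4) o(3,4)] by (simp add: W ef o)
    then show ?thesis using ef(5) by (simp only: of_int_le_iff)
  qed
  have "cut (Q - {t}) (route t (real_of_int U / 2) Y)"
  proof (rule cut_route[OF Q(1,2) inv'(2)])
    show "2 * (real_of_int U / 2) \<le> slack Q Y e f" if "e < n" "f < n" "inside t e" "inside t f" for e f
      using sc that by (simp add: scanned_def flip: W)
    show "2 * (real_of_int (D t) - real_of_int U / 2) \<le> slack Q Y e f"
      if "e < n" "f < n" "\<not> inside t e" "\<not> inside t f" for e f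
    proof -
      have "real_of_int (2 * D t - U) \<le> real_of_int (W e f)" using out[OF that] by (simp only: of_int_le_iff)
      then show ?thesis by (simp add: W[OF that(1,2)])
    qed
  qed
  moreover have "real_of_int (routed t U W e f) = slack (Q - {t}) (route t (real_of_int U / 2) Y) e f"
    if "e < n" "f < n" for e f
    unfolding slack_route[OF Q(1,2)] by (simp add: routed_def W[OF that])
  moreover have "route t (real_of_int U / 2) Y = (\<lambda>e. X e - load {i\<in>R. i < Suc t} (\<lambda>i. real_of_int ((A(t := U)) i) / 2) e)"
  proof
    fix e
    have "{i\<in>R. i < Suc t} - {t} = {i\<in>R. i < t}" by auto
    moreover have "load {i\<in>R. i < t} (\<lambda>i. real_of_int ((A(t := U)) i) / 2) e = load {i\<in>R. i < t} (\<lambda>i. real_of_int (A i) / 2) e"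
      unfolding load_def by (rule sum.cong) auto
    moreover have "finite {i\<in>R. i < Suc t}" by (rule finite_subset[of _ "{..<Suc t}"]) auto
    ultimately show "route t (real_of_int U / 2) Y e = X e - load {i\<in>R. i < Suc t} (\<lambda>i. real_of_int ((A(t := U)) i) / 2) e"
      using load_remove[of "{i\<in>R. i < Suc t}" t "\<lambda>i. real_of_int ((A(t := U)) i) / 2" e] t by (simp add: route_def Y_def)
  qed
  moreover have "0 \<le> (A(t := U)) i \<and> (A(t := U)) i \<le> 2 * D i" if "i \<in> R" "i < Suc t" for i
    using inv'(3) that U0 sc by (auto simp: scanned_def less_Suc_eq)
  ultimately show ?thesis unfolding second_inv_def Let_def Q(4) by simp
qed

lemma second_inv_final:
  assumes "first_inv k R F W'" "second_inv R (resid R F) k A W"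
  shows "feasible {..<k} (\<lambda>e. real_of_int (X0 e)) (\<lambda>i. if i \<in> R then real_of_int (A i) / 2 else real_of_int (F i * D i))"
proof -
  let ?a = "\<lambda>i. if i \<in> R then real_of_int (A i) / 2 else real_of_int (F i * D i)"
  have R: "R \<subseteq> {..<k}" and F: "\<And>i. i < k \<Longrightarrow> i \<notin> R \<Longrightarrow> F i \<in> {0, 1}" using assms(1) by (auto simp: first_inv_def)
  have sets: "{i\<in>R. k \<le> i} = {}" "{i\<in>R. i < k} = R" using R by auto
  have A: "0 \<le> A i \<and> A i \<le> 2 * D i" if "i \<in> R" for i
    using assms(2) that R unfolding second_inv_def Let_def by blast
  \<comment> \<open>With no commodity left, the diagonal of the cut condition says that the residual
    capacities are nonnegative.\<close>
  have "0 \<le> resid R F e - load R (\<lambda>i. real_of_int (A i) / 2) e" if "e < n" for e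
    using assms(2) that unfolding second_inv_def Let_def sets cut_def slack_def by fastforce
  moreover have "load {..<k} ?a e = load R (\<lambda>i. real_of_int (A i) / 2) e + load ({..<k} - R) (\<lambda>i. real_of_int (F i * D i)) e" for e
  proof -
    have "load {..<k} ?a e = load R ?a e + load ({..<k} - R) ?a e"
      unfolding load_def using sum.subset_diff[OF R] by (simp add: add.commute)
    moreover have "load R ?a e = load R (\<lambda>i. real_of_int (A i) / 2) e" unfolding load_def by (rule sum.cong) auto
    moreover have "load ({..<k} - R) ?a e = load ({..<k} - R) (\<lambda>i. real_of_int (F i * D i)) e" unfolding load_def by (rule sum.cong) auto
    ultimately show ?thesis by simp
  qed
  moreover have "0 \<le> ?a i \<and> ?a i \<le> real_of_int (D i)" if "i < k" for i
  proof (cases "i \<in> R")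
    case True
    have "real_of_int 0 \<le> real_of_int (A i)" "real_of_int (A i) \<le> real_of_int (2 * D i)"
      using A[OF True] by (simp_all only: of_int_le_iff)
    then show ?thesis using True by simp
  next
    case False
    then show ?thesis using F[OF that False] d_nonneg[OF that] by auto
  qed
  ultimately show ?thesis unfolding feasible_def resid_def by fastforce
qed

section \<open>The two routing passes in memory\<close>

definition statics :: "mem \<Rightarrow> bool" where
  "statics m \<longleftrightarrow> ar m 60 0 = int n \<and> ar m 61 0 = int k \<and>
     (\<forall>i<k. ar m 19 (int i) = int (l i) \<and> ar m 20 (int i) = int (r i) \<and> ar m 21 (int i) = D i)"

definition unfixed :: "mem \<Rightarrow> nat set" where
  "unfixed m = {i. i < k \<and> ar m 26 (int i) = 0}"

lemma scanned_scan:
  assumes "statics m" "ar m 5 0 = int i" "i < k"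
  shows "scanned i (slacks m n) (ar (sem scan m) 29 0) (ar (sem scan m) 30 0)"
  using scan_spec[of m n i "l i" "r i"] assms unfolding statics_def scanned_def inside_def by simp

lemma scan_frame: "j < 64 \<Longrightarrow> j \<notin> {3, 6, 7, 29, 30} \<Longrightarrow> ar (sem scan m) j = ar m j"
  using sem_frame[of "{60, 61, 21}" scan j m] by (simp add: prog_defs)

lemma route_frame: "j < 64 \<Longrightarrow> j \<notin> {3, 6, 7, 25} \<Longrightarrow> ar (sem (grid route_body) m) j = ar m j"
  using sem_frame[of "{60, 61, 21}" "grid route_body" j m] by (simp add: prog_defs)

lemma routed_route:
  assumes "statics m" "ar m 5 0 = int i" "i < k" "e < n" "f < n"
  shows "slacks (sem (grid route_body) m) n e f = routed i (ar m 27 (int i)) (slacks m n) e f"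
  using route_spec[of m n i "l i" "r i"] assms unfolding statics_def routed_def inside_def by auto

text \<open>Arrays are functions on all integers, and the specifications of the loops determine them
  only below \<open>k\<close> and \<open>n\<close>.\<close>

lemma first_inv_cong:
  assumes "first_inv t R F W" "\<And>i. i < k \<Longrightarrow> F i = F' i" "\<And>e f. e < n \<Longrightarrow> f < n \<Longrightarrow> W e f = W' e f"
  shows "first_inv t R F' W'"
proof -
  have "resid R F = resid R F'" using assms(2) unfolding resid_def load_def
    by (intro ext arg_cong2[of _ _ _ _ minus] sum.cong) auto
  then show ?thesis using assms unfolding first_inv_def by auto
qed

lemma second_inv_cong:
  assumes "second_inv R X t A W" "R \<subseteq> {..<k}" "\<And>i. i < k \<Longrightarrow> A i = A' i" "\<And>e f. e < n \<Longrightarrow> f < n \<Longrightarrow> W e f = W' e f"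
  shows "second_inv R X t A' W'"
proof -
  have "load {i\<in>R. i < t} (\<lambda>i. real_of_int (A i) / 2) = load {i\<in>R. i < t} (\<lambda>i. real_of_int (A' i) / 2)"
    using assms(2,3) unfolding load_def by (intro ext sum.cong) auto
  then show ?thesis using assms unfolding second_inv_def Let_def by (auto simp: subset_iff)
qed

lemma fix_comm_spec:
  assumes st: "statics m" and i: "ar m 5 0 = int i" "i < k" and a: "aval a m = A" "b = Lit c"
  defines "m' \<equiv> sem (fix_comm a b) m"
  shows "statics m'" "ar m' 26 = (ar m 26)(int i := 1)" "ar m' 28 = (ar m 28)(int i := c)"
    "\<And>e f. e < n \<Longrightarrow> f < n \<Longrightarrow> slacks m' n e f = routed i A (slacks m n) e f"
proof -
  define m1 where "m1 = upd (upd (upd m 27 (int i) A) 26 (int i) 1) 28 (int i) c"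
  have m': "m' = sem (grid route_body) m1" using i(1) a by (simp add: m'_def fix_comm_def m1_def)
  have st1: "statics m1" "ar m1 5 0 = int i" using st i by (auto simp: statics_def m1_def)
  show "statics m'" using st1(1) unfolding m' statics_def by (simp add: route_frame)
  show "ar m' 26 = (ar m 26)(int i := 1)" "ar m' 28 = (ar m 28)(int i := c)"
    unfolding m' by (simp_all add: route_frame m1_def)
  show "slacks m' n e f = routed i A (slacks m n) e f" if "e < n" "f < n" for e f
    unfolding m' routed_route[OF st1 i(2) that] by (simp add: m1_def routed_def slacks_def)
qed

lemma first_pass:
  assumes st: "statics m" and ST: "\<forall>i<k. ar m 26 (int i) = 0"
    and inv: "first_inv 0 {..<k} (\<lambda>i. ar m 28 (int i)) (slacks m n)"
  defines "m' \<equiv> sem (pass decide1) m"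
  shows "statics m' \<and> (\<forall>i<k. ar m' 26 (int i) \<in> {0, 1}) \<and>
    first_inv k (unfixed m') (\<lambda>i. ar m' 28 (int i)) (slacks m' n)"
proof -
  let ?b = "Ite (Minus (Lit 1) (arr 26 (var 5))) (scan ;; decide1) skip"
  let ?I = "\<lambda>t m. statics m \<and> (\<forall>i<k. ar m 26 (int i) \<in> {0, 1}) \<and> (\<forall>i<k. t \<le> i \<longrightarrow> ar m 26 (int i) = 0) \<and>
    first_inv t (unfixed m) (\<lambda>i. ar m 28 (int i)) (slacks m n)"
  have un0: "unfixed m = {..<k}" using ST by (auto simp: unfixed_def)
  have "?I k m'" unfolding m'_def pass_def
  proof (rule For_inv[where I = ?I and RO = "{60, 61, 21}"])
    show "chk {60, 61, 21} (For 5 61 ?b)" by (simp add: prog_defs)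
    show "ar m 61 0 = int k" using st by (simp add: statics_def)
    show "?I 0 (upd m 5 0 0)" using st ST inv un0 by (simp add: statics_def unfixed_def slacks_def[abs_def])
    fix t m0 assume t: "t < k" "ar m0 5 0 = int t" and I: "?I t m0"
    define m1 where "m1 = sem scan m0"
    have f1: "ar m1 j = ar m0 j" if "j < 64" "j \<notin> {3, 6, 7, 29, 30}" for j
      unfolding m1_def using that by (rule scan_frame)
    have ST0: "ar m0 26 (int t) = 0" using I t(1) by auto
    have b: "sem ?b m0 = sem decide1 m1" using t(2) ST0 by (simp add: m1_def)
    have sc: "scanned t (slacks m0 n) (ar m1 29 0) (ar m1 30 0)" unfolding m1_def using I t by (intro scanned_scan) auto
    have st1: "statics m1" "ar m1 5 0 = int t" using I t(2) by (auto simp: statics_def f1)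
    have D: "ar m1 21 (int t) = D t" using st1(1) t(1) by (simp add: statics_def)
    have sl1: "slacks m1 n = slacks m0 n" by (simp add: slacks_def fun_eq_iff f1)
    have fixed: "?I (Suc t) (sem (fix_comm a (Lit c)) m1)"
      if a: "aval a m1 = 2 * (c * D t)" and c: "c = 1 \<and> 2 * D t \<le> ar m1 29 0 \<or> c = 0 \<and> 2 * D t \<le> ar m1 30 0" for a c
    proof -
      let ?m = "sem (fix_comm a (Lit c)) m1"
      note S = fix_comm_spec[OF st1 t(1) a refl]
      have "unfixed ?m = unfixed m0 - {t}" using S(2) t(1) ST0 by (auto simp: unfixed_def f1 split: if_splits)
      moreover have "first_inv (Suc t) (unfixed m0 - {t}) ((\<lambda>i. ar m0 28 (int i))(t := c)) (routed t (2 * (c * D t)) (slacks m0 n))"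
        using I by (intro first_inv_fix[OF _ t(1) sc c]) blast
      then have "first_inv (Suc t) (unfixed m0 - {t}) (\<lambda>i. ar ?m 28 (int i)) (slacks ?m n)"
        by (rule first_inv_cong) (use S(3,4) in \<open>auto simp: f1 sl1\<close>)
      ultimately show ?thesis using S(1,2) I by (auto simp: f1)
    qed
    have kept: "?I (Suc t) (sem skip m1)" if "ar m1 29 0 < 2 * D t" "ar m1 30 0 < 2 * D t"
    proof -
      have "unfixed (sem skip m1) = unfixed m0" by (auto simp: unfixed_def f1)
      moreover have "first_inv (Suc t) (unfixed m0) (\<lambda>i. ar m0 28 (int i)) (slacks m0 n)"
        using I by (intro first_inv_keep[OF _ t(1) sc that]) blast
      moreover have "slacks (sem skip m1) n = slacks m0 n" by (simp add: slacks_def fun_eq_iff f1)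
      ultimately show ?thesis using I by (auto simp: statics_def f1)
    qed
    have "sem decide1 m1 = (if 2 * D t \<le> ar m1 29 0 then sem (fix_comm (Times (Lit 2) (arr 21 (var 5))) (Lit 1)) m1
        else if 2 * D t \<le> ar m1 30 0 then sem (fix_comm (Lit 0) (Lit 0)) m1 else sem skip m1)"
      using st1(2) D by (simp add: decide1_def)
    then have "?I (Suc t) (sem decide1 m1)"
      using fixed[of "Times (Lit 2) (arr 21 (var 5))" 1] fixed[of "Lit 0" 0] kept st1(2) D by (auto simp: not_le)
    then show "?I (Suc t) (upd (sem ?b m0) 5 0 (int (Suc t)))"
      unfolding b by (simp add: statics_def unfixed_def slacks_def[abs_def])
  qed
  then show ?thesis by blast
qed

text \<open>The pass writes neither array \<open>26\<close> nor array \<open>28\<close>, so the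
  split commodities and their residual capacities stay those of its start.\<close>

lemma second_pass:
  assumes st: "statics m" and ST: "\<forall>i<k. ar m 26 (int i) \<in> {0, 1}"
    and inv: "first_inv k (unfixed m) (\<lambda>i. ar m 28 (int i)) (slacks m n)"
  defines "m' \<equiv> sem (pass decide2) m"
  shows "second_inv (unfixed m) (resid (unfixed m) (\<lambda>i. ar m 28 (int i))) k (\<lambda>i. ar m' 27 (int i)) (slacks m' n)"
  unfolding m'_def pass_def
proof -
  let ?b = "Ite (Minus (Lit 1) (arr 26 (var 5))) (scan ;; decide2) skip"
  let ?X = "resid (unfixed m) (\<lambda>i. ar m 28 (int i))"
  let ?I = "\<lambda>t m'. second_inv (unfixed m) ?X t (\<lambda>i. ar m' 27 (int i)) (slacks m' n)"
  have R: "unfixed m \<subseteq> {..<k}" by (auto simp: unfixed_def)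
  show "?I k (sem (For 5 61 ?b) m)"
  proof (rule For_inv[where I = ?I and RO = "{60, 61, 21}"])
    show "chk {60, 61, 21} (For 5 61 ?b)" by (simp add: prog_defs)
    show "ar m 61 0 = int k" using st by (simp add: statics_def)
    show "?I 0 (upd m 5 0 0)"
      using second_inv_init[OF inv, of "\<lambda>i. ar m 27 (int i)"] by (simp add: slacks_def[abs_def])
    fix t m0 assume t: "t < k" "ar m0 5 0 = int t" and I: "?I t m0"
      and fr: "\<And>j. j < 64 \<Longrightarrow> j \<notin> insert 5 (wr ?b) \<Longrightarrow> ar m0 j = ar m j"
    have st0: "statics m0" using st unfolding statics_def by (simp add: fr prog_defs)
    have 26: "ar m0 26 = ar m 26" by (rule fr; simp add: prog_defs)
    have "?I (Suc t) (sem ?b m0)"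
    proof (cases "t \<in> unfixed m")
      case False
      then have "ar m0 26 (int t) = 1" using ST t(1) by (auto simp: 26 unfixed_def)
      then have "sem ?b m0 = sem skip m0" using t(2) by simp
      then show ?thesis using second_inv_skip[OF I False] by (simp add: slacks_def[abs_def])
    next
      case True
      then have "ar m0 26 (int t) = 0" by (simp add: 26 unfixed_def)
      define m1 where "m1 = sem scan m0"
      have f1: "ar m1 j = ar m0 j" if "j < 64" "j \<notin> {3, 6, 7, 29, 30}" for j
        unfolding m1_def using that by (rule scan_frame)
      define m2 where "m2 = upd m1 27 (int t) (ar m1 29 0)"
      have b: "sem ?b m0 = sem (grid route_body) m2"
        using t(2) \<open>ar m0 26 (int t) = 0\<close> f1[of 5] by (simp add: m1_def m2_def decide2_def)
      have sc: "scanned t (slacks m0 n) (ar m1 29 0) (ar m1 30 0)" unfolding m1_def using st0 t(2,1) by (rule scanned_scan)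
      have st2: "statics m2" "ar m2 5 0 = int t" using st0 t(2) by (auto simp: statics_def f1 m2_def)
      have "second_inv (unfixed m) ?X (Suc t) ((\<lambda>i. ar m0 27 (int i))(t := ar m1 29 0)) (routed t (ar m1 29 0) (slacks m0 n))"
        by (rule second_inv_step[OF I True R sc])
      then show ?thesis unfolding b
      proof (rule second_inv_cong[OF _ R])
        show "((\<lambda>i. ar m0 27 (int i))(t := ar m1 29 0)) i = ar (sem (grid route_body) m2) 27 (int i)" for i
          by (simp add: route_frame m2_def f1)
        show "routed t (ar m1 29 0) (slacks m0 n) e f = slacks (sem (grid route_body) m2) n e f" if "e < n" "f < n" for e f
          unfolding routed_route[OF st2 t(1) that] by (simp add: m2_def routed_def slacks_def f1)
      qed
    qed
    then show "?I (Suc t) (upd (sem ?b m0) 5 0 (int (Suc t)))"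
      by (simp add: slacks_def[abs_def])
  qed
qed

end

section \<open>Numerators of the split commodities\<close>

lemma diff_spec:
  assumes "ar m 60 0 = int n" "ar m 5 0 = int i" "ar m 19 (int i) = int lo" "ar m 20 (int i) = int hi"
  defines "m' \<equiv> sem (For 6 60 diff_body) m"
  shows "ar m' 31 0 = ar m 31 0 + (\<Sum>e<n. if lo \<le> e \<and> e < hi then ar m 22 (int e) else - ar m 22 (int e))"
    (is "?I n m'")
  unfolding m'_def
proof (rule For_inv[where RO = "{60, 61}" and I = ?I])
  fix t m'
  assume t: "t < n" "ar m' 6 0 = int t" and I: "?I t m'"
    and fr: "\<And>j. j < 64 \<Longrightarrow> j \<notin> insert 6 (wr diff_body) \<Longrightarrow> ar m' j = ar m j"
  have fr: "ar m' 5 = ar m 5" "ar m' 19 = ar m 19" "ar m' 20 = ar m 20" "ar m' 22 = ar m 22"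
    by (intro fr; simp add: prog_defs)+
  show "?I (Suc t) (upd (sem diff_body m') 6 0 (int (Suc t)))"
    using t(2) assms I by (simp add: diff_body_def fr)
qed (use assms in \<open>simp_all add: prog_defs\<close>)

lemma double_spec:
  assumes "ar m 61 0 = int k"
  shows "ar (sem (For 7 61 (Asg 42 (Lit 0) (Times (Lit 2) (var 42)))) m) 42 0 = 2 ^ k * ar m 42 0"
  by (rule For_inv[where RO = "{60, 61}" and I = "\<lambda>t m'. ar m' 42 0 = 2 ^ t * ar m 42 0"]) (use assms in auto)

text \<open>Rounded down for a positive gain and up otherwise, so that rounding never raises the
  cost. The divisor is \<open>2 * d\<close> because \<open>A\<close> is twice the amount.\<close>

definition numerator :: "nat \<Rightarrow> int \<Rightarrow> int \<Rightarrow> int \<Rightarrow> int" where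
  "numerator k A d g = (if 0 < g then (2 ^ k * A) div (2 * d) else - ((- (2 ^ k * A)) div (2 * d)))"

lemma div_bounds: "0 < b \<Longrightarrow> a div b * b \<le> a \<and> a < a div b * b + (b :: int)"
  using div_mult_mod_eq[of a b] pos_mod_bound[of b a] pos_mod_sign[of b a] by linarith

lemma numerator_props:
  assumes "0 \<le> A" "A \<le> 2 * d" "0 < d"
  shows "0 \<le> numerator k A d g" "numerator k A d g \<le> 2 ^ k"
    "\<bar>real_of_int (numerator k A d g) * real_of_int d - 2 ^ k * (real_of_int A / 2)\<bar> \<le> real_of_int d"
    "real_of_int (numerator k A d g) * real_of_int d * real_of_int g \<le> 2 ^ k * (real_of_int A / 2) * real_of_int g"
proof -
  define p where "p = 2 ^ k * A"
  define u where "u = p div (2 * d)"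
  define w where "w = (- p) div (2 * d)"
  let ?N = "numerator k A d g"
  have N: "?N = (if 0 < g then u else - w)" by (simp only: numerator_def p_def u_def w_def)
  have fl: "u * (2 * d) \<le> p" "p < u * (2 * d) + 2 * d" and ce: "w * (2 * d) \<le> - p" "- p < w * (2 * d) + 2 * d"
    using div_bounds[of "2 * d" p] div_bounds[of "2 * d" "- p"] assms(3) unfolding u_def w_def by simp_all
  have p: "0 \<le> p" "p \<le> 2 ^ k * (2 * d)" unfolding p_def using assms by (auto intro: mult_left_mono)
  have "u * (2 * d) \<le> 2 ^ k * (2 * d)" using fl(1) p(2) by (rule order_trans)
  then have u1: "u \<le> 2 ^ k" by (rule mult_right_le_imp_le) (use assms(3) in simp)
  have "- w * (2 * d) < (2 ^ k + 1) * (2 * d)" using ce(2) p(2) by (simp add: algebra_simps)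
  then have "- w < 2 ^ k + 1" by (rule mult_right_less_imp_less) (use assms(3) in simp)
  then have w1: "- w \<le> 2 ^ k" by simp
  have "(- 1) * (2 * d) < u * (2 * d)" using fl(2) p(1) by (simp add: algebra_simps)
  then have "- 1 < u" by (rule mult_right_less_imp_less) (use assms(3) in simp)
  moreover have "w * (2 * d) \<le> 0 * (2 * d)" using ce(1) p(1) by linarith
  then have "w \<le> 0" by (rule mult_right_le_imp_le) (use assms(3) in simp)
  ultimately show "0 \<le> ?N" "?N \<le> 2 ^ k" using u1 w1 unfolding N by simp_all
  have "\<bar>?N * (2 * d) - p\<bar> \<le> 2 * d" using fl ce unfolding N by (cases "0 < g") simp_all
  then have "\<bar>real_of_int (?N * (2 * d) - p)\<bar> \<le> real_of_int (2 * d)" by (simp only: of_int_abs[symmetric] of_int_le_iff)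
  then show "\<bar>real_of_int ?N * real_of_int d - 2 ^ k * (real_of_int A / 2)\<bar> \<le> real_of_int d"
    by (simp add: p_def abs_le_iff)
  have "?N * (2 * d) * g \<le> p * g"
  proof (cases "0 < g")
    case True
    then show ?thesis using fl(1) unfolding N by (simp add: mult_right_mono)
  next
    case False
    then have "p \<le> ?N * (2 * d)" using ce(1) unfolding N by simp
    then show ?thesis using False by (intro mult_right_mono_neg) auto
  qed
  then have "real_of_int (?N * (2 * d) * g) \<le> real_of_int (p * g)" by (simp only: of_int_le_iff)
  then show "real_of_int ?N * real_of_int d * real_of_int g \<le> 2 ^ k * (real_of_int A / 2) * real_of_int g"
    by (simp add: p_def)
qed

lemma vertex_body_spec:
  assumes "ar m 60 0 = int n" "ar m 61 0 = int k" "ar m 5 0 = int i" "ar m 19 (int i) = int lo" "ar m 20 (int i) = int hi"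
  defines "g \<equiv> \<Sum>e<n. if lo \<le> e \<and> e < hi then ar m 22 (int e) else - ar m 22 (int e)"
  defines "m' \<equiv> sem vertex_body m"
  shows "ar m' 32 = (ar m 32)(int lo := numerator k (ar m 27 (int i)) (ar m 21 (int i)) g)"
    "ar m' 33 = (ar m 33)(int lo := ar m 21 (int i))" "ar m' 34 = (ar m 34)(int lo := ar m 21 (int i) * g)"
proof -
  define m1 where "m1 = sem (For 6 60 diff_body) (upd m 31 0 0)"
  define m2 where "m2 = upd m1 42 0 (ar m1 27 (ar m1 5 0))"
  define m3 where "m3 = sem (For 7 61 (Asg 42 (Lit 0) (Times (Lit 2) (var 42)))) m2"
  have f1: "ar m1 j = ar m j" if "j < 64" "j \<noteq> 6" "j \<noteq> 31" for j
    using sem_frame[of "{60, 61}" "For 6 60 diff_body" j "upd m 31 0 0"] that by (simp add: m1_def prog_defs)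
  have f2: "ar m2 j = ar m1 j" if "j < 64" "j \<noteq> 42" for j using that by (simp add: m2_def)
  have f3: "ar m3 j = ar m2 j" if "j < 64" "j \<noteq> 42" "j \<noteq> 7" for j
    using sem_frame[of "{60, 61}" "For 7 61 (Asg 42 (Lit 0) (Times (Lit 2) (var 42)))" j m2] that by (simp add: m3_def)
  have "ar m1 31 0 = g"
    using diff_spec[of "upd m 31 0 0" n i lo hi] assms(1-5) by (simp add: m1_def g_def cong: if_cong)
  then have g: "ar m3 31 0 = g" by (simp add: f3 f2)
  have "ar m2 61 0 = int k" "ar m2 42 0 = ar m 27 (int i)" using assms(2,3) by (simp_all add: f2 f1, simp add: m2_def f1)
  from double_spec[OF this(1)] this(2) have N: "ar m3 42 0 = 2 ^ k * ar m 27 (int i)" by (simp add: m3_def)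
  have v: "ar m3 5 0 = int i" "ar m3 19 (int i) = int lo" "ar m3 21 = ar m 21" "ar m3 32 = ar m 32" "ar m3 33 = ar m 33" "ar m3 34 = ar m 34"
    using assms(3,4) by (simp_all add: f3 f2 f1)
  show "ar m' 32 = (ar m 32)(int lo := numerator k (ar m 27 (int i)) (ar m 21 (int i)) g)"
    "ar m' 33 = (ar m 33)(int lo := ar m 21 (int i))" "ar m' 34 = (ar m 34)(int lo := ar m 21 (int i) * g)"
    by (simp_all add: m'_def vertex_body_def m1_def[symmetric] m2_def[symmetric] m3_def[symmetric] v g N numerator_def)
qed

text \<open>Distinct left ends keep the commodities from overwriting each other's entries. All other
  vertices retain \<open>0\<close>, so they neither move the walks nor contribute to the
  cost.\<close>

lemma (in int_chords) vertex_pass: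
  assumes st: "statics m" and ST: "\<forall>i<k. ar m 26 (int i) \<in> {0, 1}"
    and inj: "inj_on l (unfixed m)"
    and zero: "\<forall>v<n. ar m 32 (int v) = 0 \<and> ar m 33 (int v) = 0 \<and> ar m 34 (int v) = 0"
  defines "m' \<equiv> sem (For 5 61 (Ite (Minus (Lit 1) (arr 26 (var 5))) vertex_body skip)) m"
    and "g \<equiv> \<lambda>i. \<Sum>e<n. if l i \<le> e \<and> e < r i then ar m 22 (int e) else - ar m 22 (int e)"
  shows "\<forall>i\<in>unfixed m. ar m' 32 (int (l i)) = numerator k (ar m 27 (int i)) (D i) (g i) \<and>
      ar m' 33 (int (l i)) = D i \<and> ar m' 34 (int (l i)) = D i * g i"
    and "\<forall>v<n. v \<notin> l ` unfixed m \<longrightarrow> ar m' 32 (int v) = 0 \<and> ar m' 33 (int v) = 0 \<and> ar m' 34 (int v) = 0"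
proof -
  let ?b = "Ite (Minus (Lit 1) (arr 26 (var 5))) vertex_body skip"
  let ?R = "\<lambda>t. {i \<in> unfixed m. i < t}"
  let ?I = "\<lambda>t m'. (\<forall>i\<in>?R t. ar m' 32 (int (l i)) = numerator k (ar m 27 (int i)) (D i) (g i) \<and>
      ar m' 33 (int (l i)) = D i \<and> ar m' 34 (int (l i)) = D i * g i) \<and>
    (\<forall>v<n. v \<notin> l ` ?R t \<longrightarrow> ar m' 32 (int v) = 0 \<and> ar m' 33 (int v) = 0 \<and> ar m' 34 (int v) = 0)"
  have "?I k m'" unfolding m'_def
  proof (rule For_inv[where RO = "{60, 61, 21}" and I = ?I])
    show "chk {60, 61, 21} (For 5 61 ?b)" by (simp add: prog_defs)
    show "ar m 61 0 = int k" using st by (simp add: statics_def)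
    show "?I 0 (upd m 5 0 0)" using zero by simp
    fix t m0 assume t: "t < k" "ar m0 5 0 = int t" and I: "?I t m0"
      and fr: "\<And>j. j < 64 \<Longrightarrow> j \<notin> insert 5 (wr ?b) \<Longrightarrow> ar m0 j = ar m j"
    have fr: "ar m0 19 = ar m 19" "ar m0 20 = ar m 20" "ar m0 21 = ar m 21" "ar m0 22 = ar m 22" "ar m0 26 = ar m 26"
      "ar m0 27 = ar m 27" "ar m0 60 = ar m 60" "ar m0 61 = ar m 61" by (intro fr; simp add: prog_defs)+
    have "?I (Suc t) (sem ?b m0)"
    proof (cases "t \<in> unfixed m")
      case False
      then have "ar m0 26 (int t) = 1" using ST t(1) by (auto simp: fr unfixed_def)
      then have "sem ?b m0 = sem skip m0" using t(2) by simp
      moreover have "?R (Suc t) = ?R t" using False by (auto simp: less_Suc_eq)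
      ultimately show ?thesis using I by simp
    next
      case True
      then have "ar m 26 (int t) = 0" by (simp add: unfixed_def)
      then have b: "sem ?b m0 = sem vertex_body m0" using t(2) by (simp add: fr)
      have R: "?R (Suc t) = insert t (?R t)" using True by (auto simp: less_Suc_eq)
      have lt: "l i \<noteq> l t" if "i \<in> ?R t" for i using that True inj by (auto simp: inj_on_def)
      have st': "ar m 60 0 = int n" "ar m 61 0 = int k" "ar m 19 (int t) = int (l t)" "ar m 20 (int t) = int (r t)" "ar m 21 (int t) = D t"
        using st t(1) by (auto simp: statics_def)
      note S = vertex_body_spec[of m0 n k t "l t" "r t", unfolded fr, OF st'(1,2) t(2) st'(3,4), folded g_def, unfolded st'(5)]
      have gt: "(\<Sum>e<n. if l t \<le> e \<and> e < r t then ar m 22 (int e) else - ar m 22 (int e)) = g t" by (simp add: g_def)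
      show ?thesis unfolding b R using S[unfolded gt] I lt by auto
    qed
    then show "?I (Suc t) (upd (sem ?b m0) 5 0 (int (Suc t)))" by simp
  qed
  moreover have "?R k = unfixed m" by (auto simp: unfixed_def)
  ultimately show "\<forall>i\<in>unfixed m. ar m' 32 (int (l i)) = numerator k (ar m 27 (int i)) (D i) (g i) \<and>
      ar m' 33 (int (l i)) = D i \<and> ar m' 34 (int (l i)) = D i * g i"
    and "\<forall>v<n. v \<notin> l ` unfixed m \<longrightarrow> ar m' 32 (int v) = 0 \<and> ar m' 33 (int v) = 0 \<and> ar m' 34 (int v) = 0"
    by simp_all
qed

section \<open>Walk, bisection and halving in memory\<close>

lemma walk_spec:
  assumes "ar m 60 0 = int n" "q \<in> {36, 38}"
  defines "d \<equiv> \<lambda>v. if odd (ar m 32 (int v)) then ar m 33 (int v) else 0"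
  defines "e \<equiv> \<lambda>v. if odd (ar m 32 (int v)) then dir d (ar m q 0) v else 0"
  defines "m' \<equiv> sem (walk q) m"
  shows "ar m' 39 0 = pos d (ar m q 0) n" "\<forall>v<n. ar m' 35 (int v) = e v"
    "ar m' 41 0 = (\<Sum>v<n. ar m 34 (int v) * e v)"
    "j < 64 \<Longrightarrow> j \<notin> {6, 35, 39, 41} \<Longrightarrow> ar m' j = ar m j"
proof -
  define m1 where "m1 = upd (upd m 39 0 (ar m q 0)) 41 0 0"
  have m1: "ar m1 j = ar m j" if "j < 64" "j \<noteq> 39" "j \<noteq> 41" for j using that by (simp add: m1_def)
  have m': "m' = sem (For 6 60 walk_body) m1" using assms(2) by (auto simp: m'_def walk_def m1_def)
  let ?I = "\<lambda>t m'. ar m' 39 0 = pos d (ar m q 0) t \<and> (\<forall>v<t. ar m' 35 (int v) = e v) \<and> ar m' 41 0 = (\<Sum>v<t. ar m 34 (int v) * e v)"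
  have "?I n m'" unfolding m'
  proof (rule For_inv[where RO = "{60, 61}" and I = ?I])
    show "chk {60, 61} (For 6 60 walk_body)" by (simp add: prog_defs)
    show "ar m1 60 0 = int n" using assms(1) by (simp add: m1)
    show "?I 0 (upd m1 6 0 0)" by (simp add: m1_def)
    fix t m0 assume t: "t < n" "ar m0 6 0 = int t" and I: "?I t m0"
      and fr: "\<And>j. j < 64 \<Longrightarrow> j \<notin> insert 6 (wr walk_body) \<Longrightarrow> ar m0 j = ar m1 j"
    have fr: "ar m0 32 = ar m 32" "ar m0 33 = ar m 33" "ar m0 34 = ar m 34"
      by (subst fr; simp add: prog_defs m1)+
    have odd: "2 * (x div 2) < x \<longleftrightarrow> odd x" for x :: int by (auto elim!: evenE oddE)
    show "?I (Suc t) (upd (sem walk_body m0) 6 0 (int (Suc t)))"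
      using I t(2) by (auto simp: walk_body_def fr odd e_def d_def dir_def less_Suc_eq)
  qed
  then show "ar m' 39 0 = pos d (ar m q 0) n" "\<forall>v<n. ar m' 35 (int v) = e v"
    "ar m' 41 0 = (\<Sum>v<n. ar m 34 (int v) * e v)" by auto
  show "ar m' j = ar m j" if "j < 64" "j \<notin> {6, 35, 39, 41}"
    unfolding m' using sem_frame[of "{60, 61}" "For 6 60 walk_body" j m1] that by (simp add: prog_defs m1)
qed

lemma bisect_body_spec:
  assumes "ar m 60 0 = int n"
  defines "d \<equiv> \<lambda>v. if odd (ar m 32 (int v)) then ar m 33 (int v) else 0"
  defines "m' \<equiv> sem bisect_body m"
  shows "(ar m' 36 0, ar m' 37 0) = bisect d n (ar m 36 0, ar m 37 0)"
proof (cases "1 < ar m 37 0 - ar m 36 0")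
  case False
  then show ?thesis by (simp add: m'_def bisect_body_def bisect_def)
next
  case True
  define mid where "mid = (ar m 36 0 + ar m 37 0) div 2"
  define m1 where "m1 = upd m 38 0 mid"
  define m2 where "m2 = sem (walk 38) m1"
  have "ar m1 60 0 = int n" "38 \<in> {36, 38::nat}" using assms(1) by (simp_all add: m1_def)
  note W = walk_spec[OF this, folded m2_def]
  have "ar m2 39 0 = pos d mid n" using W(1) by (simp add: m1_def d_def cong: if_cong)
  moreover have "ar m2 36 0 = ar m 36 0" "ar m2 37 0 = ar m 37 0" "ar m2 38 0 = mid" using W(4) by (simp_all add: m1_def)
  ultimately show ?thesis
    using True by (auto simp: m'_def bisect_body_def mid_def[symmetric] m1_def[symmetric] m2_def[symmetric] bisect_def Let_def)
qed

lemma level_body_spec: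
  assumes st: "ar m 60 0 = int n" "ar m 62 0 = int \<beta>"
    and D: "0 < D" "ar m 24 0 = D" "D \<le> 2 ^ \<beta>"
    and dd: "\<And>v. v < n \<Longrightarrow> 0 \<le> ar m 33 (int v) \<and> ar m 33 (int v) \<le> D"
    and inv: "halving_inv n K (\<lambda>v. ar m 33 (int v)) D (\<lambda>v. real_of_int (ar m 34 (int v))) N0 t (\<lambda>v. ar m 32 (int v))"
    and t: "t < K"
  shows "halving_inv n K (\<lambda>v. ar m 33 (int v)) D (\<lambda>v. real_of_int (ar m 34 (int v))) N0 (Suc t)
    (\<lambda>v. ar (sem level_body m) 32 (int v))"
proof -
  define d where "d = (\<lambda>v. if odd (ar m 32 (int v)) then ar m 33 (int v) else 0)"
  define m1 where "m1 = upd (upd m 36 0 0) 37 0 D"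
  define m2 where "m2 = sem (For 9 62 bisect_body) m1"
  define m3 where "m3 = sem (walk 36) m2"
  define m4 where "m4 = sem (For 6 60 halve_body) m3"
  have lev: "sem level_body m = m4"
    using D(2) by (simp add: level_body_def m1_def m2_def m3_def m4_def)
  have f1: "ar m1 j = ar m j" if "j < 64" "j \<notin> {36, 37}" for j using that by (simp add: m1_def)
  have f2: "ar m2 j = ar m j" if "j < 64" "j \<notin> {3, 6, 9, 35, 36, 37, 38, 39, 41}" for j
    using sem_frame[of "{60, 61, 62}" "For 9 62 bisect_body" j m1] that f1[of j] by (simp add: m2_def prog_defs)
  have "(ar m2 36 0, ar m2 37 0) = (bisect d n ^^ \<beta>) (0, D)" unfolding m2_def
  proof (rule For_inv[where RO = "{60, 61, 62}" and I = "\<lambda>s m'. (ar m' 36 0, ar m' 37 0) = (bisect d n ^^ s) (0, D)"])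
    show "chk {60, 61, 62} (For 9 62 bisect_body)" by (simp add: prog_defs)
    show "ar m1 62 0 = int \<beta>" using st by (simp add: f1)
    show "(ar (upd m1 9 0 0) 36 0, ar (upd m1 9 0 0) 37 0) = (bisect d n ^^ 0) (0, D)" by (simp add: m1_def)
    fix s m0 assume I: "(ar m0 36 0, ar m0 37 0) = (bisect d n ^^ s) (0, D)"
      and fr: "\<And>j. j < 64 \<Longrightarrow> j \<notin> insert 9 (wr bisect_body) \<Longrightarrow> ar m0 j = ar m1 j"
    have fr: "ar m0 60 = ar m 60" "ar m0 32 = ar m 32" "ar m0 33 = ar m 33"
      by (subst fr; simp add: prog_defs f1)+
    have "(ar (sem bisect_body m0) 36 0, ar (sem bisect_body m0) 37 0) = bisect d n (ar m0 36 0, ar m0 37 0)"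
      using bisect_body_spec[of m0 n] st(1) unfolding d_def fr by simp
    then show "(ar (upd (sem bisect_body m0) 9 0 (int (Suc s))) 36 0, ar (upd (sem bisect_body m0) 9 0 (int (Suc s))) 37 0) = (bisect d n ^^ Suc s) (0, D)"
      using I by simp
  qed
  moreover have "bracket d n D 0 D" using dd D(1) by (intro bracket_init) (auto simp: d_def)
  then have "\<exists>q. (bisect d n ^^ \<beta>) (0, D) = (q, q + 1) \<and> bracket d n D q (q + 1)"
    using D(3) by (intro bracket_iterate) auto
  ultimately obtain q where q: "ar m2 36 0 = q" "bracket d n D q (q + 1)" by auto
  define e where "e = (\<lambda>v. if odd (ar m 32 (int v)) then dir d q v else 0)"
  have "ar m2 60 0 = int n" "36 \<in> {36, 38::nat}" using st(1) by (simp_all add: f2)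
  note W = walk_spec[OF this, folded m3_def]
  have arrs: "ar m2 32 = ar m 32" "ar m2 33 = ar m 33" "ar m2 34 = ar m 34" by (simp_all add: f2)
  have e: "\<forall>v<n. ar m3 35 (int v) = e v" and kap: "ar m3 41 0 = (\<Sum>v<n. ar m 34 (int v) * e v)"
    using W(2,3)[unfolded arrs q(1), folded d_def] unfolding e_def by simp_all
  have f3: "ar m3 32 = ar m 32" "ar m3 60 = ar m 60" using W(4) by (simp_all add: f2)
  \<comment> \<open>At cost \<open>0\<close> both directions are admissible; the program then adds
    the signs, which matches the choice in \<open>halving_round\<close>.\<close>
  define s :: int where "s = (if 0 < ar m3 41 0 then - 1 else 1)"
  have halve: "\<forall>v<n. ar m4 32 (int v) = (ar m 32 (int v) + s * e v) div 2"
  proof -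
    have "(\<forall>v<n. ar m4 32 (int v) = (ar m 32 (int v) + s * e v) div 2) \<and> (\<forall>v\<ge>n. ar m4 32 (int v) = ar m 32 (int v))"
      unfolding m4_def
    proof (rule For_inv[where RO = "{60, 61}" and I = "\<lambda>t m'. (\<forall>v<t. ar m' 32 (int v) = (ar m 32 (int v) + s * e v) div 2) \<and> (\<forall>v\<ge>t. ar m' 32 (int v) = ar m 32 (int v))"])
      show "chk {60, 61} (For 6 60 halve_body)" by (simp add: prog_defs)
      show "ar m3 60 0 = int n" using st by (simp add: f3)
      fix t m0 assume t: "t < n" "ar m0 6 0 = int t"
        and I: "(\<forall>v<t. ar m0 32 (int v) = (ar m 32 (int v) + s * e v) div 2) \<and> (\<forall>v\<ge>t. ar m0 32 (int v) = ar m 32 (int v))"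
        and fr: "\<And>j. j < 64 \<Longrightarrow> j \<notin> insert 6 (wr halve_body) \<Longrightarrow> ar m0 j = ar m3 j"
      have fr: "ar m0 35 = ar m3 35" "ar m0 41 = ar m3 41" by (intro fr; simp add: prog_defs)+
      show "(\<forall>v<Suc t. ar (upd (sem halve_body m0) 6 0 (int (Suc t))) 32 (int v) = (ar m 32 (int v) + s * e v) div 2) \<and>
          (\<forall>v\<ge>Suc t. ar (upd (sem halve_body m0) 6 0 (int (Suc t))) 32 (int v) = ar m 32 (int v))"
        using I t e by (auto simp: halve_body_def fr s_def less_Suc_eq)
    qed (simp add: f3)
    then show ?thesis by blast
  qed
  have s: "s = (if (\<Sum>v<n. real_of_int (ar m 34 (int v)) * real_of_int (e v)) \<le> 0 then 1 else - 1)"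
  proof -
    have "(\<Sum>v<n. real_of_int (ar m 34 (int v)) * real_of_int (e v)) = real_of_int (ar m3 41 0)" by (simp add: kap)
    then show ?thesis by (auto simp: s_def)
  qed
  show ?thesis unfolding lev
    by (rule halving_round[OF inv t dd q(2)[unfolded d_def] _ s]) (use halve in \<open>auto simp: e_def d_def\<close>)
qed

lemma level_prog_spec:
  assumes st: "ar m 60 0 = int n" "ar m 61 0 = int K" "ar m 62 0 = int \<beta>"
    and D: "0 < D" "ar m 24 0 = D" "D \<le> 2 ^ \<beta>"
    and dd: "\<And>v. v < n \<Longrightarrow> 0 \<le> ar m 33 (int v) \<and> ar m 33 (int v) \<le> D"
    and N: "\<And>v. v < n \<Longrightarrow> 0 \<le> ar m 32 (int v) \<and> ar m 32 (int v) \<le> 2 ^ K"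
  shows "halving_inv n K (\<lambda>v. ar m 33 (int v)) D (\<lambda>v. real_of_int (ar m 34 (int v))) (\<lambda>v. ar m 32 (int v)) K
    (\<lambda>v. ar (sem level_prog m) 32 (int v))"
proof -
  let ?I = "\<lambda>t m'. halving_inv n K (\<lambda>v. ar m 33 (int v)) D (\<lambda>v. real_of_int (ar m 34 (int v)))
    (\<lambda>v. ar m 32 (int v)) t (\<lambda>v. ar m' 32 (int v))"
  have "?I K (sem (For 8 61 level_body) m)"
  proof (rule For_inv[where RO = "{60, 61, 62, 24, 33, 34}" and I = ?I])
    fix t m0 assume t: "t < K" and I: "?I t m0"
      and fr: "\<And>j. j < 64 \<Longrightarrow> j \<notin> insert 8 (wr level_body) \<Longrightarrow> ar m0 j = ar m j"
    have fr: "ar m0 24 = ar m 24" "ar m0 33 = ar m 33" "ar m0 34 = ar m 34" "ar m0 60 = ar m 60" "ar m0 62 = ar m 62"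
      by (intro fr; simp add: prog_defs)+
    show "?I (Suc t) (upd (sem level_body m0) 8 0 (int (Suc t)))"
      using level_body_spec[of m0 n \<beta> D K "\<lambda>v. ar m 32 (int v)" t] assms I t by (simp add: fr)
  qed (use st halving_init[OF N] in \<open>simp_all add: prog_defs\<close>)
  then show ?thesis by (simp only: level_prog_def)
qed

lemma choose_spec:
  assumes "ar m 61 0 = int k"
  defines "F \<equiv> \<lambda>i. if ar m 26 (int i) \<le> 0 then ar m 32 (ar m 19 (int i)) else ar m 28 (int i)"
  shows "\<forall>i<k. ar (sem choose_prog m) 4 (int i) = (if (0 < F i) = (ar m 10 (int i) < ar m 11 (int i)) then 1 else 2)"
proof -
  let ?c = "\<lambda>i. if (0 < F i) = (ar m 10 (int i) < ar m 11 (int i)) then 1 else 2 :: int"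
  let ?I = "\<lambda>t m'. (\<forall>i\<ge>t. ar m' 28 (int i) = ar m 28 (int i)) \<and> (\<forall>i<t. ar m' 4 (int i) = ?c i)"
  have "?I k (sem choose_prog m)" unfolding choose_prog_def
  proof (rule For_inv[where RO = "{60, 61}" and I = ?I])
    fix t m0 assume t: "t < k" "ar m0 5 0 = int t" and I: "?I t m0"
      and fr: "\<And>j. j < 64 \<Longrightarrow> j \<notin> insert 5 (wr choose_body) \<Longrightarrow> ar m0 j = ar m j"
    have fr: "ar m0 10 = ar m 10" "ar m0 11 = ar m 11" "ar m0 19 = ar m 19" "ar m0 26 = ar m 26" "ar m0 32 = ar m 32"
      by (intro fr; simp add: prog_defs)+
    have "ar (sem choose_body m0) 28 = (ar m0 28)(int t := F t)" "ar (sem choose_body m0) 4 = (ar m0 4)(int t := ?c t)"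
      using I t by (auto simp: choose_body_def fr skip_def fun_eq_iff F_def)
    then show "?I (Suc t) (upd (sem choose_body m0) 5 0 (int (Suc t)))" using I by (auto simp: less_Suc_eq)
  qed (use assms in \<open>simp_all add: prog_defs\<close>)
  then show ?thesis by blast
qed

text \<open>The routing \<open>b\<close> found by the two passes mediates between the unsplit
  amounts \<open>y\<close> and the given loads.\<close>

lemma (in int_chords) split_level_spec:
  assumes st: "statics m" and X: "\<And>e. e < n \<Longrightarrow> ar m 23 (int e) = X0 e"
    and ST: "\<forall>i<k. ar m 26 (int i) = 0"
    and zero: "\<forall>v<n. ar m 32 (int v) = 0 \<and> ar m 33 (int v) = 0 \<and> ar m 34 (int v) = 0"
    and a: "feasible {..<k} (\<lambda>e. real_of_int (X0 e)) a"
    and DM: "\<forall>i<k. D i \<le> ar m 24 0" "0 \<le> ar m 24 0" "ar m 24 0 < 2 ^ \<beta>" "ar m 62 0 = int \<beta>"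
  defines "m6 \<equiv> sem level_prog (sem split_prog m)"
  defines "F \<equiv> \<lambda>i. 0 < (if ar m6 26 (int i) \<le> 0 then ar m6 32 (ar m6 19 (int i)) else ar m6 28 (int i))"
  defines "y \<equiv> \<lambda>i. if F i then real_of_int (D i) else 0" and "c \<equiv> \<lambda>e. real_of_int (ar m 22 (int e))"
  shows "\<exists>b. feasible {..<k} (\<lambda>e. real_of_int (X0 e)) b \<and> (\<Sum>i<k. y i * gain c i) \<le> (\<Sum>i<k. b i * gain c i) \<and>
    (\<forall>e<n. load {..<k} y e \<le> real_of_int (X0 e) + 13 / 5 * real_of_int (ar m 24 0))"
proof -
  let ?vb = "For 5 61 (Ite (Minus (Lit 1) (arr 26 (var 5))) vertex_body skip)"
  define m1 where "m1 = sem (grid slack_body) m"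
  define m2 where "m2 = sem (pass decide1) m1"
  define m3 where "m3 = sem (pass decide2) m2"
  define m4 where "m4 = sem ?vb m3"
  have m6: "m6 = sem level_prog m4" by (simp add: m6_def split_prog_def m1_def m2_def m3_def m4_def)
  have f1: "ar m1 j = ar m j" if "j < 64" "j \<notin> {3, 5, 6, 7, 25}" for j
    using sem_frame[of "{60, 61, 21}" "grid slack_body" j m] that by (simp add: m1_def prog_defs)
  have f2: "ar m2 j = ar m1 j" if "j < 64" "j \<notin> {3, 5, 6, 7, 25, 26, 27, 28, 29, 30}" for j
    using sem_frame[of "{60, 61, 21}" "pass decide1" j m1] that by (simp add: m2_def prog_defs)
  have f3: "ar m3 j = ar m2 j" if "j < 64" "j \<notin> {3, 5, 6, 7, 25, 27, 29, 30}" for j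
    using sem_frame[of "{60, 61, 21}" "pass decide2" j m2] that by (simp add: m3_def prog_defs)
  have f4: "ar m4 j = ar m3 j" if "j < 64" "j \<notin> {3, 5, 6, 7, 31, 32, 33, 34, 42}" for j
    using sem_frame[of "{60, 61, 21}" ?vb j m3] that by (simp add: m4_def prog_defs)
  have f6: "ar m6 j = ar m4 j" if "j < 64" "j \<notin> {3, 6, 8, 9, 32, 35, 36, 37, 38, 39, 41}" for j
    using sem_frame[of "{60, 61, 62}" level_prog j m4] that by (simp add: m6 prog_defs)
  have stm: "ar m 60 0 = int n" "ar m 61 0 = int k" using st by (auto simp: statics_def)
  have stl: "ar m 19 (int i) = int (l i) \<and> ar m 20 (int i) = int (r i)"
    and stD: "ar m 21 (int i) = D i" if "i < k" for i using st that by (auto simp: statics_def)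
  have st1: "statics m1" "statics m3" using st by (auto simp: statics_def f1 f2 f3)
  have "slacks m1 n e f = X0 e + X0 f - (\<Sum>i<k. if inside i e = inside i f then 0 else D i)" if "e < n" "f < n" for e f
  proof -
    have "slacks m1 n e f = ar m 23 (int e) + ar m 23 (int f) - (\<Sum>i<k. if inside i e = inside i f then 0 else ar m 21 (int i))"
      using slack_body_spec[of m n k l r] st that unfolding m1_def statics_def inside_def by simp
    moreover have "(\<Sum>i<k. if inside i e = inside i f then 0 else ar m 21 (int i)) = (\<Sum>i<k. if inside i e = inside i f then 0 else D i)"
      using st by (intro sum.cong) (auto simp: statics_def)
    ultimately show ?thesis using X that by simp
  qed
  then have "first_inv 0 {..<k} (\<lambda>i. ar m1 28 (int i)) (slacks m1 n)"
    by (intro first_inv_init[OF _ a]) auto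
  from first_pass[OF st1(1) _ this] ST
  have st2: "statics m2" and ST2: "\<forall>i<k. ar m2 26 (int i) \<in> {0, 1}"
    and inv: "first_inv k (unfixed m2) (\<lambda>i. ar m2 28 (int i)) (slacks m2 n)" by (simp_all add: f1 m2_def)
  define R where "R = unfixed m2"
  define A where "A = (\<lambda>i. ar m3 27 (int i))"
  have R: "R \<subseteq> {..<k}" by (auto simp: R_def unfixed_def)
  note cr = first_inv_final(1)[OF inv, folded R_def] and Dpos = first_inv_final(2)[OF inv, folded R_def]
  have inj: "inj_on l R" by (rule inj_onI) (use cr in \<open>force simp: crossing_def\<close>)
  note sec = second_pass[OF st2 ST2 inv, folded m3_def, folded R_def A_def]
  define b where "b i = (if i \<in> R then real_of_int (A i) / 2 else real_of_int (ar m2 28 (int i) * D i))" for i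
  have b: "feasible {..<k} (\<lambda>e. real_of_int (X0 e)) b"
    using second_inv_final[OF inv[folded R_def] sec] by (simp add: b_def[abs_def])
  have F01: "ar m2 28 (int i) \<in> {0, 1}" if "i < k" "i \<notin> R" for i using inv that by (simp add: first_inv_def R_def)
  have A: "0 \<le> A i" "A i \<le> 2 * D i" if "i \<in> R" for i
    using sec that R unfolding second_inv_def Let_def by auto
  have R3: "unfixed m3 = R" by (simp add: R_def unfixed_def f3)
  define g where "g i = (\<Sum>e<n. if l i \<le> e \<and> e < r i then ar m3 22 (int e) else - ar m3 22 (int e))" for i
  have gain: "gain c i = real_of_int (g i)" for i
    by (simp add: gain_def cost_diff_def g_def c_def f3 f2 f1 if_distrib cong: if_cong)
  have ST3: "\<forall>i<k. ar m3 26 (int i) \<in> {0, 1}" using ST2 by (simp add: f3)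
  have zero3: "\<forall>v<n. ar m3 32 (int v) = 0 \<and> ar m3 33 (int v) = 0 \<and> ar m3 34 (int v) = 0"
    using zero by (simp add: f3 f2 f1)
  note V = vertex_pass[OF st1(2) ST3 inj[folded R3] zero3, folded m4_def g_def, unfolded R3]
  define dd where "dd v = ar m4 33 (int v)" for v
  define N where "N v = ar m4 32 (int v)" for v
  define H where "H v = real_of_int (ar m4 34 (int v))" for v
  have at: "dd (l i) = D i" "H (l i) = real_of_int (D i) * gain c i" "N (l i) = numerator k (A i) (D i) (g i)" if "i \<in> R" for i
    using V(1) that by (auto simp: dd_def H_def N_def gain A_def)
  have out: "dd v = 0 \<and> H v = 0 \<and> N v = 0" if "v < n" "v \<notin> l ` R" for v
    using V(2) that by (auto simp: dd_def H_def N_def)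
  have Np: "0 \<le> N (l i)" "N (l i) \<le> 2 ^ k"
      "\<bar>real_of_int (N (l i)) * real_of_int (D i) - 2 ^ k * b i\<bar> \<le> real_of_int (D i)"
      "real_of_int (N (l i)) * real_of_int (D i) * gain c i \<le> 2 ^ k * b i * gain c i" if "i \<in> R" for i
    using numerator_props[OF A[OF that] Dpos[OF that], of k "g i"] that by (simp_all add: at gain b_def)
  have Nb: "0 \<le> N v \<and> N v \<le> 2 ^ k" if "v < n" for v
  proof (cases "v \<in> l ` R")
    case True
    then show ?thesis using Np(1,2) by auto
  qed (use out[OF that] in auto)
  have ddb: "0 \<le> dd v \<and> dd v \<le> ar m 24 0" if "v < n" for v
  proof (cases "v \<in> l ` R")
    case True
    then obtain i where "i \<in> R" "v = l i" by auto
    then show ?thesis using at(1) Dpos[of i] DM(1) R by auto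
  qed (use out[OF that] DM(2) in auto)
  \<comment> \<open>If nothing is split, the largest demand may be \<open>0\<close>, and then no
    bracket exists. The default \<open>0\<close> covers this case, in which no commodity consults
    \<open>z\<close>.\<close>
  define z where "z v = (if R = {} then 0 else ar m6 32 (int v))" for v
  have z: "halving_inv n k dd (ar m 24 0) H N k z"
  proof (cases "R = {}")
    case True
    then have "N v = 0" if "v < n" for v using out that by blast
    then show ?thesis using True unfolding halving_inv_def by (auto simp: z_def tilt_def DM(2))
  next
    case False
    then obtain i where "i \<in> R" by blast
    then have "0 < ar m 24 0" using Dpos[of i] DM(1) R by force
    then have "halving_inv n k (\<lambda>v. ar m4 33 (int v)) (ar m 24 0) (\<lambda>v. real_of_int (ar m4 34 (int v))) (\<lambda>v. ar m4 32 (int v)) k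
      (\<lambda>v. ar (sem level_prog m4) 32 (int v))"
      using stm DM ddb Nb by (intro level_prog_spec[where \<beta> = \<beta>]) (auto simp: f4 f3 f2 f1 dd_def N_def)
    then show ?thesis using False by (simp add: m6 z_def[abs_def] dd_def[abs_def] H_def[abs_def] N_def[abs_def])
  qed
  have z01: "z (l i) \<in> {0, 1}" if "i \<in> R" for i
  proof -
    have "l i < n" using that R lr[of i] by auto
    then show ?thesis using z unfolding halving_inv_def by force
  qed
  have y: "y i = (if i \<in> R then real_of_int (D i) * real_of_int (z (l i)) else b i)" if i: "i < k" for i
  proof (cases "i \<in> R")
    case True
    then have "ar m6 26 (int i) = 0" "ar m6 19 (int i) = int (l i)"
      using stl[OF i] by (auto simp: f6 f4 f3 f2 f1 R_def unfixed_def)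
    moreover have "ar m6 32 (int (l i)) = z (l i)" using True by (auto simp: z_def)
    ultimately show ?thesis using True z01[OF True] by (auto simp: y_def F_def)
  next
    case False
    then have "ar m6 26 (int i) = 1" using ST2 i by (auto simp: f6 f4 f3 R_def unfixed_def)
    moreover have "ar m6 28 = ar m2 28" by (simp add: f6 f4 f3)
    ultimately show ?thesis using False F01[OF i False] by (auto simp: y_def F_def b_def)
  qed
  have "i \<in> R \<Longrightarrow> 0 < real_of_int (D i) \<and> real_of_int (D i) \<le> real_of_int (ar m 24 0)" for i
    using Dpos[of i] DM(1) R by auto
  \<comment> \<open>The scaled demands are integers, so scale \<open>1\<close> and demand error
    \<open>0\<close> apply.\<close>
  note RC = round_crossing[OF b R cr _ this, of 1 1 0 "ar m 24 0" dd H c N z y]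
  have bR: "b i \<in> {0, real_of_int (D i)}" if "i < k" "i \<notin> R" for i using F01[OF that] that(2) by (auto simp: b_def)
  have "(\<Sum>i<k. y i * gain c i) \<le> (\<Sum>i<k. b i * gain c i)"
    by (rule RC(2)) (use bR at out Np z y DM(2) in auto)
  moreover have "\<forall>e<n. load {..<k} y e \<le> real_of_int (X0 e) + 13 / 5 * real_of_int (ar m 24 0)"
    by (rule RC(3)) (use bR at out Np z y DM(2) in auto)
  ultimately show ?thesis using b by blast
qed


section \<open>From routings of intervals to paths\<close>

lemma arc_less:
  assumes "s < t" "t < n"
  shows "arc n s t = {s..<t}"
proof -
  have "(t + n - s) mod n = t - s"
  proof -
    have "t + n - s = (t - s) + n" using assms by simp
    then have "(t + n - s) mod n = (t - s) mod n" by (simp only: mod_add_self2)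
    then show ?thesis using assms by simp
  qed
  then have "e \<in> arc n s t \<longleftrightarrow> (\<exists>j<t - s. e = (s + j) mod n)" for e by (auto simp: arc_def)
  moreover have "(\<exists>j<t - s. e = (s + j) mod n) \<longleftrightarrow> e \<in> {s..<t}" for e
  proof
    assume "e \<in> {s..<t}"
    then have "e - s < t - s" "e = (s + (e - s)) mod n" using assms by auto
    then show "\<exists>j<t - s. e = (s + j) mod n" by blast
  qed (use assms in auto)
  ultimately show ?thesis by blast
qed

lemma arc_greater:
  assumes "s < t" "t < n"
  shows "arc n t s = {..<n} - {s..<t}"
proof
  have len: "(s + n - t) mod n = s + n - t" using assms by simp
  show "arc n t s \<subseteq> {..<n} - {s..<t}"
  proof
    fix e assume "e \<in> arc n t s"
    then obtain j where j: "e = (t + j) mod n" "j < s + n - t" by (auto simp: arc_def len)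
    then show "e \<in> {..<n} - {s..<t}"
      using assms by (cases "t + j < n") (auto simp: mod_if)
  qed
  show "{..<n} - {s..<t} \<subseteq> arc n t s"
  proof
    fix e assume e: "e \<in> {..<n} - {s..<t}"
    show "e \<in> arc n t s"
    proof (cases "t \<le> e")
      case True
      then have "e = (t + (e - t)) mod n" "e - t < s + n - t" using e by auto
      then show ?thesis unfolding arc_def len by blast
    next
      case False
      then have "e < s" using e by auto
      then have "t + (e + n - t) = e + n" using assms by simp
      then have "e = (t + (e + n - t)) mod n" using e by simp
      moreover have "e + n - t < s + n - t" using \<open>e < s\<close> assms by simp
      ultimately show ?thesis unfolding arc_def len by blast
    qed
  qed
qed

text \<open>The conclusion that existence and algorithm share.\<close>

definition ring_solution :: "weighted_ring \<Rightarrow> (nat \<Rightarrow> real) \<Rightarrow> (nat \<Rightarrow> nat set) \<Rightarrow> bool" where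
  "ring_solution I x P \<longleftrightarrow> unsplittable_solution I P \<and>
     (\<Sum>i<num_comm I. dem I i * path_cost I (P i)) \<le> (\<Sum>e<ring_size I. ecost I e * x e) \<and>
     (\<forall>e<ring_size I. edge_load I P e \<le> x e + 13 / 5 * max_demand I)"

text \<open>The factor \<open>p\<close> is \<open>1\<close> for real data and the common denominator
  for the program.\<close>

locale ring_chords = chords n k l r d for n k l r d +
  fixes I :: weighted_ring and p :: real
  assumes wf: "weighted_ring_instance I"
    and nk: "n = ring_size I" "k = num_comm I"
    and lr_eq: "\<And>i. i < k \<Longrightarrow> l i = min (src I i) (snk I i) \<and> r i = max (src I i) (snk I i)"
    and p: "0 < p" and d_eq: "\<And>i. i < k \<Longrightarrow> d i = p * dem I i"
begin

text \<open>\<open>F\<close> tells whether the interval is used; which of the two numbered paths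
  this is depends on the order of the terminals.\<close>

lemma path_choice:
  assumes "i < k"
  shows "(if F = (src I i < snk I i) then path1 I i else path2 I i) = {e. e < n \<and> inside i e = F}"
proof -
  have st: "src I i < n" "snk I i < n" "src I i \<noteq> snk I i"
    using wf assms unfolding weighted_ring_instance_def nk by auto
  have ins: "inside i e \<longleftrightarrow> min (src I i) (snk I i) \<le> e \<and> e < max (src I i) (snk I i)" for e
    unfolding inside_def using lr_eq[OF assms] by simp
  show ?thesis
  proof (cases "src I i < snk I i")
    case True
    then have "path1 I i = {src I i..<snk I i}" "path2 I i = {..<n} - {src I i..<snk I i}"
      using arc_less[OF True st(2)] arc_greater[OF True st(2)] by (auto simp: path1_def path2_def nk)
    moreover have "inside i e \<longleftrightarrow> e \<in> {src I i..<snk I i}" for e using True by (simp add: ins)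
    moreover have "{src I i..<snk I i} \<subseteq> {..<n}" using st by auto
    ultimately show ?thesis using True by (cases F) auto
  next
    case False
    then have lt: "snk I i < src I i" using st by simp
    then have "path2 I i = {snk I i..<src I i}" "path1 I i = {..<n} - {snk I i..<src I i}"
      using arc_less[OF lt st(1)] arc_greater[OF lt st(1)] by (auto simp: path1_def path2_def nk)
    moreover have "inside i e \<longleftrightarrow> e \<in> {snk I i..<src I i}" for e using lt by (simp add: ins)
    moreover have "{snk I i..<src I i} \<subseteq> {..<n}" using st by auto
    ultimately show ?thesis using False by (cases F) auto
  qed
qed

lemma choice_solution:
  assumes b: "feasible {..<k} X b" and X: "\<And>e. e < n \<Longrightarrow> X e = p * x e"
    and y: "\<And>i. i < k \<Longrightarrow> y i = (if F i then d i else 0)"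
    and cost: "(\<Sum>i<k. y i * gain c i) \<le> (\<Sum>i<k. b i * gain c i)" and c: "\<And>e. e < n \<Longrightarrow> c e = p * ecost I e"
    and load: "\<forall>e<n. load {..<k} y e \<le> X e + 13 / 5 * Dm" "Dm \<le> p * max_demand I"
    and P: "\<And>i. i < k \<Longrightarrow> P i = (if F i = (src I i < snk I i) then path1 I i else path2 I i)"
  shows "ring_solution I x P"
  unfolding ring_solution_def
proof (intro conjI)
  have P': "P i = {e. e < n \<and> inside i e = F i}" if "i < k" for i
    using P[OF that] path_choice[OF that, of "F i"] by simp
  show "unsplittable_solution I P" unfolding unsplittable_solution_def using P nk by auto
  have el: "p * edge_load I P e = load {..<k} y e" if "e < n" for e
  proof -
    have "p * edge_load I P e = (\<Sum>i<k. if e \<in> P i then d i else 0)"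
      unfolding edge_load_def nk[symmetric] sum_distrib_left
      by (rule sum.mono_neutral_cong_left) (auto simp: d_eq)
    also have "\<dots> = load {..<k} y e"
      unfolding load_def using that by (intro sum.cong) (auto simp: P' y)
    finally show ?thesis .
  qed
  have c0: "0 \<le> c e" if "e < n" for e
    using wf that p by (simp add: c weighted_ring_instance_def nk)
  \<comment> \<open>Demands and costs each carry a factor \<open>p\<close>.\<close>
  have "p * p * (\<Sum>i<k. dem I i * path_cost I (P i)) = (\<Sum>e<n. c e * load {..<k} y e)"
  proof -
    have "p * p * (\<Sum>i<k. dem I i * path_cost I (P i)) = (\<Sum>i<k. d i * (p * path_cost I (P i)))"
      unfolding sum_distrib_left by (intro sum.cong) (auto simp: d_eq)
    also have "\<dots> = (\<Sum>i<k. \<Sum>e<n. if e \<in> P i then d i * c e else 0)"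
    proof (rule sum.cong)
      fix i assume "i \<in> {..<k}"
      then have "P i \<subseteq> {..<n}" by (auto simp: P')
      then have "(\<Sum>e<n. if e \<in> P i then d i * c e else 0) = (\<Sum>e\<in>P i. d i * c e)"
        by (simp add: sum.inter_restrict[symmetric] Int_absorb1)
      also have "\<dots> = d i * (p * path_cost I (P i))"
        unfolding path_cost_def sum_distrib_left using \<open>P i \<subseteq> {..<n}\<close> by (intro sum.cong) (auto simp: c)
      finally show "d i * (p * path_cost I (P i)) = (\<Sum>e<n. if e \<in> P i then d i * c e else 0)" by simp
    qed simp
    also have "\<dots> = (\<Sum>e<n. \<Sum>i<k. if e \<in> P i then d i * c e else 0)" by (rule sum.swap)
    also have "\<dots> = (\<Sum>e<n. c e * load {..<k} y e)"
      unfolding load_def sum_distrib_left by (intro sum.cong) (auto simp: P' y)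
    finally show ?thesis .
  qed
  also have "\<dots> \<le> (\<Sum>e<n. c e * load {..<k} b e)" unfolding cost_load using cost by simp
  \<comment> \<open>This is where nonnegative costs enter: the loads of \<open>b\<close> are bounded
    by the given ones but need not equal them.\<close>
  also have "\<dots> \<le> (\<Sum>e<n. c e * X e)"
    using b c0 by (intro sum_mono mult_left_mono) (auto simp: feasible_def)
  also have "\<dots> = p * p * (\<Sum>e<n. ecost I e * x e)"
    unfolding sum_distrib_left by (intro sum.cong) (auto simp: c X)
  finally show "(\<Sum>i<num_comm I. dem I i * path_cost I (P i)) \<le> (\<Sum>e<ring_size I. ecost I e * x e)"
    using p by (simp add: nk)
  show "\<forall>e<ring_size I. edge_load I P e \<le> x e + 13 / 5 * max_demand I"
  proof (intro allI impI)
    fix e assume "e < ring_size I"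
    then have e: "e < n" by (simp add: nk)
    have "p * edge_load I P e \<le> p * x e + 13 / 5 * (p * max_demand I)"
      using load(1) e load(2) unfolding el[OF e] by (force simp: X)
    also have "\<dots> = p * (x e + 13 / 5 * max_demand I)" by (simp add: algebra_simps)
    finally show "edge_load I P e \<le> x e + 13 / 5 * max_demand I" using p by simp
  qed
qed

lemma dem_le: "i < k \<Longrightarrow> dem I i \<le> max_demand I"
  unfolding max_demand_def nk by (rule Max_ge) auto

text \<open>The amount is the share of whichever path is the interval; it reproduces the given loads
  exactly.\<close>

lemma fractional_feasible:
  assumes "x \<in> fractional_solutions I"
  shows "\<exists>a. feasible {..<k} (\<lambda>e. p * x e) a"
proof -
  obtain lam where lam: "\<And>i. i < k \<Longrightarrow> 0 \<le> lam i \<and> lam i \<le> 1"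
    and x: "\<And>e. e < n \<Longrightarrow> x e = (\<Sum>i | i < k \<and> e \<in> path1 I i. lam i * dem I i) + (\<Sum>i | i < k \<and> e \<in> path2 I i. (1 - lam i) * dem I i)"
    using assms unfolding fractional_solutions_def nk by blast
  define a where "a i = (if src I i < snk I i then lam i * d i else (1 - lam i) * d i)" for i
  have p1: "path1 I i = {e. e < n \<and> inside i e = (src I i < snk I i)}"
    "path2 I i = {e. e < n \<and> inside i e = (\<not> src I i < snk I i)}" if "i < k" for i
    using path_choice[OF that, of "src I i < snk I i"] path_choice[OF that, of "\<not> src I i < snk I i"] by auto
  have "load {..<k} a e = p * x e" if e: "e < n" for e
  proof -
    have "(\<Sum>i | i < k \<and> e \<in> path1 I i. lam i * dem I i) = (\<Sum>i<k. if e \<in> path1 I i then lam i * dem I i else 0)"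
      by (rule sum.mono_neutral_cong_left) auto
    moreover have "(\<Sum>i | i < k \<and> e \<in> path2 I i. (1 - lam i) * dem I i) = (\<Sum>i<k. if e \<in> path2 I i then (1 - lam i) * dem I i else 0)"
      by (rule sum.mono_neutral_cong_left) auto
    ultimately have "p * x e = (\<Sum>i<k. p * ((if e \<in> path1 I i then lam i * dem I i else 0) + (if e \<in> path2 I i then (1 - lam i) * dem I i else 0)))"
      unfolding x[OF e] by (simp add: sum.distrib sum_distrib_left distrib_left)
    also have "\<dots> = load {..<k} a e"
      unfolding load_def using e by (intro sum.cong) (auto simp: p1 a_def d_eq algebra_simps)
    finally show ?thesis by simp
  qed
  moreover have "0 \<le> a i \<and> a i \<le> d i" if "i < k" for i
  proof -
    have "0 \<le> lam i * d i" "lam i * d i \<le> d i"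
      using lam[OF that] d_nonneg[OF that] by (auto intro: mult_left_le_one_le)
    then show ?thesis by (simp add: a_def left_diff_distrib)
  qed
  ultimately show ?thesis by (auto simp: feasible_def intro!: exI[of _ a])
qed

end

section \<open>Existence for real data\<close>

text \<open>Floor or ceiling of \<open>2 ^ k * b / d\<close>, according to the sign of
  \<open>g\<close>.\<close>

lemma real_numerator:
  assumes "0 \<le> b" "b \<le> d" "0 < d"
  shows "\<exists>N :: int. 0 \<le> N \<and> N \<le> 2 ^ k \<and> \<bar>real_of_int N * d - 2 ^ k * b\<bar> \<le> d \<and>
    real_of_int N * d * g \<le> 2 ^ k * b * g"
proof -
  define q where "q = 2 ^ k * b / d"
  have qd: "2 ^ k * b = q * d" using assms(3) by (simp add: q_def)
  have "0 \<le> q" using assms by (simp add: q_def)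
  moreover have "q \<le> 2 ^ k" using assms by (simp add: q_def pos_divide_le_eq)
  then have "q \<le> real_of_int (2 ^ k)" by simp
  ultimately have pos: "0 \<le> \<lfloor>q\<rfloor>" "\<lfloor>q\<rfloor> \<le> 2 ^ k" "0 \<le> \<lceil>q\<rceil>" "\<lceil>q\<rceil> \<le> 2 ^ k"
    using floor_mono[of q "real_of_int (2 ^ k)"] by (simp_all only: zero_le_floor floor_of_int ceiling_le zero_le_ceiling)
  have dist: "\<bar>real_of_int N * d - 2 ^ k * b\<bar> \<le> d" if "\<bar>real_of_int N - q\<bar> \<le> 1" for N
  proof -
    have "\<bar>real_of_int N * d - 2 ^ k * b\<bar> = \<bar>real_of_int N - q\<bar> * d"
      using assms(3) unfolding qd by (simp only: left_diff_distrib[symmetric] abs_mult abs_of_pos)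
    then show ?thesis using mult_right_mono[OF that, of d] assms(3) by simp
  qed
  show ?thesis
  proof (cases "0 \<le> g")
    case True
    have f: "real_of_int \<lfloor>q\<rfloor> \<le> q" "q < real_of_int \<lfloor>q\<rfloor> + 1" by linarith+
    then have "real_of_int \<lfloor>q\<rfloor> * d \<le> 2 ^ k * b" unfolding qd using assms(3) by (intro mult_right_mono) auto
    then have "real_of_int \<lfloor>q\<rfloor> * d * g \<le> 2 ^ k * b * g" using True by (rule mult_right_mono)
    moreover have "\<bar>real_of_int \<lfloor>q\<rfloor> - q\<bar> \<le> 1" using f by linarith
    ultimately show ?thesis using pos dist by blast
  next
    case False
    have f: "q \<le> real_of_int \<lceil>q\<rceil>" "real_of_int \<lceil>q\<rceil> < q + 1" by linarith+
    then have "2 ^ k * b \<le> real_of_int \<lceil>q\<rceil> * d" unfolding qd using assms(3) by (intro mult_right_mono) auto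
    then have "real_of_int \<lceil>q\<rceil> * d * g \<le> 2 ^ k * b * g" using False by (intro mult_right_mono_neg) auto
    moreover have "\<bar>real_of_int \<lceil>q\<rceil> - q\<bar> \<le> 1" using f by linarith
    ultimately show ?thesis using pos dist by blast
  qed
qed

lemma (in chords) rounding_exists:
  assumes "feasible {..<k} X a" "0 < k" and Dm: "\<And>i. i < k \<Longrightarrow> d i \<le> Dm"
  shows "\<exists>b y. feasible {..<k} X b \<and> (\<forall>i<k. y i \<in> {0, d i}) \<and>
    (\<Sum>i<k. y i * gain c i) \<le> (\<Sum>i<k. b i * gain c i) \<and> (\<forall>e<n. load {..<k} y e \<le> X e + 13 / 5 * Dm)"
proof -
  obtain b where b: "feasible {..<k} X b"
    and cr: "\<forall>i<k. \<forall>j<k. i \<noteq> j \<longrightarrow> b i \<notin> {0, d i} \<longrightarrow> b j \<notin> {0, d j} \<longrightarrow> crossing i j"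
    using feasible_crossing_exists[OF assms(1)] by blast
  have bd: "0 \<le> b i \<and> b i \<le> d i" if "i < k" for i using b that by (simp add: feasible_def)
  define R where "R = {i. i < k \<and> b i \<notin> {0, d i}}"
  have R: "R \<subseteq> {..<k}" by (auto simp: R_def)
  have Rk: "i < k" "0 < d i" if "i \<in> R" for i
    using that bd[of i] by (auto simp: R_def less_le)
  have crR: "crossing i j" if "i \<in> R" "j \<in> R" "i \<noteq> j" for i j using cr that by (auto simp: R_def)
  show ?thesis
  proof (cases "R = {}")
    case True
    have "0 \<le> Dm" using Dm[OF assms(2)] d_nonneg[OF assms(2)] by simp
    then have "\<forall>e<n. load {..<k} b e \<le> X e + 13 / 5 * Dm" using b by (force simp: feasible_def)
    moreover have "\<forall>i<k. b i \<in> {0, d i}" using True by (auto simp: R_def)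
    ultimately show ?thesis using b by (intro exI[of _ b]) auto
  next
    case False
    then obtain i0 where i0: "i0 \<in> R" by blast
    have Dm0: "0 < Dm" using Rk[OF i0] Dm[of i0] by simp
    have inj: "inj_on l R" by (rule inj_onI) (use crR in \<open>force simp: crossing_def\<close>)
    \<comment> \<open>Scaled demands are at most \<open>10 * k\<close> and are rounded with error at
      most 1; over \<open>k\<close> commodities the errors add up to at most a tenth of
      \<open>M * Dm\<close>.\<close>
    define M where "M = 10 * real k / Dm"
    have M: "0 < M" "M * Dm = 10 * real k" using Dm0 assms(2) by (auto simp: M_def)
    define f where "f v = inv_into R l v" for v
    have f: "f (l i) = i" if "i \<in> R" for i using inj that by (simp add: f_def)
    define D where "D = 10 * int k"
    define dd where "dd v = (if v \<in> l ` R then \<lfloor>M * d (f v)\<rfloor> else 0)" for v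
    define H where "H v = (if v \<in> l ` R then 1 * d (f v) * gain c (f v) else 0)" for v
    have "\<forall>i\<in>R. \<exists>N :: int. 0 \<le> N \<and> N \<le> 2 ^ k \<and> \<bar>real_of_int N * d i - 2 ^ k * b i\<bar> \<le> d i \<and>
        real_of_int N * d i * gain c i \<le> 2 ^ k * b i * gain c i"
      using real_numerator bd Rk by blast
    then obtain N0 :: "nat \<Rightarrow> int" where N0: "\<And>i. i \<in> R \<Longrightarrow> 0 \<le> N0 i \<and> N0 i \<le> 2 ^ k \<and>
        \<bar>real_of_int (N0 i) * d i - 2 ^ k * b i\<bar> \<le> d i \<and> real_of_int (N0 i) * d i * gain c i \<le> 2 ^ k * b i * gain c i"
      by metis
    define N where "N v = (if v \<in> l ` R then N0 (f v) else 0)" for v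
    have dd0: "0 \<le> dd v \<and> dd v \<le> D" for v
    proof (cases "v \<in> l ` R")
      case True
      then obtain i where i: "i \<in> R" "v = l i" by blast
      have "M * d i \<le> M * Dm" using M(1) Dm Rk[OF i(1)] by (intro mult_left_mono) auto
      then have "\<lfloor>M * d i\<rfloor> \<le> D" unfolding M(2) D_def by (simp add: floor_le_iff)
      moreover have "0 \<le> M * d i" using M(1) Rk[OF i(1)] by simp
      ultimately show ?thesis using i f by (simp add: dd_def)
    qed (simp add: dd_def D_def)
    have "0 \<le> N v \<and> N v \<le> 2 ^ k" for v using N0 f by (auto simp: N_def)
    then obtain z where z: "halving_inv n k dd D H N k z"
      using halving_exists[of n dd D N k H] dd0 assms(2) by (auto simp: D_def)
    define y where "y i = (if i \<in> R then d i * real_of_int (z (l i)) else b i)" for i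
    have Rd: "i \<in> R \<Longrightarrow> 0 < d i \<and> d i \<le> Dm" for i using Rk Dm by blast
    have bR: "\<And>i. i < k \<Longrightarrow> i \<notin> R \<Longrightarrow> b i \<in> {0, d i}" by (auto simp: R_def)
    have ddM: "\<bar>M * d i - real_of_int (dd (l i))\<bar> \<le> 1" if "i \<in> R" for i
    proof -
      have "dd (l i) = \<lfloor>M * d i\<rfloor>" using that f by (simp add: dd_def)
      then show ?thesis by linarith
    qed
    note RC = round_crossing[OF b R crR bR Rd M(1), of 1 1 D dd H c N z y]
    have NR: "N (l i) = N0 i" if "i \<in> R" for i using that f by (simp add: N_def)
    have "\<forall>i<k. y i \<in> {0, d i}"
      by (rule RC(1)) (use M(2) Dm0 ddM N0 NR f z in \<open>auto simp: D_def H_def dd_def y_def\<close>)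
    moreover have "(\<Sum>i<k. y i * gain c i) \<le> (\<Sum>i<k. b i * gain c i)"
      by (rule RC(2)) (use M(2) Dm0 ddM N0 NR f z in \<open>auto simp: D_def H_def dd_def y_def\<close>)
    moreover have "\<forall>e<n. load {..<k} y e \<le> X e + 13 / 5 * Dm"
      by (rule RC(3)) (use M(2) Dm0 ddM N0 NR f z in \<open>auto simp: D_def H_def dd_def y_def\<close>)
    ultimately show ?thesis using b by blast
  qed
qed

lemma weighted_ring_solution_exists:
  assumes I: "weighted_ring_instance I" and x: "x \<in> fractional_solutions I"
  shows "\<exists>P. ring_solution I x P"
proof -
  define l where "l i = min (src I i) (snk I i)" for i
  define r where "r i = max (src I i) (snk I i)" for i
  interpret ring_chords "ring_size I" "num_comm I" l r "dem I" I 1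
    using I by unfold_locales (auto simp: weighted_ring_instance_def l_def r_def min_def max_def)
  have k: "0 < num_comm I" using I by (simp add: weighted_ring_instance_def)
  obtain a where "feasible {..<num_comm I} (\<lambda>e. 1 * x e) a" using fractional_feasible[OF x] by blast
  from rounding_exists[OF this k dem_le, of "ecost I"]
  obtain b y where b: "feasible {..<num_comm I} (\<lambda>e. 1 * x e) b" and y: "\<forall>i<num_comm I. y i \<in> {0, dem I i}"
    and *: "(\<Sum>i<num_comm I. y i * gain (ecost I) i) \<le> (\<Sum>i<num_comm I. b i * gain (ecost I) i)"
      "\<forall>e<ring_size I. load {..<num_comm I} y e \<le> 1 * x e + 13 / 5 * max_demand I" by blast
  have "ring_solution I x (\<lambda>i. if (y i = dem I i) = (src I i < snk I i) then path1 I i else path2 I i)"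
    by (rule choice_solution[where F = "\<lambda>i. y i = dem I i" and y = y and c = "ecost I" and Dm = "max_demand I", OF b])
      (use y * in auto)
  then show ?thesis by blast
qed


section \<open>Reading the input\<close>

lemma length_frac_code: "length (frac_code r) = 2"
  by (simp add: frac_code_def split: prod.split)

lemma frac_code_rat:
  assumes "r \<in> \<rat>"
  shows "0 < frac_code r ! 1" "real_of_int (frac_code r ! 0) = r * real_of_int (frac_code r ! 1)"
proof -
  obtain q where q: "r = real_of_rat q" using assms by (auto elim: Rats_cases)
  then have the: "(THE q. real_of_rat q = r) = q" by (intro the_equality) auto
  obtain a b where ab: "quotient_of q = (a, b)" by fastforce
  have b: "0 < b" by (rule quotient_of_denom_pos[OF ab])
  have "q = of_int a / of_int b" by (rule quotient_of_div[OF ab])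
  then have r: "r = real_of_int a / real_of_int b" by (simp add: q of_rat_divide)
  have f: "frac_code r = [a, b]" by (simp add: frac_code_def the ab)
  show "0 < frac_code r ! 1" "real_of_int (frac_code r ! 0) = r * real_of_int (frac_code r ! 1)"
    using b unfolding f by (simp_all add: r)
qed

lemma length_concat_map:
  assumes "\<And>i. i < k \<Longrightarrow> length (f i) = w"
  shows "length (concat (map f [0..<k])) = w * k"
  using assms by (induction k) auto

lemma nth_concat_map:
  assumes "\<And>i. i < k \<Longrightarrow> length (f i) = w" "i < k" "j < w"
  shows "concat (map f [0..<k]) ! (w * i + j) = f i ! j"
  using assms
proof (induction k)
  case (Suc k)
  have len: "length (concat (map f [0..<k])) = w * k" using Suc.prems(1) by (intro length_concat_map) auto
  show ?case
  proof (cases "i = k")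
    case True
    then show ?thesis using Suc.prems by (simp add: nth_append len)
  next
    case False
    then have "i < k" using Suc.prems by simp
    then have "w * i + w \<le> w * k" by (metis Suc_leI mult_Suc_right mult_le_mono2 add.commute)
    then have "w * i + j < w * k" using Suc.prems(3) by simp
    then show ?thesis using Suc \<open>i < k\<close> by (simp add: nth_append len)
  qed
qed simp

lemma encode_instance_nth:
  fixes I x
  defines "xs \<equiv> encode_instance (I, x)" and "k \<equiv> num_comm I" and "n \<equiv> ring_size I"
  shows "length xs = 2 + 4 * k + 4 * n" "xs ! 0 = int n" "xs ! 1 = int k"
    "i < k \<Longrightarrow> j < 4 \<Longrightarrow> xs ! (2 + 4 * i + j) = ([int (src I i), int (snk I i)] @ frac_code (dem I i)) ! j"
    "e < n \<Longrightarrow> j < 4 \<Longrightarrow> xs ! (2 + 4 * (k + e) + j) = (frac_code (ecost I e) @ frac_code (x e)) ! j"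
proof -
  define A where "A = concat (map (\<lambda>i. [int (src I i), int (snk I i)] @ frac_code (dem I i)) [0..<k])"
  define B where "B = concat (map (\<lambda>e. frac_code (ecost I e) @ frac_code (x e)) [0..<n])"
  have xs: "xs = [int n, int k] @ A @ B" by (simp add: xs_def encode_instance_def A_def B_def k_def n_def)
  have A: "length A = 4 * k" unfolding A_def by (rule length_concat_map) (simp add: length_frac_code)
  have B: "length B = 4 * n" unfolding B_def by (rule length_concat_map) (simp add: length_frac_code)
  show "length xs = 2 + 4 * k + 4 * n" "xs ! 0 = int n" "xs ! 1 = int k" using A B by (simp_all add: xs)
  show "xs ! (2 + 4 * i + j) = ([int (src I i), int (snk I i)] @ frac_code (dem I i)) ! j" if "i < k" "j < 4"
  proof -
    have "xs ! (2 + 4 * i + j) = A ! (4 * i + j)" using that A by (simp add: xs nth_append)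
    also have "\<dots> = ([int (src I i), int (snk I i)] @ frac_code (dem I i)) ! j"
      unfolding A_def by (rule nth_concat_map) (use that in \<open>simp_all add: length_frac_code\<close>)
    finally show ?thesis .
  qed
  show "xs ! (2 + 4 * (k + e) + j) = (frac_code (ecost I e) @ frac_code (x e)) ! j" if "e < n" "j < 4"
  proof -
    have "xs ! (2 + 4 * (k + e) + j) = B ! (4 * e + j)" using that A by (simp add: xs nth_append)
    also have "\<dots> = (frac_code (ecost I e) @ frac_code (x e)) ! j"
      unfolding B_def by (rule nth_concat_map) (use that in \<open>simp_all add: length_frac_code\<close>)
    finally show ?thesis .
  qed
qed

lemma length_le_input_size: "length xs \<le> input_size xs"
proof (induction xs)
  case (Cons z xs)
  then show ?case using int_size_pos[of z] by (simp add: input_size_def)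
qed simp

lemma bounded_init_mem: "bounded (init_mem xs) (input_size xs)"
  unfolding bounded_def
proof
  fix a
  show "\<bar>init_mem xs a\<bar> \<le> 2 ^ input_size xs"
  proof (cases "0 \<le> a \<and> nat a < length xs")
    case True
    then have "int_size (xs ! nat a) \<in> set (map int_size xs)" by simp
    then have "int_size (xs ! nat a) \<le> input_size xs" unfolding input_size_def by (rule member_le_sum_list) simp
    then have "(2::int) ^ int_size (xs ! nat a) \<le> 2 ^ input_size xs" by (rule power_increasing) simp
    with abs_le_int_size have "\<bar>xs ! nat a\<bar> \<le> 2 ^ input_size xs" by (rule order_trans)
    then show ?thesis using True by (simp add: init_mem_def)
  qed (auto simp: init_mem_def)
qed

lemma init_mem_nat: "i < length xs \<Longrightarrow> init_mem xs (int i) = xs ! i"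
  by (simp add: init_mem_def)

section \<open>The program solves the problem in polynomial time\<close>

text \<open>The quotient \<open>P div b\<close> is exact, so scaling by \<open>P\<close> loses
  nothing.\<close>

lemma scaled_eq:
  assumes "0 < b" "b dvd P" "real_of_int a = r * real_of_int b"
  shows "real_of_int (a * (P div b)) = real_of_int P * r"
  using assms by (simp add: real_of_int_div)

lemma init_prog_spec:
  assumes "2 \<le> length xs"
  defines "m \<equiv> sem init_prog (init_mem xs)"
  shows "ar m 60 0 = xs ! 0" "ar m 61 0 = xs ! 1" "\<And>a. 0 \<le> a \<Longrightarrow> m a = init_mem xs a"
    "\<And>j i. j < 60 \<Longrightarrow> 0 \<le> i \<Longrightarrow> ar m j i = 0"
proof -
  have m: "m = upd (upd (init_mem xs) 60 0 (init_mem xs 0)) 61 0 (init_mem xs 1)"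
    by (simp add: m_def init_prog_def upd_input)
  have "init_mem xs 0 = xs ! 0" "init_mem xs 1 = xs ! 1" using assms(1) by (auto simp: init_mem_def)
  then show "ar m 60 0 = xs ! 0" "ar m 61 0 = xs ! 1" by (simp_all add: m)
  show "m a = init_mem xs a" if "0 \<le> a" for a using that by (simp add: m upd_input)
  show "ar m j i = 0" if "j < 60" "0 \<le> i" for j i
  proof -
    have "ar (init_mem xs) j i = 0" using adr_neg[OF that(2), of j] by (simp add: ar_def init_mem_def del: mem_adr)
    then show ?thesis using that by (simp add: m)
  qed
qed

lemma program_correct:
  assumes wi: "weighted_ring_instance I" and xf: "x \<in> fractional_solutions I" and rat: "rational_data I x"
  defines "xs \<equiv> encode_instance (I, x)"
  defines "m3 \<equiv> sem scale_prog (sem copy_prog (sem init_prog (init_mem xs)))"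
  assumes m4: "\<forall>j<64. j \<noteq> 62 \<longrightarrow> j \<noteq> 3 \<longrightarrow> ar m4 j = ar m3 j" "ar m4 62 0 = int \<beta>" "ar m3 24 0 < 2 ^ \<beta>"
  defines "m7 \<equiv> sem choose_prog (sem level_prog (sem split_prog m4))"
  shows "\<exists>P. (\<forall>i<num_comm I. ar m7 4 (int i) = 1 \<and> P i = path1 I i \<or> ar m7 4 (int i) = 2 \<and> P i = path2 I i) \<and>
    ring_solution I x P"
proof -
  define n where "n = ring_size I"
  define k where "k = num_comm I"
  define m1 where "m1 = sem init_prog (init_mem xs)"
  define m2a where "m2a = sem (For 5 61 copy_comm) m1"
  define m2 where "m2 = sem (For 6 60 copy_edge) m2a"
  have m3: "m3 = sem scale_prog m2" by (simp add: m3_def copy_prog_def m1_def m2a_def m2_def)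
  note E = encode_instance_nth[where I = I and x = x, folded xs_def n_def k_def]
  have "2 \<le> length xs" by (simp add: E)
  note S1 = init_prog_spec[OF this, folded m1_def, unfolded E(2,3)]
  have inpc: "init_mem xs a = ([int (src I i), int (snk I i)] @ frac_code (dem I i)) ! j"
    if "a = 2 + 4 * int i + int j" "i < k" "j < 4" for a i j
  proof -
    have "init_mem xs (int (2 + 4 * i + j)) = xs ! (2 + 4 * i + j)" by (rule init_mem_nat) (use that in \<open>simp add: E(1)\<close>)
    moreover have "int (2 + 4 * i + j) = a" using that(1) by simp
    ultimately show ?thesis using E(4)[OF that(2,3)] by metis
  qed
  have inpe: "init_mem xs a = (frac_code (ecost I e) @ frac_code (x e)) ! j"
    if "a = 2 + 4 * (int k + int e) + int j" "e < n" "j < 4" for a e j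
  proof -
    have "init_mem xs (int (2 + 4 * (k + e) + j)) = xs ! (2 + 4 * (k + e) + j)" by (rule init_mem_nat) (use that in \<open>simp add: E(1)\<close>)
    moreover have "int (2 + 4 * (k + e) + j) = a" using that(1) by simp
    ultimately show ?thesis using E(5)[OF that(2,3)] by metis
  qed
  have comm: "init_mem xs (2 + 4 * int i) = int (src I i)" "init_mem xs (3 + 4 * int i) = int (snk I i)"
    "init_mem xs (4 + 4 * int i) = frac_code (dem I i) ! 0" "init_mem xs (5 + 4 * int i) = frac_code (dem I i) ! 1" if "i < k" for i
    using inpc[of "2 + 4 * int i" i 0] inpc[of "3 + 4 * int i" i 1] inpc[of "4 + 4 * int i" i 2] inpc[of "5 + 4 * int i" i 3] that
    by simp_all
  have edge: "init_mem xs (2 + 4 * (int k + int e)) = frac_code (ecost I e) ! 0" "init_mem xs (3 + 4 * (int k + int e)) = frac_code (ecost I e) ! 1"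
    "init_mem xs (4 + 4 * (int k + int e)) = frac_code (x e) ! 0" "init_mem xs (5 + 4 * (int k + int e)) = frac_code (x e) ! 1" if "e < n" for e
    using inpe[of "2 + 4 * (int k + int e)" e 0] inpe[of "3 + 4 * (int k + int e)" e 1] inpe[of "4 + 4 * (int k + int e)" e 2]
      inpe[of "5 + 4 * (int k + int e)" e 3] that
    by (simp_all add: nth_append length_frac_code)
  note S2 = copy_comm_spec[of m1 k "init_mem xs", OF S1(2,3), folded m2a_def]
  have f2a: "ar m2a j = ar m1 j" if "j < 64" "j \<notin> {5, 10, 11, 12, 13, 19, 20}" for j
    using sem_frame[of "{60, 61}" "For 5 61 copy_comm" j m1] that by (simp add: m2a_def prog_defs)
  have f2: "ar m2 j = ar m2a j" if "j < 64" "j \<notin> {6, 14, 15, 16, 17}" for j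
    using sem_frame[of "{60, 61}" "For 6 60 copy_edge" j m2a] that by (simp add: m2_def prog_defs)
  have f3: "ar m3 j = ar m2 j" if "j < 64" "j \<notin> {3, 5, 6, 18, 21, 22, 23, 24}" for j
    using sem_frame[of "{60, 61, 12, 13, 14, 15, 16, 17}" scale_prog j m2] that by (simp add: m3 prog_defs)
  have dims: "ar m2a 60 0 = int n" "ar m2a 61 0 = int k" "ar m2 60 0 = int n" "ar m2 61 0 = int k" using S1 by (simp_all add: f2 f2a)
  have C: "ar m2 10 (int i) = int (src I i)" "ar m2 11 (int i) = int (snk I i)" "ar m2 12 (int i) = frac_code (dem I i) ! 0"
    "ar m2 13 (int i) = frac_code (dem I i) ! 1" "ar m2 19 (int i) = int (min (src I i) (snk I i))"
    "ar m2 20 (int i) = int (max (src I i) (snk I i))" if "i < k" for i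
    using S2 that comm[OF that] by (auto simp: f2)
  have raw: "m2a a = init_mem xs a" if "0 \<le> a" for a using S2 that by blast
  note S3 = copy_edge_spec[of m2a n k "init_mem xs", OF dims(1,2) raw, folded m2_def]
  have Ed: "ar m2 14 (int e) = frac_code (ecost I e) ! 0" "ar m2 15 (int e) = frac_code (ecost I e) ! 1"
    "ar m2 16 (int e) = frac_code (x e) ! 0" "ar m2 17 (int e) = frac_code (x e) ! 1" if "e < n" for e
    using S3 that edge[OF that] by auto
  have ratd: "dem I i \<in> \<rat>" if "i < k" for i using rat that by (simp add: rational_data_def k_def)
  have rate: "ecost I e \<in> \<rat>" "x e \<in> \<rat>" if "e < n" for e using rat that by (simp_all add: rational_data_def n_def)
  define Q where "Q = (\<Prod>i<k. ar m2 13 (int i)) * (\<Prod>e<n. ar m2 15 (int e) * ar m2 17 (int e))"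
  define p where "p = real_of_int Q"
  have den: "0 < ar m2 13 (int i)" if "i < k" for i using frac_code_rat(1)[OF ratd[OF that]] by (simp only: C[OF that])
  have dene: "0 < ar m2 15 (int e)" "0 < ar m2 17 (int e)" if "e < n" for e
    using frac_code_rat(1)[OF rate(1)[OF that]] frac_code_rat(1)[OF rate(2)[OF that]] by (simp_all only: Ed[OF that])
  have Q: "0 < Q" unfolding Q_def by (intro mult_pos_pos prod_pos ballI) (simp_all add: den dene)
  have dvd1: "ar m2 13 (int i) dvd Q" if "i < k" for i unfolding Q_def using that by (intro dvd_mult2 dvd_prodI) auto
  have dvd2: "ar m2 15 (int e) dvd Q" "ar m2 17 (int e) dvd Q" if "e < n" for e
  proof -
    have "ar m2 15 (int e) * ar m2 17 (int e) dvd (\<Prod>e<n. ar m2 15 (int e) * ar m2 17 (int e))"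
      by (rule dvd_prodI[of "{..<n}" e "\<lambda>e. ar m2 15 (int e) * ar m2 17 (int e)"]) (use that in auto)
    then have "ar m2 15 (int e) * ar m2 17 (int e) dvd Q" unfolding Q_def by (rule dvd_mult)
    then show "ar m2 15 (int e) dvd Q" "ar m2 17 (int e) dvd Q" by (auto dest: dvd_mult_left dvd_mult_right)
  qed
  note S4 = scale_spec[of m2 n k, OF dims(3,4), folded m3 Q_def]
  define D where "D i = ar m3 21 (int i)" for i
  define X0 where "X0 e = ar m3 23 (int e)" for e
  have D: "real_of_int (D i) = p * dem I i" if "i < k" for i
    unfolding D_def p_def using S4(1) that dvd1[OF that]
    by (simp only: C) (intro scaled_eq frac_code_rat ratd, auto)
  have X0: "real_of_int (X0 e) = p * x e" if "e < n" for e
    unfolding X0_def p_def using S4(4) that dvd2[OF that]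
    by (simp only: Ed) (intro scaled_eq frac_code_rat rate, auto)
  have cost: "real_of_int (ar m3 22 (int e)) = p * ecost I e" if "e < n" for e
    unfolding p_def using S4(4) that dvd2[OF that]
    by (simp only: Ed) (intro scaled_eq frac_code_rat rate, auto)
  have p: "0 < p" using Q by (simp add: p_def)
  define l where "l i = min (src I i) (snk I i)" for i
  define r where "r i = max (src I i) (snk I i)" for i
  have lr: "l i < r i" "r i < n" if "i < k" for i
    using wi that by (auto simp: weighted_ring_instance_def l_def r_def n_def k_def min_def max_def)
  have D0: "0 \<le> real_of_int (D i)" if "i < k" for i
    using wi that p by (simp add: D weighted_ring_instance_def k_def)
  interpret int_chords n k l r D X0
    by unfold_locales (use lr D0 in auto)
  interpret ring_chords n k l r "\<lambda>i. real_of_int (D i)" I p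
    by unfold_locales (use wi p D in \<open>auto simp: n_def k_def l_def r_def\<close>)
  obtain a where "feasible {..<k} (\<lambda>e. p * x e) a" using fractional_feasible[OF xf] by blast
  then have a: "feasible {..<k} (\<lambda>e. real_of_int (X0 e)) a" by (auto simp: feasible_def X0)
  have f4: "ar m4 j = ar m3 j" if "j < 64" "j \<notin> {3, 62}" for j using m4(1) that by auto
  \<comment> \<open>Cells beyond the input start at \<open>0\<close>: this marks all commodities as
    not fixed and provides the default for vertices that are no left end.\<close>
  have zero: "ar m3 j (int i) = 0" if "j \<in> {26, 32, 33, 34}" for j i
    using that S1(4)[of j "int i"] by (auto simp: f3 f2 f2a)
  have st: "statics m4" using dims C by (simp add: statics_def f4 f3 D_def l_def r_def)
  define m5 where "m5 = sem split_prog m4"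
  define m6 where "m6 = sem level_prog m5"
  have f5: "ar m5 j = ar m4 j" if "j < 20" "j \<notin> {3, 5, 6, 7}" for j
    using sem_frame[of "{60, 61, 19, 20, 21, 22, 23}" split_prog j m4] that by (simp add: m5_def prog_defs)
  have f6: "ar m6 j = ar m5 j" if "j < 20" "j \<notin> {3, 6, 8, 9}" for j
    using sem_frame[of "{60, 61, 62}" level_prog j m5] that by (simp add: m6_def prog_defs)
  have k61: "ar m6 61 0 = int k"
    using sem_frame[of "{60, 61, 19, 20, 21, 22, 23}" split_prog 61 m4] sem_frame[of "{60, 61, 62}" level_prog 61 m5] dims
    by (simp add: m6_def m5_def prog_defs f4 f3)
  define F where "F i \<longleftrightarrow> 0 < (if ar m6 26 (int i) \<le> 0 then ar m6 32 (ar m6 19 (int i)) else ar m6 28 (int i))" for i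
  define y where "y i = (if F i then real_of_int (D i) else 0)" for i
  define c where "c e = real_of_int (ar m4 22 (int e))" for e
  have "\<exists>b. feasible {..<k} (\<lambda>e. real_of_int (X0 e)) b \<and> (\<Sum>i<k. y i * gain c i) \<le> (\<Sum>i<k. b i * gain c i) \<and>
    (\<forall>e<n. load {..<k} y e \<le> real_of_int (X0 e) + 13 / 5 * real_of_int (ar m4 24 0))"
    unfolding y_def[abs_def] F_def c_def[abs_def] m6_def m5_def
    by (rule split_level_spec[OF st, where \<beta> = \<beta>]) (use S4(1,2) a zero m4(2,3) in \<open>auto simp: f4 X0_def D_def\<close>)
  then obtain b where b: "feasible {..<k} (\<lambda>e. real_of_int (X0 e)) b" "(\<Sum>i<k. y i * gain c i) \<le> (\<Sum>i<k. b i * gain c i)"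
    "\<forall>e<n. load {..<k} y e \<le> real_of_int (X0 e) + 13 / 5 * real_of_int (ar m4 24 0)" by blast
  have k0: "0 < k" using wi by (simp add: weighted_ring_instance_def k_def)
  have "0 \<le> dem I 0" using wi k0 by (simp add: weighted_ring_instance_def k_def)
  then have max0: "0 \<le> max_demand I" using dem_le[OF k0] by simp
  \<comment> \<open>The stored maximum starts from \<open>0\<close>, so it is \<open>0\<close> or
    one of the scaled demands.\<close>
  have DM: "real_of_int (ar m4 24 0) \<le> p * max_demand I"
  proof (cases "ar m3 24 0 = 0")
    case True
    then show ?thesis using p max0 by (simp add: f4)
  next
    case False
    then obtain i where i: "i < k" "ar m3 24 0 = D i" using S4(1,3) by (auto simp: D_def)
    then have "real_of_int (ar m4 24 0) = p * dem I i" using D by (simp add: f4)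
    then show ?thesis using dem_le[OF i(1)] p by (simp add: mult_left_mono)
  qed
  define P where "P i = (if F i = (src I i < snk I i) then path1 I i else path2 I i)" for i
  have "ring_solution I x P"
    by (rule choice_solution[where F = F, OF b(1) X0 _ b(2) _ b(3) DM]) (auto simp: y_def c_def f4 cost P_def)
  moreover have "ar m7 4 (int i) = 1 \<and> P i = path1 I i \<or> ar m7 4 (int i) = 2 \<and> P i = path2 I i" if "i < k" for i
  proof -
    have "m7 = sem choose_prog m6" by (simp add: m7_def m6_def m5_def)
    then have "ar m7 4 (int i) = (if F i = (ar m6 10 (int i) < ar m6 11 (int i)) then 1 else 2)"
      using choose_spec[OF k61] that by (simp add: F_def)
    moreover have "ar m6 10 (int i) = int (src I i)" "ar m6 11 (int i) = int (snk I i)"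
      using C that by (simp_all add: f6 f5 f4 f3)
    ultimately show ?thesis by (auto simp: P_def)
  qed
  ultimately show ?thesis unfolding k_def by blast
qed

section \<open>Size and time bounds across the phases\<close>

definition grow :: "cm \<Rightarrow> nat \<Rightarrow> nat \<Rightarrow> nat" where
  "grow c K B = B + work c K * (B + 1)"

definition ctime :: "cm \<Rightarrow> nat \<Rightarrow> nat \<Rightarrow> nat" where
  "ctime c K B = work c K * (grow c K B + work c K * (B + 1) + 2)"

text \<open>At the start of a phase the read-only cells are bounded like the rest of the memory, so
  \<open>b\<close> is taken to be \<open>B\<close>. Since the number of phases is constant, the
  composed bounds stay polynomial.\<close>

lemma exec_phase:
  assumes "chk RO c" "RO \<subseteq> {..<64}" "bounded m B" "\<forall>j\<in>RO. 60 \<le> j \<longrightarrow> ar m j 0 \<le> int K"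
  shows "\<exists>r. exec (compile c) m r (sem c m) \<and> r \<le> ctime c K B \<and> bounded (sem c m) (grow c K B)"
  using exec_cm[OF assms(1-3), of B K "grow c K B" "work c K" "grow c K B + work c K * (B + 1) + 2"]
    bounded_ar[OF assms(3)] assms(4) by (auto simp: grow_def ctime_def ro_bounded_def)

lemma poly_bounded_grow: "poly_bounded f \<Longrightarrow> poly_bounded g \<Longrightarrow> poly_bounded (\<lambda>N. grow c (f N) (g N))"
  unfolding grow_def by (intro poly_bounded_add poly_bounded_mult poly_bounded_work poly_bounded_const)

lemma poly_bounded_ctime: "poly_bounded f \<Longrightarrow> poly_bounded g \<Longrightarrow> poly_bounded (\<lambda>N. ctime c (f N) (g N))"
  unfolding ctime_def by (intro poly_bounded_add poly_bounded_mult poly_bounded_work poly_bounded_grow poly_bounded_const)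

definition bits_after_scale :: "nat \<Rightarrow> nat" where
  "bits_after_scale N = grow scale_prog N (grow copy_prog N (grow init_prog N N))"

definition bits_at_output :: "nat \<Rightarrow> nat" where
  "bits_at_output N = grow choose_prog N (grow level_prog (N + bits_after_scale N + 1) (grow split_prog N (bits_after_scale N + 1)))"

definition time_bound :: "nat \<Rightarrow> nat" where
  "time_bound N = ctime init_prog N N + (ctime copy_prog N (grow init_prog N N) +
     (ctime scale_prog N (grow copy_prog N (grow init_prog N N)) +
     ((bits_after_scale N + 3) * (bits_work * (bits_after_scale N + bits_work + 3)) +
     (ctime split_prog N (bits_after_scale N + 1) +
     (ctime level_prog (N + bits_after_scale N + 1) (grow split_prog N (bits_after_scale N + 1)) +
     (ctime choose_prog N (grow level_prog (N + bits_after_scale N + 1) (grow split_prog N (bits_after_scale N + 1))) +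
     (N + 2) * (output_work * (bits_at_output N + output_work + 2))))))))"

lemma poly_bounded_time: "poly_bounded time_bound"
  unfolding time_bound_def[abs_def] bits_at_output_def bits_after_scale_def
  by (intro poly_bounded_add poly_bounded_mult poly_bounded_grow poly_bounded_ctime poly_bounded_const poly_bounded_id)

lemma program_run:
  assumes wi: "weighted_ring_instance I" and xf: "x \<in> fractional_solutions I" and rat: "rational_data I x"
  defines "xs \<equiv> encode_instance (I, x)"
  shows "\<exists>r m. exec ring_program (init_mem xs) r m \<and> r \<le> time_bound (input_size xs) \<and>
    (\<exists>P. encodes_solution I m P \<and> ring_solution I x P)"
proof -
  define N where "N = input_size xs"
  define n where "n = ring_size I"
  define k where "k = num_comm I"
  note E = encode_instance_nth[where I = I and x = x, folded xs_def n_def k_def]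
  have nkN: "n \<le> N" "k \<le> N" using length_le_input_size[of xs] by (auto simp: E(1) N_def)
  define m0 where "m0 = init_mem xs"
  define m1 where "m1 = sem init_prog m0"
  define m2 where "m2 = sem copy_prog m1"
  define m3 where "m3 = sem scale_prog m2"
  have "2 \<le> length xs" by (simp add: E)
  note S1 = init_prog_spec[OF this, folded m0_def, folded m1_def, unfolded E(2,3)]
  have b0: "bounded m0 N" unfolding m0_def N_def by (rule bounded_init_mem)
  obtain r1 where r1: "exec (compile init_prog) m0 r1 m1" "r1 \<le> ctime init_prog N N" "bounded m1 (grow init_prog N N)"
    using exec_phase[OF chk_progs(1) _ b0, of N] by (auto simp: m1_def)
  obtain r2 where r2: "exec (compile copy_prog) m1 r2 m2" "r2 \<le> ctime copy_prog N (grow init_prog N N)"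
    "bounded m2 (grow copy_prog N (grow init_prog N N))"
    using exec_phase[OF chk_progs(2) _ r1(3), of N] S1 nkN by (auto simp: m2_def)
  have nk2: "ar m2 60 0 = int n" "ar m2 61 0 = int k"
    using sem_frame[OF chk_progs(2), of 60 m1] sem_frame[OF chk_progs(2), of 61 m1] S1 by (simp_all add: m2_def prog_defs)
  obtain r3 where r3: "exec (compile scale_prog) m2 r3 m3" "r3 \<le> ctime scale_prog N (grow copy_prog N (grow init_prog N N))"
    "bounded m3 (bits_after_scale N)"
    using exec_phase[OF chk_progs(3) _ r2(3), of N] nk2 nkN by (auto simp: m3_def bits_after_scale_def)
  have nk3: "ar m3 60 0 = int n" "ar m3 61 0 = int k"
    using sem_frame[OF chk_progs(3), of 60 m2] sem_frame[OF chk_progs(3), of 61 m2] nk2 by (simp_all add: m3_def prog_defs)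
  have "0 \<le> ar m3 24 0" using scale_spec(2)[OF nk2] by (simp add: m3_def)
  from exec_bits[OF r3(3) this order_refl] obtain r4 m4 \<beta> where r4: "exec bits_com m3 r4 m4"
    "r4 \<le> (bits_after_scale N + 3) * (bits_work * (bits_after_scale N + bits_work + 3))" "bounded m4 (bits_after_scale N + 1)"
    and m4: "ar m4 62 0 = int \<beta>" "\<beta> \<le> bits_after_scale N + 1" "ar m3 24 0 < 2 ^ \<beta>"
      "\<forall>j<64. j \<noteq> 62 \<longrightarrow> j \<noteq> 3 \<longrightarrow> ar m4 j = ar m3 j" by blast
  define m5 where "m5 = sem split_prog m4"
  define m6 where "m6 = sem level_prog m5"
  define m7 where "m7 = sem choose_prog m6"
  have nk4: "ar m4 60 0 = int n" "ar m4 61 0 = int k" using m4(4) nk3 by simp_all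
  obtain r5 where r5: "exec (compile split_prog) m4 r5 m5" "r5 \<le> ctime split_prog N (bits_after_scale N + 1)"
    "bounded m5 (grow split_prog N (bits_after_scale N + 1))"
    using exec_phase[OF chk_progs(4) _ r4(3), of N] nk4 nkN by (auto simp: m5_def)
  have nk5: "ar m5 60 0 = int n" "ar m5 61 0 = int k" "ar m5 62 0 = int \<beta>"
    using sem_frame[OF chk_progs(4), of 60 m4] sem_frame[OF chk_progs(4), of 61 m4] sem_frame[OF chk_progs(4), of 62 m4] nk4 m4(1)
    by (simp_all add: m5_def prog_defs)
  \<comment> \<open>The bisection loop is bounded by the bit length of the largest scaled demand,
    which can exceed the input size; hence a larger bound on loops in this phase.\<close>
  define K where "K = N + bits_after_scale N + 1"
  obtain r6 where r6: "exec (compile level_prog) m5 r6 m6" "r6 \<le> ctime level_prog K (grow split_prog N (bits_after_scale N + 1))"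
    "bounded m6 (grow level_prog K (grow split_prog N (bits_after_scale N + 1)))"
    using exec_phase[OF chk_progs(5) _ r5(3), of K] nk5 nkN m4(2) by (auto simp: m6_def K_def)
  have nk6: "ar m6 60 0 = int n" "ar m6 61 0 = int k"
    using sem_frame[OF chk_progs(5), of 60 m5] sem_frame[OF chk_progs(5), of 61 m5] nk5 by (simp_all add: m6_def prog_defs)
  obtain r7 where r7: "exec (compile choose_prog) m6 r7 m7"
    "r7 \<le> ctime choose_prog N (grow level_prog K (grow split_prog N (bits_after_scale N + 1)))" "bounded m7 (bits_at_output N)"
    using exec_phase[OF chk_progs(6) _ r6(3), of N] nk6 nkN by (auto simp: m7_def bits_at_output_def K_def)
  have "ar m7 61 0 = int k" using sem_frame[OF chk_progs(6), of 61 m6] nk6 by (simp add: m7_def prog_defs)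
  from exec_output[OF r7(3) this order_refl] obtain r8 m8 where r8: "exec output_com m7 r8 m8"
    "r8 \<le> (k + 2) * (output_work * (bits_at_output N + output_work + 2))" "\<forall>i<k. m8 (int i) = ar m7 4 (int i)" by blast
  have "exec ring_program m0 (r1 + (r2 + (r3 + (r4 + (r5 + (r6 + (r7 + r8))))))) m8"
    unfolding ring_program_def 
    by (rule exec.Seq[OF r1(1) exec.Seq[OF r2(1) exec.Seq[OF r3(1) exec.Seq[OF r4(1) exec.Seq[OF r5(1)
      exec.Seq[OF r6(1) exec.Seq[OF r7(1) r8(1)]]]]]]])
  moreover have "r1 + (r2 + (r3 + (r4 + (r5 + (r6 + (r7 + r8)))))) \<le> time_bound N"
  proof -
    have "r8 \<le> (N + 2) * (output_work * (bits_at_output N + output_work + 2))"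
      using r8(2) nkN(2) by (meson add_le_mono1 mult_le_mono1 order_trans)
    then show ?thesis unfolding time_bound_def
      using r1(2) r2(2) r3(2) r4(2) r5(2) r6(2)[unfolded K_def] r7(2)[unfolded K_def] by (intro add_mono)
  qed
  moreover obtain P where P: "\<forall>i<k. ar m7 4 (int i) = 1 \<and> P i = path1 I i \<or> ar m7 4 (int i) = 2 \<and> P i = path2 I i"
    "ring_solution I x P"
    using program_correct[OF wi xf rat, folded xs_def, folded m0_def, folded m1_def, folded m2_def, folded m3_def, OF m4(4,1,3), folded m5_def, folded m6_def, folded m7_def]
    unfolding k_def by blast
  moreover have "encodes_solution I m8 P" using P(1) r8(3) by (auto simp: encodes_solution_def k_def)
  ultimately show ?thesis unfolding m0_def N_def
    by (intro exI[of _ "r1 + (r2 + (r3 + (r4 + (r5 + (r6 + (r7 + r8))))))"] exI[of _ m8] conjI exI[of _ P]) simp_all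
qed

text \<open>Real data have no finite encoding. Existence is therefore claimed for all real
  instances, and the running time refers to rational ones.\<close>

theorem theorem1p7:
  "(\<forall>I x. weighted_ring_instance I \<and> x \<in> fractional_solutions I \<longrightarrow>
      (\<exists>P. unsplittable_solution I P \<and>
         (\<Sum>i<num_comm I. dem I i * path_cost I (P i)) \<le> (\<Sum>e<ring_size I. ecost I e * x e) \<and>
         (\<forall>e<ring_size I. edge_load I P e \<le> x e + 13 / 5 * max_demand I))) \<and>
   (\<exists>prog. solves_in_poly_time prog encode_instance
      {(I, x). weighted_ring_instance I \<and> x \<in> fractional_solutions I \<and> rational_data I x}
      (\<lambda>(I, x) m. \<exists>P. encodes_solution I m P \<and> unsplittable_solution I P \<and>
         (\<Sum>i<num_comm I. dem I i * path_cost I (P i)) \<le> (\<Sum>e<ring_size I. ecost I e * x e) \<and>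
         (\<forall>e<ring_size I. edge_load I P e \<le> x e + 13 / 5 * max_demand I)))"
  unfolding ring_solution_def[symmetric]
proof (intro conjI allI impI)
  fix I x assume "weighted_ring_instance I \<and> x \<in> fractional_solutions I"
  then show "\<exists>P. ring_solution I x P"
    using weighted_ring_solution_exists by blast
next
  obtain p where p: "\<And>N. time_bound N \<le> poly p N" using poly_bounded_time unfolding poly_bounded_def by blast
  show "\<exists>prog. solves_in_poly_time prog encode_instance
      {(I, x). weighted_ring_instance I \<and> x \<in> fractional_solutions I \<and> rational_data I x}
      (\<lambda>(I, x) m. \<exists>P. encodes_solution I m P \<and> ring_solution I x P)"
    unfolding solves_in_poly_time_def
  proof (rule exI[of _ ring_program], rule exI[of _ p], rule ballI)
    fix X assume "X \<in> {(I, x). weighted_ring_instance I \<and> x \<in> fractional_solutions I \<and> rational_data I x}"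
    then obtain I x where X: "X = (I, x)" "weighted_ring_instance I" "x \<in> fractional_solutions I" "rational_data I x" by blast
    obtain r m where run: "exec ring_program (init_mem (encode_instance X)) r m" "r \<le> time_bound (input_size (encode_instance X))"
      and sol: "\<exists>P. encodes_solution I m P \<and> ring_solution I x P"
      using program_run[OF X(2-4)] unfolding X(1) by blast
    have "r \<le> poly p (input_size (encode_instance X))" using run(2) p by (rule order_trans)
    with run(1) sol show "\<exists>r m. exec ring_program (init_mem (encode_instance X)) r m \<and> r \<le> poly p (input_size (encode_instance X)) \<and>
      (case X of (I, x) \<Rightarrow> \<lambda>m. \<exists>P. encodes_solution I m P \<and> ring_solution I x P) m"
      unfolding X(1) by (intro exI[of _ r] exI[of _ m]) simp
  qed
qed

end
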